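(* Let $e_0,\dots,e_4\in\mathbb{R}[t]$ with $\gcd(e_0,\dots,e_4)=1$ parametrize a spine curve, and let $E,E'\in\mathbb{R}[t]^6$ be the associated vectors, assumed $\mathbb{R}[t]$-linearly independent and with non-constant Plücker map. Let $E_1,E_2$ be a $\mu$-basis of the module $\langle E,E'\rangle$ quasi-generated by $E$ and $E'$, and let $k$ be the degree of the parametrization $t\mapsto E\wedge E'$ of the Plücker curve. Then $$k\cdot\deg\mathcal V(\hat{\mathcal E})=\deg E_1+\deg E_2=\deg(E\wedge E')-\deg q_{E,E'},\qquad q_{E,E'}=\gcd(E\wedge E'),$$ and, with $\hat y=(u,y_0,y_1,y_2,y_3,y_4)$, up to a nonzero constant factor, $$\operatorname{Res}_t\big(E_1\cdot\hat y^T,\ E_2\cdot\hat y^T\big)=F_{\mathcal V(\hat{\mathcal E})}^{\,k},$$ where $F_{\mathcal V(\hat{\mathcal E})}$ is the implicit equation of the dual variety $\mathcal V(\hat{\mathcal E})\subset\mathbb{P}^5$.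
   Context: Write $e=(e_1,e_2,e_3,e_4)$ and $\langle v,w\rangle=v_1w_1+v_2w_2+v_3w_3-v_4w_4$. The spine curve $t\mapsto(e_0:e_1:e_2:e_3:e_4)\in\mathbb{P}^4$ lifts to the curve $\hat{\mathcal E}$ on the Lie quadric $\{-uy_0+y_1^2+y_2^2+y_3^2-y_4^2=0\}\subset\mathbb{P}^5$ given by $t\mapsto(\langle e,e\rangle:e_0^2:e_0e_1:e_0e_2:e_0e_3:e_0e_4)$. Put $$E=\Big(-\tfrac{e_0^2}{2},-\tfrac{\langle e,e\rangle}{2},e_0e_1,e_0e_2,e_0e_3,-e_0e_4\Big)\in\mathbb{R}[t]^6$$ and let $E'=dE/dt$. For $\mathbb{R}[t]$-linearly independent $A,B\in\mathbb{R}[t]^d$, the module quasi-generated by $A,B$ is $M=\langle A,B\rangle=\{aA+bB\in\mathbb{R}[t]^d : a,b\in\mathbb{R}(t)\}$; any linearly independent pair with $\langle A,B\rangle=M$ is called a pair of quasi-generators of $M$. $A\wedge B=([i,j])_{i<j}$, $[i,j]=A_iB_j-A_jB_i$; $\deg(A\wedge B)$ is the maximal degree of the entries and $\gcd(A\wedge B)$ their gcd. $\deg A$ is the maximal degree of the entries of $A$; $\deg M=\min\{\deg(\tilde A\wedge\tilde B):\langle\tilde A,\tilde B\rangle=M\}$; quasi-generators $\tilde A,\tilde B$ form a $\mu$-basis of $M$ if $\deg\tilde A+\deg\tilde B=\deg M$. The Plücker map is $\mathbb{P}^1\dashrightarrow\mathbb{P}^{d(d-1)/2-1}$, $t\mapsto([i,j])_{i<j}$;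 its closed image is the Plücker curve and its degree is the cardinality of the fibre over a generic point of the image (over $\mathbb{C}$). For a parameter $t_0$ let $L(M,t_0)=\{x : C(t_0)\cdot x=0\ \forall\, C\in M\}$, where $C\cdot x=\sum_i C_ix_i$, and $\mathcal S_M=\bigcup_t\mathbb{P}(L(M,t))\subset\mathbb{P}^{d-1}$ ($t\in\mathbb{P}^1$; at $t=\infty$ use leading coefficient vectors). The dual variety of $\hat{\mathcal E}$ is the hypersurface $\mathcal V(\hat{\mathcal E})=\mathcal S_{\langle E,E'\rangle}\subset\mathbb{P}^5$ (here $d=6$); its implicit equation is the irreducible form defining its Zariski closure. $\operatorname{Res}_t$ is the Sylvester resultant with respect to $t$ of polynomials of $t$-degrees $\deg E_1$, $\deg E_2$. *)

theory Defs
  imports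
    Complex_Main
    "HOL-Library.Poly_Mapping"
    "HOL-Computational_Algebra.Polynomial_Factorial"
    "HOL-Computational_Algebra.Field_as_Ring"
    "Subresultants.Resultant_Prelim"
begin

definition vdeg :: "real poly vec \<Rightarrow> nat" where
  "vdeg A = Max (degree ` set\<^sub>v A)"

definition wedge :: "real poly vec \<Rightarrow> real poly vec \<Rightarrow> real poly vec" where
  "wedge A B = vec_of_list
     [A $ i * B $ j - A $ j * B $ i. i \<leftarrow> [0..<dim_vec A], j \<leftarrow> [Suc i..<dim_vec A]]"

definition lin_indep :: "nat \<Rightarrow> real poly vec \<Rightarrow> real poly vec \<Rightarrow> bool" where
  "lin_indep d A B \<longleftrightarrow> A \<in> carrier_vec d \<and> B \<in> carrier_vec d \<and>
     (\<forall>a b. a \<cdot>\<^sub>v A + b \<cdot>\<^sub>v B = 0\<^sub>v d \<longrightarrow> a = 0 \<and> b = 0)"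

definition quasi_span :: "nat \<Rightarrow> real poly vec \<Rightarrow> real poly vec \<Rightarrow> real poly vec set" where
  "quasi_span d A B = {C \<in> carrier_vec d. \<exists>a b :: real poly fract.
     map_vec to_fract C = a \<cdot>\<^sub>v map_vec to_fract A + b \<cdot>\<^sub>v map_vec to_fract B}"

definition quasi_generators ::
  "nat \<Rightarrow> real poly vec \<Rightarrow> real poly vec \<Rightarrow> real poly vec set \<Rightarrow> bool" where
  "quasi_generators d A B M \<longleftrightarrow> lin_indep d A B \<and> quasi_span d A B = M"

definition module_deg :: "nat \<Rightarrow> real poly vec set \<Rightarrow> nat" where
  "module_deg d M = (LEAST n. \<exists>A B. quasi_generators d A B M \<and> n = vdeg (wedge A B))"

definition mu_basis ::
  "nat \<Rightarrow> real poly vec \<Rightarrow> real poly vec \<Rightarrow> real poly vec set \<Rightarrow> bool" where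
  "mu_basis d A B M \<longleftrightarrow> quasi_generators d A B M \<and> vdeg A + vdeg B = module_deg d M"

text \<open>Varieties are complex: parameters and points have complex coordinates.\<close>

definition eval_vec :: "complex \<Rightarrow> real poly vec \<Rightarrow> complex vec" where
  "eval_vec t A = map_vec (\<lambda>p. poly (map_poly complex_of_real p) t) A"

definition proj_point :: "complex vec \<Rightarrow> complex vec set" where
  "proj_point v = {c \<cdot>\<^sub>v v | c. c \<noteq> 0}"

text \<open>
  The Pluecker map is taken on the affine parameters at which some coordinate is nonzero.
  Leaving out the finitely many other points of the parameter line (the roots of the gcd, and
  infinity) changes neither non-constancy nor the fibre over a generic point of the image.
\<close>

definition plucker_dom :: "real poly vec \<Rightarrow> real poly vec \<Rightarrow> complex set" where
  "plucker_dom A B = {t. \<exists>x \<in> set\<^sub>v (eval_vec t (wedge A B)). x \<noteq> 0}"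

definition plucker_map :: "real poly vec \<Rightarrow> real poly vec \<Rightarrow> complex \<Rightarrow> complex vec set" where
  "plucker_map A B t = proj_point (eval_vec t (wedge A B))"

definition plucker_nonconstant :: "real poly vec \<Rightarrow> real poly vec \<Rightarrow> bool" where
  "plucker_nonconstant A B \<longleftrightarrow>
     (\<exists>s \<in> plucker_dom A B. \<exists>t \<in> plucker_dom A B. plucker_map A B s \<noteq> plucker_map A B t)"

definition plucker_degree :: "real poly vec \<Rightarrow> real poly vec \<Rightarrow> nat" where
  "plucker_degree A B = (THE k. finite {p \<in> plucker_map A B ` plucker_dom A B.
     \<not> (finite {t \<in> plucker_dom A B. plucker_map A B t = p} \<and>
        card {t \<in> plucker_dom A B. plucker_map A B t = p} = k)})"

text \<open>
  A polynomial is a finitely supported map from monomials (exponent maps) to coefficients.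
  A subset of projective \<open>(d - 1)\<close>-space is represented by the set of all its homogeneous
  coordinate vectors, that is, by a set of nonzero vectors closed under nonzero scaling.
\<close>

type_synonym 'a mpoly = "(nat \<Rightarrow>\<^sub>0 nat) \<Rightarrow>\<^sub>0 'a"

definition MConst :: "'a \<Rightarrow> 'a::zero mpoly" where
  "MConst c = Poly_Mapping.single 0 c"

definition MVar :: "nat \<Rightarrow> 'a::zero_neq_one mpoly" where
  "MVar i = Poly_Mapping.single (Poly_Mapping.single i 1) 1"

definition cmpoly :: "real mpoly \<Rightarrow> complex mpoly" where
  "cmpoly F = Poly_Mapping.map complex_of_real F"

definition meval :: "complex mpoly \<Rightarrow> complex vec \<Rightarrow> complex" where
  "meval F x = (\<Sum>m\<in>Poly_Mapping.keys F. Poly_Mapping.lookup F m *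
     (\<Prod>i\<in>Poly_Mapping.keys m. (x $ i) ^ Poly_Mapping.lookup m i))"

text \<open>Forms of degree \<open>n\<close> in the \<open>d\<close> variables with index below \<open>d\<close>; this includes \<open>0\<close>.\<close>

definition is_form :: "nat \<Rightarrow> nat \<Rightarrow> complex mpoly \<Rightarrow> bool" where
  "is_form d n F \<longleftrightarrow> (\<forall>m\<in>Poly_Mapping.keys F.
     Poly_Mapping.keys m \<subseteq> {..<d} \<and>
     (\<Sum>i\<in>Poly_Mapping.keys m. Poly_Mapping.lookup m i) = n)"

definition proj_zeros :: "nat \<Rightarrow> complex mpoly \<Rightarrow> complex vec set" where
  "proj_zeros d F = {x \<in> carrier_vec d. x \<noteq> 0\<^sub>v d \<and> meval F x = 0}"

definition zariski_closure :: "nat \<Rightarrow> complex vec set \<Rightarrow> complex vec set" where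
  "zariski_closure d S = {x \<in> carrier_vec d. x \<noteq> 0\<^sub>v d \<and>
     (\<forall>G n. is_form d n G \<and> S \<subseteq> proj_zeros d G \<longrightarrow> meval G x = 0)}"

text \<open>
  Irreducibility is in the polynomial ring in all variables \<open>MVar i\<close>. For \<open>F\<close> in finitely many
  of them this is the same as irreducibility in those, since factors involve no other variables.
\<close>

definition implicit_equation :: "nat \<Rightarrow> complex vec set \<Rightarrow> complex mpoly \<Rightarrow> bool" where
  "implicit_equation d S F \<longleftrightarrow>
     (\<exists>n. is_form d n F) \<and> irreducible F \<and> proj_zeros d F = zariski_closure d S"

definition hypersurface_degree :: "nat \<Rightarrow> complex vec set \<Rightarrow> nat" where
  "hypersurface_degree d S = (THE n. \<exists>F. implicit_equation d S F \<and> is_form d n F)"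

definition module_space :: "nat \<Rightarrow> real poly vec set \<Rightarrow> complex \<Rightarrow> complex vec set" where
  "module_space d M t = {x \<in> carrier_vec d. \<forall>C\<in>M. eval_vec t C \<bullet> x = 0}"

definition leading_vec :: "real poly vec \<Rightarrow> complex vec" where
  "leading_vec C = map_vec (\<lambda>p. complex_of_real (coeff p (vdeg C))) C"

definition module_space_inf :: "nat \<Rightarrow> real poly vec set \<Rightarrow> complex vec set" where
  "module_space_inf d M = {x \<in> carrier_vec d. \<forall>C\<in>M. leading_vec C \<bullet> x = 0}"

definition swept_variety :: "nat \<Rightarrow> real poly vec set \<Rightarrow> complex vec set" where
  "swept_variety d M = ((\<Union>t. module_space d M t) \<union> module_space_inf d M) - {0\<^sub>v d}"

text \<open>\<open>A \<bullet> y\<close> for the vector \<open>y\<close> of variables, as a polynomial in \<open>t\<close> with coefficients in \<open>\<real>[y]\<close>\<close>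

definition moving_form :: "real poly vec \<Rightarrow> real mpoly poly" where
  "moving_form A = (\<Sum>i<dim_vec A. Polynomial.smult (MVar i) (map_poly MConst (A $ i)))"

definition lie_form :: "real poly list \<Rightarrow> real poly" where
  "lie_form v = v ! 0 * v ! 0 + v ! 1 * v ! 1 + v ! 2 * v ! 2 - v ! 3 * v ! 3"

text \<open>
  \<open>spine_vec \<bullet> y\<close> is the polar form of the Lie quadric
  \<open>- u y0 + y1^2 + y2^2 + y3^2 - y4^2 = 0\<close> at the lifted point
  \<open>(<e, e> : e0^2 : e0 e1 : e0 e2 : e0 e3 : e0 e4)\<close>, where \<open>y = (u, y0, y1, y2, y3, y4)\<close> are
  the variables number 0, ..., 5.
\<close>

definition spine_vec ::
  "real poly \<Rightarrow> real poly \<Rightarrow> real poly \<Rightarrow> real poly \<Rightarrow> real poly \<Rightarrow> real poly vec" where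
  "spine_vec e0 e1 e2 e3 e4 = vec_of_list
     [Polynomial.smult (- 1 / 2) (e0 ^ 2), Polynomial.smult (- 1 / 2) (lie_form [e1, e2, e3, e4]),
      e0 * e1, e0 * e2, e0 * e3, - (e0 * e4)]"

text \<open>
  The equations \<open>E \<bullet> y = E' \<bullet> y = 0\<close> say that the polar hyperplane of \<open>y\<close> is tangent to
  the lifted curve, hence the name.
\<close>

definition dual_variety ::
  "real poly \<Rightarrow> real poly \<Rightarrow> real poly \<Rightarrow> real poly \<Rightarrow> real poly \<Rightarrow> complex vec set" where
  "dual_variety e0 e1 e2 e3 e4 = swept_variety 6
     (quasi_span 6 (spine_vec e0 e1 e2 e3 e4) (map_vec pderiv (spine_vec e0 e1 e2 e3 e4)))"

end

theory Submission
  imports Defs "HOL-Computational_Algebra.Fundamental_Theorem_Algebra" "HOL-Library.Countable_Set"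
    "HOL-Analysis.Continuum_Not_Denumerable"
begin

text \<open>
  At every parameter, infinity included, the values of a \<open>\<mu>\<close>-basis are linearly independent, so the
  resultant vanishes at \<open>x\<close> exactly when \<open>x\<close> lies in one of the subspaces \<open>L(M, t)\<close>, of codimension two.
  The points of these subspaces are polynomially parametrized, hence their vanishing ideal is prime
  and the resultant is a power of one irreducible form \<open>P\<close>.

  To find the exponent, restrict to a generic pencil \<open>y + s q\<close>. The \<open>deg E1 + deg E2\<close> parameters \<open>t\<close>
  whose subspace meets the pencil are the roots of one polynomial, and each of them determines a
  value of \<open>s\<close>. Parameters in one fibre of the Pluecker map have the same subspace and the same \<open>s\<close>; if
  different fibres have different \<open>s\<close>, the roots of the restricted resultant all have multiplicity \<open>k\<close>.
  This separation is where it matters that \<open>M\<close> is spanned by \<open>E\<close> and \<open>E'\<close>: by a generic projection of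
  the curve \<open>E\<close> to a plane it becomes the biduality theorem for plane curves.
\<close>

section \<open>Multivariate polynomials\<close>

text \<open>Two obstacles shape the proof. Lines through a point \<open>q\<close> with nonzero
  resultant only show that the resultant is a \<open>k\<close>-th power on each generic line; these
  roots have to be assembled into one polynomial. Normalized to constant term 1, a root has
  coefficients given by a recursion that divides only by positive integers, so they depend
  polynomially on the direction of the line. Divisibility by \<open>P\<close> is likewise proved on
  pencils, by division by a monic family, whose quotient again depends polynomially on the base
  point. The other obstacle is genericity. Most generic choices ask finitely many polynomial
  functions not to vanish, which is possible since polynomials over \<complex> form a domain. A
  projection that is generically as injective as the curve, however, has to separate infinitely many
  pairs of points. It is taken from the moment curve \<open>(1, \<mu>, \<mu>^2, ...)\<close>, where
  each pair excludes only finitely many \<open>\<mu>\<close>, so that countably many pairs can be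
  separated at once.\<close>

definition mp_hom :: "('a::zero \<Rightarrow> 'b) \<Rightarrow> ((nat \<Rightarrow>\<^sub>0 nat) \<Rightarrow> 'b) \<Rightarrow> 'a mpoly \<Rightarrow> 'b::comm_ring_1" where
  "mp_hom h g F = (\<Sum>m\<in>Poly_Mapping.keys F. h (Poly_Mapping.lookup F m) * g m)"

lemma mp_hom_superset:
  assumes "finite S" "Poly_Mapping.keys F \<subseteq> S" "h 0 = 0"
  shows "mp_hom h g F = (\<Sum>m\<in>S. h (Poly_Mapping.lookup F m) * g m)"
  unfolding mp_hom_def using assms
  by (intro sum.mono_neutral_left) (auto simp: in_keys_iff)

lemma mp_hom_zero [simp]: "mp_hom h g 0 = 0"
  by (simp add: mp_hom_def)

lemma mp_hom_single:
  assumes "h 0 = 0"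
  shows "mp_hom h g (Poly_Mapping.single m c) = h c * g m"
  using assms by (cases "c = 0") (auto simp: mp_hom_def)

lemma mp_hom_add:
  assumes "h 0 = 0" "\<And>a b. h (a + b) = h a + h b"
  shows "mp_hom h g (F + G) = mp_hom h g F + mp_hom h g G"
proof -
  let ?S = "Poly_Mapping.keys F \<union> Poly_Mapping.keys G"
  have "mp_hom h g (F + G) = (\<Sum>m\<in>?S. h (Poly_Mapping.lookup (F + G) m) * g m)"
    by (rule mp_hom_superset) (use keys_add[of F G] assms in auto)
  also have "\<dots> = (\<Sum>m\<in>?S. h (Poly_Mapping.lookup F m) * g m) + (\<Sum>m\<in>?S. h (Poly_Mapping.lookup G m) * g m)"
    by (simp add: lookup_add assms distrib_right sum.distrib)
  also have "(\<Sum>m\<in>?S. h (Poly_Mapping.lookup F m) * g m) = mp_hom h g F"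
    by (rule mp_hom_superset[symmetric]) (use assms in auto)
  also have "(\<Sum>m\<in>?S. h (Poly_Mapping.lookup G m) * g m) = mp_hom h g G"
    by (rule mp_hom_superset[symmetric]) (use assms in auto)
  finally show ?thesis .
qed

lemma mp_hom_sum:
  assumes "h 0 = 0" "\<And>a b. h (a + b) = h a + h b"
  shows "mp_hom h g (sum f S) = (\<Sum>i\<in>S. mp_hom h g (f i))"
  by (induction S rule: infinite_finite_induct) (simp_all add: mp_hom_add[of h, OF assms])

lemma mpoly_sum_singles:
  "F = (\<Sum>m\<in>Poly_Mapping.keys F. Poly_Mapping.single m (Poly_Mapping.lookup F m))"
proof (rule poly_mapping_eqI)
  fix k
  have "(\<Sum>m\<in>Poly_Mapping.keys F. Poly_Mapping.lookup (Poly_Mapping.single m (Poly_Mapping.lookup F m)) k)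
      = (\<Sum>m\<in>Poly_Mapping.keys F. if m = k then Poly_Mapping.lookup F m else 0)"
    by (intro sum.cong) (auto simp: lookup_single when_def)
  also have "\<dots> = Poly_Mapping.lookup F k"
    by (simp add: sum.delta in_keys_iff)
  finally show "Poly_Mapping.lookup F k = Poly_Mapping.lookup
      (\<Sum>m\<in>Poly_Mapping.keys F. Poly_Mapping.single m (Poly_Mapping.lookup F m)) k"
    by (simp add: lookup_sum)
qed

text \<open>Expansion into terms reduces this to products of two terms. Evaluation
  \<open>mev\<close>, the grading \<open>graded\<close> and the extension of scalars
  \<open>cmpoly\<close> are all instances, so one computation makes each of them
  multiplicative.\<close>

lemma mp_hom_mult:
  assumes h0: "h 0 = 0" and ha: "\<And>a b. h (a + b) = h a + h b" and hm: "\<And>a b. h (a * b) = h a * h b"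
    and g: "\<And>m m'. g (m + m') = g m * g m'"
  shows "mp_hom h g (F * G) = mp_hom h g F * mp_hom h g (G :: 'a::comm_ring_1 mpoly)"
proof -
  let ?s = "\<lambda>F m. Poly_Mapping.single m (Poly_Mapping.lookup F m) :: 'a mpoly"
  have "F * G = (\<Sum>m\<in>Poly_Mapping.keys F. \<Sum>m'\<in>Poly_Mapping.keys G. ?s F m * ?s G m')"
    by (subst (1) mpoly_sum_singles[of F], subst (1) mpoly_sum_singles[of G]) (simp add: sum_product)
  then have "mp_hom h g (F * G) = (\<Sum>m\<in>Poly_Mapping.keys F. \<Sum>m'\<in>Poly_Mapping.keys G. mp_hom h g (?s F m * ?s G m'))"
    by (simp add: mp_hom_sum[of h, OF h0 ha])
  also have "mp_hom h g (?s F m * ?s G m') =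
      (h (Poly_Mapping.lookup F m) * g m) * (h (Poly_Mapping.lookup G m') * g m')" for m m'
    by (simp add: mult_single mp_hom_single[of h, OF h0] hm g mult_ac)
  then have "(\<Sum>m\<in>Poly_Mapping.keys F. \<Sum>m'\<in>Poly_Mapping.keys G. mp_hom h g (?s F m * ?s G m'))
      = mp_hom h g F * mp_hom h g G"
    by (simp add: mp_hom_def sum_product)
  finally show ?thesis .
qed

lemma MConst_simps: "MConst 0 = 0" "MConst 1 = 1" "MConst (a + b) = MConst a + MConst b"
    "MConst (a * b) = MConst a * MConst b"
  by (simp_all add: MConst_def single_add mult_single)

lemma MConst_power: "MConst (a ^ n) = MConst a ^ n"
  for a :: "'a::comm_ring_1" by (induction n) (simp_all add: MConst_simps)

lemma prod_lookup_superset: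
  assumes "finite S" "Poly_Mapping.keys m \<subseteq> S"
  shows "(\<Prod>i\<in>Poly_Mapping.keys m. f i ^ Poly_Mapping.lookup m i) = (\<Prod>i\<in>S. f i ^ Poly_Mapping.lookup m i)"
  using assms by (intro prod.mono_neutral_left) (auto simp: in_keys_iff)

definition mmon :: "(nat \<Rightarrow> 'a) \<Rightarrow> (nat \<Rightarrow>\<^sub>0 nat) \<Rightarrow> 'a::comm_ring_1" where
  "mmon x m = (\<Prod>i\<in>Poly_Mapping.keys m. x i ^ Poly_Mapping.lookup m i)"

lemma mmon_add: "mmon x (m + m') = mmon x m * mmon x m'"
proof -
  let ?S = "Poly_Mapping.keys m \<union> Poly_Mapping.keys m'"
  have "mmon x (m + m') = (\<Prod>i\<in>?S. x i ^ Poly_Mapping.lookup (m + m') i)"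
    unfolding mmon_def by (rule prod_lookup_superset) (use keys_add[of m m'] in auto)
  also have "\<dots> = (\<Prod>i\<in>?S. x i ^ Poly_Mapping.lookup m i) * (\<Prod>i\<in>?S. x i ^ Poly_Mapping.lookup m' i)"
    by (simp add: lookup_add power_add prod.distrib)
  also have "\<dots> = mmon x m * mmon x m'"
    unfolding mmon_def by (simp add: prod_lookup_superset[of ?S m] prod_lookup_superset[of ?S m'])
  finally show ?thesis .
qed

definition mev :: "complex mpoly \<Rightarrow> (nat \<Rightarrow> complex) \<Rightarrow> complex" where
  "mev F x = mp_hom (\<lambda>c. c) (mmon x) F"

lemma meval_eq_mev: "meval F v = mev F (\<lambda>i. v $ i)"
  by (simp add: meval_def mev_def mp_hom_def mmon_def)

lemma mev_simps [simp]:
  "mev 0 x = 0" "mev 1 x = 1" "mev (F + G) x = mev F x + mev G x" "mev (F * G) x = mev F x * mev G x"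
  "mev (MConst c) x = c" "mev (MVar i) x = x i"
proof -
  show "mev (F * G) x = mev F x * mev G x"
    unfolding mev_def by (rule mp_hom_mult) (simp_all add: mmon_add)
qed (simp_all add: mev_def mp_hom_add MConst_def MVar_def mp_hom_single mmon_def flip: single_one)

lemma mev_uminus [simp]: "mev (- F) x = - mev F x"
  using mev_simps(3)[of F "- F" x] by (simp add: add_eq_0_iff)

lemma mev_power [simp]: "mev (F ^ n) x = mev F x ^ n"
  by (induction n) simp_all

lemma mev_sum [simp]: "mev (sum f S) x = (\<Sum>i\<in>S. mev (f i) x)"
  by (induction S rule: infinite_finite_induct) simp_all

definition vars_below :: "nat \<Rightarrow> 'a::zero mpoly \<Rightarrow> bool" where
  "vars_below d F \<longleftrightarrow> (\<forall>m\<in>Poly_Mapping.keys F. Poly_Mapping.keys m \<subseteq> {..<d})"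

lemma vars_below_add: "vars_below d F \<Longrightarrow> vars_below d G \<Longrightarrow> vars_below d (F + G)"
  unfolding vars_below_def using keys_add[of F G] by blast

lemma vars_below_mult: "vars_below d F \<Longrightarrow> vars_below d G \<Longrightarrow> vars_below d (F * G)"
  unfolding vars_below_def
proof
  fix m assume a: "\<forall>m\<in>Poly_Mapping.keys F. Poly_Mapping.keys m \<subseteq> {..<d}"
    "\<forall>m\<in>Poly_Mapping.keys G. Poly_Mapping.keys m \<subseteq> {..<d}" "m \<in> Poly_Mapping.keys (F * G)"
  then obtain m1 m2 where "m = m1 + m2" "m1 \<in> Poly_Mapping.keys F" "m2 \<in> Poly_Mapping.keys G"
    using keys_mult[of F G] by auto
  then show "Poly_Mapping.keys m \<subseteq> {..<d}" using a keys_add[of m1 m2] by blast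
qed

lemma vars_below_const [simp]: "vars_below d (MConst c)" "vars_below d 0" "vars_below d 1"
  by (auto simp: vars_below_def MConst_def)

lemma vars_below_var: "i < d \<Longrightarrow> vars_below d (MVar i)"
  by (auto simp: vars_below_def MVar_def)

lemma vars_below_power: "vars_below d F \<Longrightarrow> vars_below d (F ^ n)"
  by (induction n) (auto intro: vars_below_mult)

lemma vars_below_uminus: "vars_below d F \<Longrightarrow> vars_below d (- F)"
  by (auto simp: vars_below_def in_keys_iff)

lemma vars_below_diff:
  fixes F G :: "'a::comm_ring_1 mpoly"
  shows "vars_below d F \<Longrightarrow> vars_below d G \<Longrightarrow> vars_below d (F - G)"
  using vars_below_add[of d F "- G"] vars_below_uminus[of d G] by simp

lemma mev_cong:
  assumes "vars_below d F" "\<And>i. i < d \<Longrightarrow> x i = y i"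
  shows "mev F x = mev F y"
proof -
  have "mmon x m = mmon y m" if "m \<in> Poly_Mapping.keys F" for m
  proof -
    have "Poly_Mapping.keys m \<subseteq> {..<d}" using assms(1) that by (simp add: vars_below_def)
    then show ?thesis unfolding mmon_def using assms(2) by (intro prod.cong refl) (simp add: subset_eq)
  qed
  then show ?thesis by (simp add: mev_def mp_hom_def)
qed

text \<open>Residue and quotient modulo \<open>N\<close> recover the lowest digit and the number
  formed by the others. In Kronecker's substitution the digits are the exponents of a
  monomial.\<close>

lemma digits_inj:
  fixes a b :: "nat \<Rightarrow> nat"
  assumes "\<And>i. i < d \<Longrightarrow> a i < N" "\<And>i. i < d \<Longrightarrow> b i < N" "(\<Sum>i<d. a i * N ^ i) = (\<Sum>i<d. b i * N ^ i)" "i < d"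
  shows "a i = b i"
  using assms
proof (induction d arbitrary: a b i)
  case (Suc d)
  have split: "(\<Sum>i<Suc d. c i * N ^ i) = c 0 + N * (\<Sum>i<d. c (Suc i) * N ^ i)" for c :: "nat \<Rightarrow> nat"
    by (simp only: sum.lessThan_Suc_shift) (simp add: sum_distrib_left mult_ac)
  have eq: "a 0 + N * (\<Sum>i<d. a (Suc i) * N ^ i) = b 0 + N * (\<Sum>i<d. b (Suc i) * N ^ i)"
    using Suc.prems(3) by (simp only: split)
  have lt: "a 0 < N" "b 0 < N" using Suc.prems by auto
  have "a 0 = b 0" using arg_cong[OF eq, of "\<lambda>z. z mod N"] lt by simp
  moreover have "(\<Sum>i<d. a (Suc i) * N ^ i) = (\<Sum>i<d. b (Suc i) * N ^ i)"
    using arg_cong[OF eq, of "\<lambda>z. z div N"] lt by simp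
  then have "a (Suc j) = b (Suc j)" if "j < d" for j
    using Suc.IH[of "\<lambda>i. a (Suc i)" "\<lambda>i. b (Suc i)" j] Suc.prems(1,2) that by simp
  ultimately show ?case using Suc.prems(4) by (cases i) auto
qed simp

lemma mev_eq_0_imp:
  assumes vb: "vars_below d F" and z: "\<And>x. mev F x = 0"
  shows "F = 0"
proof (rule ccontr)
  assume "F \<noteq> 0"
  define K where "K = Poly_Mapping.keys F"
  \<comment> \<open>\<open>N\<close> exceeds all exponents in \<open>F\<close>, so they are digits
    in base \<open>N\<close>; the inserted 0 keeps the maximum defined when
    \<open>d = 0\<close>.\<close>
  define N where "N = Suc (Max (insert 0 ((\<lambda>(m, i). Poly_Mapping.lookup m i) ` (K \<times> {..<d}))))"
  have finK: "finite K" by (simp add: K_def)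
  have N: "Poly_Mapping.lookup m i < N" if "m \<in> K" "i < d" for m i
    unfolding N_def less_Suc_eq_le using that finK by (intro Max_ge) (auto intro!: rev_image_eqI[of "(m,i)"])
  define e where "e m = (\<Sum>i<d. Poly_Mapping.lookup m i * N ^ i)" for m
  have inj: "inj_on e K"
  proof (rule inj_onI)
    fix m m' assume m: "m \<in> K" "m' \<in> K" "e m = e m'"
    show "m = m'"
    proof (rule poly_mapping_eqI)
      fix i
      show "Poly_Mapping.lookup m i = Poly_Mapping.lookup m' i"
      proof (cases "i < d")
        case True
        then show ?thesis using digits_inj[of d "Poly_Mapping.lookup m" N "Poly_Mapping.lookup m'" i] m N
          by (simp add: e_def)
      next
        case False
        then have "i \<notin> Poly_Mapping.keys m" "i \<notin> Poly_Mapping.keys m'" using vb m by (auto simp: vars_below_def K_def)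
        then show ?thesis by (simp add: in_keys_iff)
      qed
    qed
  qed
  \<comment> \<open>Kronecker's substitution \<open>x i = z ^ (N ^ i)\<close> separates the monomials.\<close>
  define p where "p = (\<Sum>m\<in>K. monom (Poly_Mapping.lookup F m) (e m))"
  have "poly p z = 0" for z
  proof -
    have "mmon (\<lambda>i. z ^ N ^ i) m = z ^ e m" if "m \<in> K" for m
    proof -
      have "mmon (\<lambda>i. z ^ N ^ i) m = (\<Prod>i<d. (z ^ N ^ i) ^ Poly_Mapping.lookup m i)"
        unfolding mmon_def by (rule prod_lookup_superset) (use vb that in \<open>auto simp: vars_below_def K_def\<close>)
      also have "\<dots> = z ^ e m"
        by (simp add: e_def power_sum mult.commute flip: power_mult)
      finally show ?thesis .
    qed
    then have "poly p z = mev F (\<lambda>i. z ^ N ^ i)"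
      by (simp add: p_def poly_sum poly_monom mev_def mp_hom_def K_def)
    then show ?thesis using z by simp
  qed
  then have p0: "p = 0" using poly_all_0_iff_0 by blast
  obtain m where m: "m \<in> K" using \<open>F \<noteq> 0\<close> by (metis K_def ex_in_conv keys_eq_empty)
  have "coeff p (e m) = (\<Sum>m'\<in>K. if m' = m then Poly_Mapping.lookup F m' else 0)"
    unfolding p_def coeff_sum coeff_monom using inj m by (intro sum.cong) (auto dest: inj_onD)
  also have "\<dots> = Poly_Mapping.lookup F m" using m finK by simp
  finally show False using m p0 by (simp add: K_def in_keys_iff)
qed

lemma mev_eqI:
  assumes "vars_below d F" "vars_below d G" "\<And>x. mev F x = mev G x"
  shows "F = G"
proof -
  have "mev (F - G) x = 0" for x
    using mev_simps(3)[of F "- G" x] assms(3) by simp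
  then have "F - G = 0" using mev_eq_0_imp[OF vars_below_diff[OF assms(1,2)]] by blast
  then show ?thesis by simp
qed

section \<open>Homogeneity and its inheritance by factors\<close>

definition weight :: "nat set \<Rightarrow> (nat \<Rightarrow>\<^sub>0 nat) \<Rightarrow> nat" where
  "weight S m = (\<Sum>i\<in>Poly_Mapping.keys m \<inter> S. Poly_Mapping.lookup m i)"

lemma weight_add: "weight S (m + m') = weight S m + weight S m'"
proof -
  let ?K = "(Poly_Mapping.keys m \<union> Poly_Mapping.keys m') \<inter> S"
  have sup: "weight S m'' = (\<Sum>i\<in>?K. Poly_Mapping.lookup m'' i)"
    if "Poly_Mapping.keys m'' \<subseteq> Poly_Mapping.keys m \<union> Poly_Mapping.keys m'" for m''
    unfolding weight_def using that by (intro sum.mono_neutral_left) (auto simp: in_keys_iff)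
  show ?thesis using keys_add[of m m'] by (simp add: sup lookup_add sum.distrib)
qed

definition homog :: "nat set \<Rightarrow> nat \<Rightarrow> 'a::zero mpoly \<Rightarrow> bool" where
  "homog S n F \<longleftrightarrow> (\<forall>m\<in>Poly_Mapping.keys F. weight S m = n)"

text \<open>The result of multiplying every variable with index in \<open>S\<close> by one new
  variable; the coefficients are the homogeneous components of \<open>F\<close>.\<close>

definition graded :: "nat set \<Rightarrow> complex mpoly \<Rightarrow> complex mpoly poly" where
  "graded S = mp_hom (\<lambda>c. [:MConst c:]) (\<lambda>m. monom (Poly_Mapping.single m 1) (weight S m))"

lemma graded_mult: "graded S (F * G) = graded S F * graded S G"
  unfolding graded_def
  by (rule mp_hom_mult) (simp_all add: MConst_simps weight_add mult_monom mult_single)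

lemma graded_eq: "graded S F = (\<Sum>m\<in>Poly_Mapping.keys F. monom (Poly_Mapping.single m (Poly_Mapping.lookup F m)) (weight S m))"
  by (simp add: graded_def mp_hom_def MConst_def smult_monom mult_single)

lemma homog_iff_graded: "homog S n F \<longleftrightarrow> graded S F = monom F n"
proof
  assume h: "homog S n F"
  have "graded S F = (\<Sum>m\<in>Poly_Mapping.keys F. monom (Poly_Mapping.single m (Poly_Mapping.lookup F m)) n)"
    unfolding graded_eq using h by (intro sum.cong) (auto simp: homog_def)
  also have "\<dots> = monom (\<Sum>m\<in>Poly_Mapping.keys F. Poly_Mapping.single m (Poly_Mapping.lookup F m)) n"
    by (simp add: poly_eq_iff coeff_sum)
  finally show "graded S F = monom F n" using mpoly_sum_singles[of F] by simp
next
  assume g: "graded S F = monom F n"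
  show "homog S n F"
    unfolding homog_def
  proof (rule ballI, rule ccontr)
    fix m assume m: "m \<in> Poly_Mapping.keys F" "weight S m \<noteq> n"
    have "Poly_Mapping.lookup (coeff (graded S F) (weight S m)) m =
        (\<Sum>m'\<in>Poly_Mapping.keys F. if m' = m then Poly_Mapping.lookup F m' else 0)"
      unfolding graded_eq coeff_sum lookup_sum
      by (intro sum.cong) (auto simp: lookup_single when_def)
    also have "\<dots> = Poly_Mapping.lookup F m" using m by simp
    finally show False using m g by (simp add: in_keys_iff)
  qed
qed

lemma coeff_graded:
  "Poly_Mapping.lookup (coeff (graded S F) j) m = (if weight S m = j then Poly_Mapping.lookup F m else 0)"
proof -
  have "Poly_Mapping.lookup (coeff (graded S F) j) m =
      (\<Sum>m'\<in>Poly_Mapping.keys F. if m' = m then (if weight S m = j then Poly_Mapping.lookup F m else 0) else 0)"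
    unfolding graded_eq coeff_sum lookup_sum
    by (intro sum.cong) (auto simp: lookup_single when_def)
  also have "\<dots> = (if weight S m = j then Poly_Mapping.lookup F m else 0)"
    by (simp add: in_keys_iff)
  finally show ?thesis .
qed

text \<open>Reflection is multiplicative and strips powers of the variable. The reflected factors of
  a monomial are therefore constants, so \<open>p\<close> has no coefficient below its leading
  one.\<close>

lemma monom_factor:
  fixes p q :: "'a::idom poly"
  assumes "p * q = monom c n" "c \<noteq> 0"
  shows "p = monom (lead_coeff p) (degree p)"
proof -
  have nz: "p \<noteq> 0" "q \<noteq> 0" using assms by (auto simp: monom_eq_0_iff[symmetric])
  have "degree (reflect_poly (monom c n)) = 0"
    using assms(2) by (induction n) (auto simp: monom_0 monom_Suc reflect_poly_pCons')
  then have "degree (reflect_poly p * reflect_poly q) = 0"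
    by (simp add: assms(1) flip: reflect_poly_mult)
  then have d: "degree (reflect_poly p) = 0"
    using nz by (subst (asm) degree_mult_eq) auto
  have "coeff p j = 0" if "j < degree p" for j
  proof -
    have "coeff p j = coeff (reflect_poly p) (degree p - j)"
      using that by (subst coeff_reflect_poly) auto
    also have "\<dots> = 0" using d that by (intro coeff_eq_0) auto
    finally show ?thesis .
  qed
  then show ?thesis
    by (intro poly_eqI) (metis coeff_eq_0 coeff_monom linorder_neqE_nat)
qed

text \<open>Under \<open>graded\<close>, a factorization of a homogeneous polynomial becomes a
  factorization of a monomial over a domain.\<close>

lemma homog_factor:
  fixes F G :: "complex mpoly"
  assumes "homog S n (F * G)" "F * G \<noteq> 0"
  shows "\<exists>a b. homog S a F \<and> homog S b G \<and> a + b = n"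
proof -
  have e: "graded S F * graded S G = monom (F * G) n"
    using assms(1) by (simp add: homog_iff_graded graded_mult)
  have hom: "homog S a H" if "graded S H = monom c a" for a c H
  proof -
    have "weight S m = a" if "m \<in> Poly_Mapping.keys H" for m
    proof (rule ccontr)
      assume "weight S m \<noteq> a"
      then have "coeff (graded S H) (weight S m) = 0" using \<open>graded S H = monom c a\<close> by simp
      then show False using coeff_graded[of S H "weight S m" m] that by (simp add: in_keys_iff)
    qed
    then show ?thesis by (simp add: homog_def)
  qed
  have 1: "graded S F = monom (lead_coeff (graded S F)) (degree (graded S F))"
    by (rule monom_factor[OF e assms(2)])
  have 2: "graded S G = monom (lead_coeff (graded S G)) (degree (graded S G))"
    by (rule monom_factor[where q = "graded S F" and n = n, OF _ assms(2)]) (simp add: mult.commute[of "graded S G"] e)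
  have "graded S F \<noteq> 0" "graded S G \<noteq> 0" using e assms(2) by (auto simp: monom_eq_0_iff[symmetric])
  then have "degree (graded S F) + degree (graded S G) = n"
    using arg_cong[OF e, of degree] assms(2) by (simp add: degree_mult_eq degree_monom_eq)
  then show ?thesis using hom[OF 1] hom[OF 2] by blast
qed

text \<open>The bound on the variables is also a homogeneity condition, of weight 0 in the excluded
  variables; hence \<open>homog_factor\<close> covers both halves of \<open>is_form\<close>.\<close>

lemma is_form_iff_homog: "is_form d n F \<longleftrightarrow> homog UNIV n F \<and> homog {d..} 0 F"
proof -
  have "(Poly_Mapping.keys m \<subseteq> {..<d}) = (weight {d..} m = 0)" for m
  proof -
    have "weight {d..} m = 0 \<longleftrightarrow> Poly_Mapping.keys m \<inter> {d..} = {}"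
      unfolding weight_def by (subst sum_eq_0_iff) (auto simp: in_keys_iff)
    then show ?thesis by (auto simp: disjoint_iff not_le)
  qed
  then show ?thesis unfolding is_form_def homog_def by (auto simp: weight_def)
qed

lemma is_form_factor:
  assumes "is_form d n (F * G)" "F * G \<noteq> 0"
  shows "\<exists>a b. is_form d a F \<and> is_form d b G \<and> a + b = n"
proof -
  obtain a b where 1: "homog UNIV a F" "homog UNIV b G" "a + b = n"
    using homog_factor[of UNIV n F G] assms by (auto simp: is_form_iff_homog)
  obtain a' b' where 2: "homog {d..} a' F" "homog {d..} b' G" "a' + b' = 0"
    using homog_factor[of "{d..}" 0 F G] assms by (auto simp: is_form_iff_homog)
  then show ?thesis using 1 by (auto simp: is_form_iff_homog)
qed

lemma is_form_vars_below: "is_form d n F \<Longrightarrow> vars_below d F"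
  by (auto simp: is_form_def vars_below_def)

lemma is_form_unique:
  assumes "is_form d n F" "is_form d n' F" "F \<noteq> 0"
  shows "n = n'"
proof -
  obtain m where "m \<in> Poly_Mapping.keys F" using assms(3) by (metis ex_in_conv keys_eq_empty)
  then show ?thesis using assms(1,2) by (auto simp: is_form_def)
qed

lemma is_form_0_const:
  assumes "is_form d 0 F"
  shows "F = MConst (Poly_Mapping.lookup F 0)"
proof -
  have "m = 0" if "m \<in> Poly_Mapping.keys F" for m
  proof -
    have "(\<Sum>i\<in>Poly_Mapping.keys m. Poly_Mapping.lookup m i) = 0" using assms that by (auto simp: is_form_def)
    then show ?thesis by (auto simp: in_keys_iff intro!: poly_mapping_eqI)
  qed
  then show ?thesis
    by (intro poly_mapping_eqI) (auto simp: MConst_def lookup_single when_def in_keys_iff)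
qed

lemma is_form_simps:
  "is_form d n 0" "is_form d 0 (MConst c)" "is_form d 0 1" "i < d \<Longrightarrow> is_form d 1 (MVar i)"
  by (auto simp: is_form_def MConst_def MVar_def)

lemma is_form_add: "is_form d n F \<Longrightarrow> is_form d n G \<Longrightarrow> is_form d n (F + G)"
  unfolding is_form_def using keys_add[of F G] by blast

lemma is_form_sum: "(\<And>i. i \<in> S \<Longrightarrow> is_form d n (f i)) \<Longrightarrow> is_form d n (sum f S)"
  by (induction S rule: infinite_finite_induct) (auto intro: is_form_add is_form_simps)

lemma is_form_mult: "is_form d a F \<Longrightarrow> is_form d b G \<Longrightarrow> is_form d (a + b) (F * G)"
proof -
  assume a: "is_form d a F" "is_form d b G"
  have "homog S (a + b) (F * G)" if "homog S a F" "homog S b G" for S a b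
    unfolding homog_def
  proof
    fix m assume "m \<in> Poly_Mapping.keys (F * G)"
    then obtain m1 m2 where "m = m1 + m2" "m1 \<in> Poly_Mapping.keys F" "m2 \<in> Poly_Mapping.keys G"
      using keys_mult[of F G] by auto
    then show "weight S m = a + b" using that by (auto simp: homog_def weight_add)
  qed
  from this[of UNIV] this[of "{d..}" 0 0] a show ?thesis by (auto simp: is_form_iff_homog)
qed

lemma is_form_power: "is_form d a F \<Longrightarrow> is_form d (n * a) (F ^ n)"
  by (induction n) (auto intro: is_form_mult is_form_simps)

lemma is_form_prod:
  "finite S \<Longrightarrow> (\<And>i. i \<in> S \<Longrightarrow> is_form d 1 (f i)) \<Longrightarrow> is_form d (card S) (prod f S)"
proof (induction S rule: finite_induct)
  case (insert x S)
  then show ?case using is_form_mult[of d 1 "f x" "card S" "prod f S"] by simp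
qed (auto intro: is_form_simps)

lemma mev_scale:
  assumes "is_form d n F"
  shows "mev F (\<lambda>i. c * x i) = c ^ n * mev F x"
proof -
  have "mmon (\<lambda>i. c * x i) m = c ^ n * mmon x m" if "m \<in> Poly_Mapping.keys F" for m
    using assms that by (auto simp: mmon_def power_mult_distrib prod.distrib is_form_def simp flip: power_sum)
  then show ?thesis by (simp add: mev_def mp_hom_def sum_distrib_left mult_ac)
qed

lemma MConst_dvd_1: "c \<noteq> 0 \<Longrightarrow> MConst c dvd (1 :: complex mpoly)"
  by (rule dvdI[of _ _ "MConst (inverse c)"]) (simp add: MConst_simps flip: MConst_simps(4) MConst_simps(2))

section \<open>Polynomial functions and families of polynomials\<close>

text \<open>Working with functions lets closure rules show that determinants, products and values of
  families are polynomial; \<open>polyfun_imp_mev\<close> recovers a polynomial where divisibility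
  or degree matters.\<close>

inductive polyfun :: "nat \<Rightarrow> ((nat \<Rightarrow> complex) \<Rightarrow> complex) \<Rightarrow> bool" for d where
  const: "polyfun d (\<lambda>x. c)"
| coord: "i < d \<Longrightarrow> polyfun d (\<lambda>x. x i)"
| add: "polyfun d f \<Longrightarrow> polyfun d g \<Longrightarrow> polyfun d (\<lambda>x. f x + g x)"
| mult: "polyfun d f \<Longrightarrow> polyfun d g \<Longrightarrow> polyfun d (\<lambda>x. f x * g x)"

lemma polyfun_sum: "(\<And>i. i \<in> S \<Longrightarrow> polyfun d (f i)) \<Longrightarrow> polyfun d (\<lambda>x. \<Sum>i\<in>S. f i x)"
  by (induction S rule: infinite_finite_induct) (auto intro: polyfun.intros)

lemma polyfun_prod: "(\<And>i. i \<in> S \<Longrightarrow> polyfun d (f i)) \<Longrightarrow> polyfun d (\<lambda>x. \<Prod>i\<in>S. f i x)"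
  by (induction S rule: infinite_finite_induct) (auto intro: polyfun.intros)

lemma polyfun_power: "polyfun d f \<Longrightarrow> polyfun d (\<lambda>x. f x ^ n)"
  by (induction n) (auto intro: polyfun.intros)

lemma polyfun_uminus: "polyfun d f \<Longrightarrow> polyfun d (\<lambda>x. - f x)"
  using polyfun.mult[OF polyfun.const[of d "-1"], of f] by simp

lemma polyfun_diff: "polyfun d f \<Longrightarrow> polyfun d g \<Longrightarrow> polyfun d (\<lambda>x. f x - g x)"
  using polyfun.add[OF _ polyfun_uminus[of d g], of f] by simp

lemmas polyfun_intros = polyfun.intros polyfun_sum polyfun_prod polyfun_power polyfun_uminus polyfun_diff

lemma polyfun_mev: "vars_below d F \<Longrightarrow> polyfun d (mev F)"
proof -
  assume v: "vars_below d F"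
  have "polyfun d (\<lambda>x. \<Sum>m\<in>Poly_Mapping.keys F. Poly_Mapping.lookup F m *
      (\<Prod>i\<in>Poly_Mapping.keys m. x i ^ Poly_Mapping.lookup m i))"
    using v by (intro polyfun_intros) (auto simp: vars_below_def)
  moreover have "mev F = (\<lambda>x. \<Sum>m\<in>Poly_Mapping.keys F. Poly_Mapping.lookup F m *
      (\<Prod>i\<in>Poly_Mapping.keys m. x i ^ Poly_Mapping.lookup m i))"
    by (simp add: mev_def mp_hom_def mmon_def fun_eq_iff)
  ultimately show ?thesis by simp
qed

lemma polyfun_imp_mev:
  assumes "polyfun d f"
  obtains F where "vars_below d F" "f = mev F"
proof -
  have "\<exists>F. vars_below d F \<and> f = mev F"
    using assms
  proof induction
    case (const c)
    then show ?case by (intro exI[of _ "MConst c"]) (auto simp: fun_eq_iff)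
  next
    case (coord i)
    then show ?case by (intro exI[of _ "MVar i"]) (auto simp: fun_eq_iff vars_below_var)
  next
    case (add f g)
    then obtain F G where "vars_below d F \<and> f = mev F" "vars_below d G \<and> g = mev G" by blast
    then show ?case by (intro exI[of _ "F + G"]) (auto simp: fun_eq_iff vars_below_add)
  next
    case (mult f g)
    then obtain F G where "vars_below d F \<and> f = mev F" "vars_below d G \<and> g = mev G" by blast
    then show ?case by (intro exI[of _ "F * G"]) (auto simp: fun_eq_iff vars_below_mult)
  qed
  then show ?thesis using that by blast
qed

text \<open>Irreducibility of affine space: the product of the two polynomials is nonzero, so it has
  a nonzero value.\<close>

lemma polyfun_mult_nonzero:
  assumes "polyfun d f" "polyfun d g" "f x \<noteq> 0" "g y \<noteq> 0"
  shows "\<exists>z. f z \<noteq> 0 \<and> g z \<noteq> 0"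
proof -
  obtain F where F: "vars_below d F" "f = mev F" using polyfun_imp_mev[OF assms(1)] .
  obtain G where G: "vars_below d G" "g = mev G" using polyfun_imp_mev[OF assms(2)] .
  have "F \<noteq> 0" "G \<noteq> 0" using assms F G by auto
  then have "F * G \<noteq> 0" by simp
  then obtain z where "mev (F * G) z \<noteq> 0" using mev_eq_0_imp[OF vars_below_mult[OF F(1) G(1)]] by blast
  then show ?thesis using F G by auto
qed

lemma polyfun_common_nonzero:
  assumes "finite I" "\<And>i. i \<in> I \<Longrightarrow> polyfun d (f i)" "\<And>i. i \<in> I \<Longrightarrow> \<exists>x. f i x \<noteq> 0"
  shows "\<exists>x. \<forall>i\<in>I. f i x \<noteq> 0"
  using assms
proof (induction I rule: finite_induct)
  case (insert j I)
  then obtain x where x: "\<forall>i\<in>I. f i x \<noteq> 0" by auto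
  obtain y where y: "f j y \<noteq> 0" using insert.prems(2)[of j] by auto
  have "\<exists>z. (\<Prod>i\<in>I. f i z) \<noteq> 0 \<and> f j z \<noteq> 0"
    by (rule polyfun_mult_nonzero[of d _ _ x y]) (use insert x y in \<open>auto intro: polyfun_prod\<close>)
  then show ?case using insert(1) by auto
qed simp

text \<open>The set where \<open>D\<close> is nonzero is Zariski dense: otherwise
  \<open>f - g\<close> and \<open>D\<close> would be nonzero at a common point.\<close>

lemma polyfun_eq_dense:
  assumes "polyfun d f" "polyfun d g" "polyfun d D" "D x0 \<noteq> 0" "\<And>x. D x \<noteq> 0 \<Longrightarrow> f x = g x"
  shows "f x = g x"
proof (rule ccontr)
  assume "f x \<noteq> g x"
  then obtain z where "f z - g z \<noteq> 0" "D z \<noteq> 0"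
    using polyfun_mult_nonzero[OF polyfun_diff[OF assms(1,2)] assms(3), of x x0] assms(4) by auto
  then show False using assms(5) by auto
qed

text \<open>A univariate polynomial over the ring of polynomial functions. The degree bound, uniform
  in \<open>x\<close>, makes evaluation a fixed finite sum.\<close>

definition polyfam :: "nat \<Rightarrow> ((nat \<Rightarrow> complex) \<Rightarrow> complex poly) \<Rightarrow> bool" where
  "polyfam d p \<longleftrightarrow> (\<forall>j. polyfun d (\<lambda>x. coeff (p x) j)) \<and> (\<exists>N. \<forall>x. degree (p x) \<le> N)"

lemma polyfam_coeff: "polyfam d p \<Longrightarrow> polyfun d (\<lambda>x. coeff (p x) j)"
  by (simp add: polyfam_def)

lemma polyfam_const: "polyfam d (\<lambda>x. p)"
  by (auto simp: polyfam_def intro: polyfun.intros)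

lemma polyfam_smult: "polyfun d f \<Longrightarrow> polyfam d p \<Longrightarrow> polyfam d (\<lambda>x. smult (f x) (p x))"
  unfolding polyfam_def by (auto intro!: polyfun_intros intro: order_trans[OF degree_smult_le])

lemma polyfam_add:
  assumes "polyfam d p" "polyfam d q"
  shows "polyfam d (\<lambda>x. p x + q x)"
proof -
  obtain M N where "\<And>x. degree (p x) \<le> M" "\<And>x. degree (q x) \<le> N" using assms by (auto simp: polyfam_def)
  then have "degree (p x + q x) \<le> max M N" for x by (intro degree_add_le) (auto simp: le_max_iff_disj)
  then show ?thesis using assms by (auto simp: polyfam_def intro!: polyfun_intros)
qed

lemma polyfam_mult:
  assumes "polyfam d p" "polyfam d q"
  shows "polyfam d (\<lambda>x. p x * q x)"
proof -
  obtain M N where "\<And>x. degree (p x) \<le> M" "\<And>x. degree (q x) \<le> N" using assms by (auto simp: polyfam_def)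
  then have "degree (p x * q x) \<le> M + N" for x by (meson add_mono degree_mult_le order_trans)
  then show ?thesis using assms by (auto simp: polyfam_def coeff_mult intro!: polyfun_intros)
qed

lemma polyfam_sum: "(\<And>i. i \<in> S \<Longrightarrow> polyfam d (p i)) \<Longrightarrow> polyfam d (\<lambda>x. \<Sum>i\<in>S. p i x)"
  by (induction S rule: infinite_finite_induct) (auto intro: polyfam_const polyfam_add)

lemma polyfam_pderiv: "polyfam d p \<Longrightarrow> polyfam d (\<lambda>x. pderiv (p x))"
  unfolding polyfam_def coeff_pderiv
  by (auto intro!: polyfun_intros simp: degree_pderiv) (meson diff_le_self order_trans)

lemma polyfam_pCons: "polyfun d f \<Longrightarrow> polyfam d p \<Longrightarrow> polyfam d (\<lambda>x. pCons (f x) (p x))"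
  using polyfam_add[OF polyfam_smult[OF _ polyfam_const[of d 1], of f] polyfam_mult[OF polyfam_const[of d "[:0,1:]"], of p]]
  by (simp add: one_pCons)

lemma polyfun_poly:
  assumes "polyfam d p" "polyfun d s"
  shows "polyfun d (\<lambda>x. poly (p x) (s x))"
proof -
  obtain N where N: "\<And>x. degree (p x) \<le> N" using assms by (auto simp: polyfam_def)
  have "poly (p x) (s x) = (\<Sum>j\<le>N. coeff (p x) j * s x ^ j)" for x
    unfolding poly_altdef using N[of x]
    by (intro sum.mono_neutral_left) (auto simp: coeff_eq_0)
  then show ?thesis using assms by (simp add: polyfam_def polyfun_intros)
qed

lemma polyfun_line:
  assumes "polyfun d f" "\<And>i. i < d \<Longrightarrow> polyfun d (\<lambda>x. a x i)" "\<And>i. i < d \<Longrightarrow> polyfun d (\<lambda>x. b x i)"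
  shows "\<exists>p. polyfam d p \<and> (\<forall>x s. f (\<lambda>i. a x i + s * b x i) = poly (p x) s)"
  using assms(1)
proof induction
  case (const c)
  then show ?case by (intro exI[of _ "\<lambda>x. [:c:]"]) (auto intro: polyfam_const)
next
  case (coord i)
  then show ?case using assms(2,3)
    by (intro exI[of _ "\<lambda>x. [:a x i, b x i:]"]) (auto intro!: polyfam_pCons polyfam_const)
next
  case (add f g)
  then obtain p q where "polyfam d p \<and> (\<forall>x s. f (\<lambda>i. a x i + s * b x i) = poly (p x) s)"
    "polyfam d q \<and> (\<forall>x s. g (\<lambda>i. a x i + s * b x i) = poly (q x) s)" by blast
  then show ?case by (intro exI[of _ "\<lambda>x. p x + q x"]) (auto intro: polyfam_add)
next
  case (mult f g)
  then obtain p q where "polyfam d p \<and> (\<forall>x s. f (\<lambda>i. a x i + s * b x i) = poly (p x) s)"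
    "polyfam d q \<and> (\<forall>x s. g (\<lambda>i. a x i + s * b x i) = poly (q x) s)" by blast
  then show ?case by (intro exI[of _ "\<lambda>x. p x * q x"]) (auto intro: polyfam_mult)
qed

section \<open>Sylvester resultants\<close>

lemma polyfun_det:
  assumes "\<And>x. A x \<in> carrier_mat n n" "\<And>i j. i < n \<Longrightarrow> j < n \<Longrightarrow> polyfun d (\<lambda>x. A x $$ (i, j))"
  shows "polyfun d (\<lambda>x. det (A x))"
  unfolding det_def'[OF assms(1)]
  by (intro polyfun_intros assms(2)) (auto simp: permutes_in_image)

lemma polyfun_resultant_sub:
  assumes "polyfam d p" "polyfam d q"
  shows "polyfun d (\<lambda>x. resultant_sub m n (p x) (q x))"
  unfolding resultant_sub_def
proof (rule polyfun_det)
  fix i j assume "i < m + n" "j < m + n"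
  then show "polyfun d (\<lambda>x. sylvester_mat_sub m n (p x) (q x) $$ (i, j))"
    using polyfam_coeff[OF assms(1)] polyfam_coeff[OF assms(2)] polyfun.const[of d 0]
    by (cases "i < n"; cases "i \<le> j \<and> j - i \<le> m"; cases "i - n \<le> j \<and> j \<le> i")
       (simp_all only: sylvester_mat_sub_index if_True if_False simp_thms)
qed (rule sylvester_mat_sub_carrier)

text \<open>The rows of the Sylvester matrix read as polynomials: \<open>f\<close>, then
  \<open>g\<close>, times decreasing powers of the variable. The matrix applied to the vector of
  powers of \<open>t\<close> evaluates the rows at \<open>t\<close>.\<close>

definition sylv_row :: "nat \<Rightarrow> nat \<Rightarrow> 'a::comm_ring_1 poly \<Rightarrow> 'a poly \<Rightarrow> nat \<Rightarrow> 'a poly" where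
  "sylv_row m n f g i = (if i < n then monom 1 (n - 1 - i) * f else monom 1 (m + n - 1 - i) * g)"

lemma sylvester_mat_sub_row:
  assumes "degree f \<le> m" "degree g \<le> n" "i < m + n" "j < m + n"
  shows "sylvester_mat_sub m n f g $$ (i, j) = coeff (sylv_row m n f g i) (m + n - 1 - j)"
  unfolding sylvester_mat_sub_index[OF assms(3,4)] sylv_row_def using assms
  by (auto simp: coeff_monom_mult coeff_eq_0 Suc_diff_le not_le intro!: arg_cong2[of _ _ _ _ coeff])

lemma degree_sylv_row:
  assumes "degree f \<le> m" "degree g \<le> n" "i < m + n"
  shows "degree (sylv_row m n f g i) < m + n"
proof -
  have "degree (monom 1 k * h) \<le> k + degree h" for k and h :: "'a poly"
    using degree_mult_le[of "monom 1 k" h] degree_monom_le[of "1::'a" k] by linarith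
  from this[of "n - 1 - i" f] this[of "m + n - 1 - i" g] show ?thesis
    using assms by (auto simp: sylv_row_def)
qed

lemma poly_rev_sum:
  fixes p :: "'a::comm_ring_1 poly"
  assumes "degree p < N"
  shows "(\<Sum>j<N. coeff p (N - 1 - j) * t ^ (N - 1 - j)) = poly p t"
proof -
  have "(\<Sum>j<N. coeff p (N - 1 - j) * t ^ (N - 1 - j)) = (\<Sum>j<N. coeff p j * t ^ j)"
    by (rule sum.reindex_bij_witness[of _ "\<lambda>j. N - 1 - j" "\<lambda>j. N - 1 - j"]) auto
  also have "\<dots> = poly p t"
    unfolding poly_altdef using assms by (intro sum.mono_neutral_right) (auto simp: coeff_eq_0)
  finally show ?thesis .
qed

text \<open>A vector in the left kernel of the Sylvester matrix lists the coefficients of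
  \<open>u\<close> and \<open>v\<close>, and its combination of the rows is
  \<open>u f + v g\<close>.\<close>

lemma resultant_sub_eq_0_imp:
  fixes f g :: "'a::field poly"
  assumes "degree f \<le> m" "degree g \<le> n" "resultant_sub m n f g = 0"
  obtains u v where "u \<noteq> 0 \<or> v \<noteq> 0" "u = 0 \<or> degree u < n" "v = 0 \<or> degree v < m" "u * f + v * g = 0"
proof -
  let ?N = "m + n"
  let ?S = "sylvester_mat_sub m n f g"
  have "det (transpose_mat ?S) = 0"
    using assms(3) by (simp add: resultant_sub_def det_transpose[OF sylvester_mat_sub_carrier])
  then obtain c where c: "c \<in> carrier_vec ?N" "c \<noteq> 0\<^sub>v ?N" "transpose_mat ?S *\<^sub>v c = 0\<^sub>v ?N"
    using det_0_iff_vec_prod_zero_field[of "transpose_mat ?S" ?N] by (auto simp: sylvester_mat_sub_carrier)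
  define u where "u = (\<Sum>i<n. monom (c $ i) (n - 1 - i))"
  define v where "v = (\<Sum>i<m. monom (c $ (n + i)) (m - 1 - i))"
  have cu: "coeff u (n - 1 - i) = c $ i" if "i < n" for i
  proof -
    have "coeff u (n - 1 - i) = (\<Sum>j<n. if j = i then c $ j else 0)"
      unfolding u_def coeff_sum coeff_monom using that by (intro sum.cong) auto
    then show ?thesis using that by simp
  qed
  have cv: "coeff v (m - 1 - i) = c $ (n + i)" if "i < m" for i
  proof -
    have "coeff v (m - 1 - i) = (\<Sum>j<m. if j = i then c $ (n + j) else 0)"
      unfolding v_def coeff_sum coeff_monom using that by (intro sum.cong) auto
    then show ?thesis using that by simp
  qed
  have row: "(\<Sum>i<?N. smult (c $ i) (sylv_row m n f g i)) = 0"
  proof (rule poly_eqI)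
    fix k
    show "coeff (\<Sum>i<?N. smult (c $ i) (sylv_row m n f g i)) k = coeff 0 k"
    proof (cases "k < ?N")
      case True
      let ?j = "?N - 1 - k"
      have j: "?j < ?N" "?N - 1 - ?j = k" using True by auto
      have "0 = (transpose_mat ?S *\<^sub>v c) $ ?j" using c(3) j by simp
      also have "\<dots> = (\<Sum>i<?N. ?S $$ (i, ?j) * c $ i)"
        using c(1) j by (simp add: scalar_prod_def atLeast0LessThan)
      also have "\<dots> = (\<Sum>i<?N. coeff (sylv_row m n f g i) k * c $ i)"
        using j by (intro sum.cong) (auto simp: sylvester_mat_sub_row[OF assms(1,2)])
      finally show ?thesis by (simp add: coeff_sum mult.commute)
    next
      case False
      then have "coeff (sylv_row m n f g i) k = 0" if "i < ?N" for i
        using degree_sylv_row[OF assms(1,2) that] by (intro coeff_eq_0) simp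
      then show ?thesis by (simp add: coeff_sum)
    qed
  qed
  have "(\<Sum>i<?N. smult (c $ i) (sylv_row m n f g i)) =
      (\<Sum>i<n. smult (c $ i) (sylv_row m n f g i)) + (\<Sum>i<m. smult (c $ (n + i)) (sylv_row m n f g (n + i)))"
    using sum.atLeastLessThan_concat[of 0 n ?N "\<lambda>i. smult (c $ i) (sylv_row m n f g i)"]
      sum.shift_bounds_nat_ivl[of "\<lambda>i. smult (c $ i) (sylv_row m n f g i)" 0 n m]
    by (simp add: atLeast0LessThan add.commute)
  also have "\<dots> = u * f + v * g"
    unfolding u_def v_def sum_distrib_right
    by (intro arg_cong2[of _ _ _ _ "(+)"] sum.cong) (auto simp: sylv_row_def smult_monom simp flip: mult_smult_left)
  finally have "u * f + v * g = 0" using row by simp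
  moreover have "u \<noteq> 0 \<or> v \<noteq> 0"
  proof (rule ccontr)
    assume "\<not> ?thesis"
    then have "c $ i = 0" if "i < ?N" for i
      using cu[of i] cv[of "i - n"] that by (cases "i < n") auto
    then show False using c(1,2) by (auto intro!: eq_vecI)
  qed
  moreover have "u = 0 \<or> degree u < n" "v = 0 \<or> degree v < m"
  proof -
    have "coeff u k = 0" if "n \<le> k" for k
      unfolding u_def coeff_sum coeff_monom using that by (intro sum.neutral) auto
    then show "u = 0 \<or> degree u < n" using leading_coeff_0_iff[of u] by (meson not_le)
    have "coeff v k = 0" if "m \<le> k" for k
      unfolding v_def coeff_sum coeff_monom using that by (intro sum.neutral) auto
    then show "v = 0 \<or> degree v < m" using leading_coeff_0_iff[of v] by (meson not_le)
  qed
  ultimately show ?thesis using that by blast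
qed

lemma coprime_complex_poly_iff:
  fixes f g :: "complex poly"
  assumes "\<And>t. \<not> (poly f t = 0 \<and> poly g t = 0)"
  shows "coprime f g"
proof -
  have nz: "gcd f g \<noteq> 0" using assms by auto
  have "degree (gcd f g) = 0"
  proof (rule ccontr)
    assume "degree (gcd f g) \<noteq> 0"
    then have "\<not> constant (poly (gcd f g))" by (simp add: constant_degree)
    then obtain z where "poly (gcd f g) z = 0" using fundamental_theorem_of_algebra by blast
    then have "[:-z, 1:] dvd gcd f g" by (simp add: poly_eq_0_iff_dvd)
    then have "poly f z = 0" "poly g z = 0" by (simp_all add: poly_eq_0_iff_dvd)
    then show False using assms by blast
  qed
  then show ?thesis using nz is_unit_iff_degree[OF nz] is_unit_gcd_iff[of f g] coprime_iff_gcd_eq_1[of f g] by simp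
qed

text \<open>As \<open>m\<close> and \<open>n\<close> only bound the degrees, a simultaneous drop of
  both counts as a common root at infinity. Without any common root, \<open>f\<close> divides
  \<open>v\<close> and \<open>g\<close> divides \<open>u\<close>, and the polynomial that attains
  its formal degree forces a zero cofactor. Conversely, the powers of a common root, or the first
  unit vector for infinity, form a kernel vector.\<close>

lemma resultant_sub_eq_0_iff:
  fixes f g :: "complex poly"
  assumes deg: "degree f \<le> m" "degree g \<le> n" and pos: "m + n > 0"
  shows "resultant_sub m n f g = 0 \<longleftrightarrow>
    (\<exists>t. poly f t = 0 \<and> poly g t = 0) \<or> (coeff f m = 0 \<and> coeff g n = 0)"
proof
  assume r: "resultant_sub m n f g = 0"
  show "(\<exists>t. poly f t = 0 \<and> poly g t = 0) \<or> (coeff f m = 0 \<and> coeff g n = 0)"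
  proof (rule ccontr)
    assume a: "\<not> ?thesis"
    obtain u v where uv: "u \<noteq> 0 \<or> v \<noteq> 0" "u = 0 \<or> degree u < n" "v = 0 \<or> degree v < m" "u * f + v * g = 0"
      using resultant_sub_eq_0_imp[OF deg r] .
    have cop: "coprime f g" by (rule coprime_complex_poly_iff) (use a in blast)
    have eq: "u * f = - v * g" using uv(4) by (simp add: eq_neg_iff_add_eq_0)
    have "v * g = f * (- u)" using eq by (simp add: algebra_simps)
    then have "f dvd v * g" by (rule dvdI)
    then have fv: "f dvd v" using cop by (simp add: coprime_dvd_mult_left_iff)
    have "u * f = g * (- v)" using eq by (simp add: algebra_simps)
    then have "g dvd u * f" by (rule dvdI)
    then have gu: "g dvd u" using cop by (simp add: coprime_commute coprime_dvd_mult_left_iff)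
    show False
    proof (cases "coeff f m = 0")
      case False
      then have "degree f = m" "f \<noteq> 0" using deg(1) le_degree[of f m] by auto
      then have "v = 0" using uv(3) dvd_imp_degree_le[OF fv] by auto
      then show False using eq uv(1) \<open>f \<noteq> 0\<close> by auto
    next
      case True
      then have "coeff g n \<noteq> 0" using a by auto
      then have "degree g = n" "g \<noteq> 0" using deg(2) le_degree[of g n] by auto
      then have "u = 0" using uv(2) dvd_imp_degree_le[OF gu] by auto
      then show False using eq uv(1) \<open>g \<noteq> 0\<close> by auto
    qed
  qed
next
  let ?N = "m + n"
  let ?S = "sylvester_mat_sub m n f g"
  have ker: "resultant_sub m n f g = 0" if "c \<in> carrier_vec ?N" "c \<noteq> 0\<^sub>v ?N" "?S *\<^sub>v c = 0\<^sub>v ?N" for c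
    unfolding resultant_sub_def using that det_0_iff_vec_prod_zero_field[OF sylvester_mat_sub_carrier] by blast
  assume "(\<exists>t. poly f t = 0 \<and> poly g t = 0) \<or> (coeff f m = 0 \<and> coeff g n = 0)"
  then show "resultant_sub m n f g = 0"
  proof (elim disjE exE)
    fix t assume t: "poly f t = 0 \<and> poly g t = 0"
    let ?c = "vec ?N (\<lambda>j. t ^ (?N - 1 - j))"
    have "?S *\<^sub>v ?c = 0\<^sub>v ?N"
    proof (rule eq_vecI)
      fix i assume i: "i < dim_vec (0\<^sub>v ?N :: complex vec)"
      then have "(?S *\<^sub>v ?c) $ i = (\<Sum>j<?N. ?S $$ (i, j) * t ^ (?N - 1 - j))"
        by (simp add: scalar_prod_def atLeast0LessThan)
      also have "\<dots> = (\<Sum>j<?N. coeff (sylv_row m n f g i) (?N - 1 - j) * t ^ (?N - 1 - j))"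
        using i by (intro sum.cong) (auto simp: sylvester_mat_sub_row[OF deg])
      also have "\<dots> = poly (sylv_row m n f g i) t"
        using i by (intro poly_rev_sum degree_sylv_row deg) auto
      also have "\<dots> = 0" using t by (simp add: sylv_row_def)
      finally show "(?S *\<^sub>v ?c) $ i = 0\<^sub>v ?N $ i" using i by simp
    qed auto
    moreover have "?c $ (?N - 1) \<noteq> 0\<^sub>v ?N $ (?N - 1)" using pos by simp
    then have "?c \<noteq> 0\<^sub>v ?N" by metis
    ultimately show ?thesis by (intro ker[of ?c]) auto
  next
    assume top: "coeff f m = 0 \<and> coeff g n = 0"
    let ?c = "unit_vec ?N 0"
    have "?S *\<^sub>v ?c = 0\<^sub>v ?N"
    proof (rule eq_vecI)
      fix i assume i: "i < dim_vec (0\<^sub>v ?N :: complex vec)"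
      then have "(?S *\<^sub>v ?c) $ i = ?S $$ (i, 0)"
        using pos by simp
      also have "\<dots> = 0" using i pos top by (auto simp: sylvester_mat_sub_index)
      finally show "(?S *\<^sub>v ?c) $ i = 0\<^sub>v ?N $ i" using i by simp
    qed auto
    then show ?thesis using pos by (intro ker[of ?c]) auto
  qed
qed

text \<open>A left kernel vector would give a nonzero polynomial of degree below \<open>N\<close>
  with \<open>N\<close> distinct roots.\<close>

lemma vandermonde_nonzero:
  fixes t :: "nat \<Rightarrow> complex"
  assumes "inj_on t {..<N}"
  shows "det (mat N N (\<lambda>(j, i). t i ^ (N - 1 - j))) \<noteq> 0"
proof
  let ?W = "mat N N (\<lambda>(j, i). t i ^ (N - 1 - j))"
  assume "det ?W = 0"
  then have "det (transpose_mat ?W) = 0" by (subst det_transpose[of ?W N]) simp_all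
  then obtain c where c: "c \<in> carrier_vec N" "c \<noteq> 0\<^sub>v N" "transpose_mat ?W *\<^sub>v c = 0\<^sub>v N"
    using det_0_iff_vec_prod_zero_field[of "transpose_mat ?W" N] by auto
  have "N > 0" using c(1,2) by (metis carrier_vecD eq_vecI gr0I index_zero_vec(2) less_nat_zero_code)
  define p where "p = (\<Sum>j<N. monom (c $ j) (N - 1 - j))"
  have coeff: "coeff p (N - 1 - j) = c $ j" if "j < N" for j
  proof -
    have "coeff p (N - 1 - j) = (\<Sum>i<N. if i = j then c $ i else 0)"
      unfolding p_def coeff_sum coeff_monom using that by (intro sum.cong) auto
    then show ?thesis using that by simp
  qed
  have "degree p \<le> N - 1" unfolding p_def by (intro degree_sum_le) (auto intro: order_trans[OF degree_monom_le])
  have "poly p (t i) = 0" if "i < N" for i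
  proof -
    have "0 = (transpose_mat ?W *\<^sub>v c) $ i" using c(3) that by simp
    also have "\<dots> = (\<Sum>j<N. t i ^ (N - 1 - j) * c $ j)"
      using c(1) that by (simp add: scalar_prod_def atLeast0LessThan)
    also have "\<dots> = poly p (t i)" by (simp add: p_def poly_sum poly_monom mult.commute)
    finally show ?thesis by simp
  qed
  then have sub: "t ` {..<N} \<subseteq> {z. poly p z = 0}" by auto
  have "p = 0"
  proof (rule ccontr)
    assume "p \<noteq> 0"
    then have "card (t ` {..<N}) \<le> degree p"
      using card_mono[OF poly_roots_finite sub] card_poly_roots_bound[of p] by fastforce
    then show False using \<open>degree p \<le> N - 1\<close> \<open>N > 0\<close> card_image[OF assms] by simp
  qed
  then have "c $ j = 0" if "j < N" for j using coeff[OF that] by simp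
  then show False using c(1,2) by (auto intro!: eq_vecI)
qed

text \<open>
  Evaluation at a common root of \<open>f0 + s f1\<close> and \<open>g0 + s g1\<close> is an eigenvector of the pencil of Sylvester
  matrices. When there are \<open>m + n\<close> such roots, a Vandermonde matrix diagonalizes the pencil.
\<close>

lemma resultant_sub_pencil:
  fixes f0 f1 g0 g1 :: "complex poly"
  assumes deg: "degree f0 \<le> m" "degree f1 \<le> m" "degree g0 \<le> n" "degree g1 \<le> n"
    and T: "finite T" "card T = m + n"
    and root: "\<And>t. t \<in> T \<Longrightarrow> poly f0 t + \<sigma> t * poly f1 t = 0 \<and> poly g0 t + \<sigma> t * poly g1 t = 0"
  shows "resultant_sub m n (f1 + smult u f0) (g1 + smult u g0) =
    resultant_sub m n f1 g1 * (\<Prod>t\<in>T. 1 - u * \<sigma> t)"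
proof -
  let ?N = "m + n"
  obtain t where t: "bij_betw t {..<?N} T" using T ex_bij_betw_nat_finite[of T] by (auto simp: atLeast0LessThan)
  let ?W = "mat ?N ?N (\<lambda>(j, i). t i ^ (?N - 1 - j))"
  let ?S = "sylvester_mat_sub m n (f1 + smult u f0) (g1 + smult u g0)"
  let ?S1 = "sylvester_mat_sub m n f1 g1"
  let ?D = "mat_diag ?N (\<lambda>i. 1 - u * \<sigma> (t i))"
  have deg': "degree (f1 + smult u f0) \<le> m" "degree (g1 + smult u g0) \<le> n"
    using deg by (auto intro!: degree_add_le order_trans[OF degree_smult_le])
  have SW: "(sylvester_mat_sub m n f g * ?W) $$ (r, i) = poly (sylv_row m n f g r) (t i)"
    if "degree f \<le> m" "degree g \<le> n" "r < ?N" "i < ?N" for f g r i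
  proof -
    have "(sylvester_mat_sub m n f g * ?W) $$ (r, i) = (\<Sum>j<?N. sylvester_mat_sub m n f g $$ (r, j) * t i ^ (?N - 1 - j))"
      using that by (simp add: scalar_prod_def atLeast0LessThan)
    also have "\<dots> = (\<Sum>j<?N. coeff (sylv_row m n f g r) (?N - 1 - j) * t i ^ (?N - 1 - j))"
      using that by (intro sum.cong) (auto simp: sylvester_mat_sub_row)
    also have "\<dots> = poly (sylv_row m n f g r) (t i)"
      using that by (intro poly_rev_sum degree_sylv_row) auto
    finally show ?thesis .
  qed
  have W: "?W \<in> carrier_mat ?N ?N" by simp
  have "?S * ?W = (?S1 * ?W) * ?D"
  proof (rule eq_matI)
    fix r i assume "r < dim_row ((?S1 * ?W) * ?D)" "i < dim_col ((?S1 * ?W) * ?D)"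
    then have ri: "r < ?N" "i < ?N" by (auto simp: mat_diag_def)
    have tT: "t i \<in> T" using t ri by (auto simp: bij_betw_def)
    have c: "?S1 * ?W \<in> carrier_mat ?N ?N" by (intro mult_carrier_mat[of _ _ ?N] sylvester_mat_sub_carrier W)
    \<comment> \<open>At the parameter \<open>t i\<close>, the polynomial \<open>f1 + u f0\<close>
      has the value of \<open>f1\<close> times \<open>1 - u * \<sigma> (t i)\<close>, and likewise
      for \<open>g\<close>; so all rows are scaled by the same factor.\<close>
    have r: "poly f0 (t i) = - \<sigma> (t i) * poly f1 (t i)" "poly g0 (t i) = - \<sigma> (t i) * poly g1 (t i)"
      using root[OF tT] by (simp_all add: eq_neg_iff_add_eq_0)
    have "((?S1 * ?W) * ?D) $$ (r, i) = poly (sylv_row m n f1 g1 r) (t i) * (1 - u * \<sigma> (t i))"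
      unfolding mat_diag_mult_right[OF c] using ri SW[OF deg(2,4)] by simp
    moreover have "(?S * ?W) $$ (r, i) = poly (sylv_row m n (f1 + smult u f0) (g1 + smult u g0) r) (t i)"
      by (rule SW[OF deg' ri])
    moreover have "poly (sylv_row m n (f1 + smult u f0) (g1 + smult u g0) r) (t i)
        = poly (sylv_row m n f1 g1 r) (t i) * (1 - u * \<sigma> (t i))"
      using r by (simp add: sylv_row_def algebra_simps)
    ultimately show "(?S * ?W) $$ (r, i) = ((?S1 * ?W) * ?D) $$ (r, i)"
      by metis
  qed (auto simp: mat_diag_def)
  then have "det (?S * ?W) = det ((?S1 * ?W) * ?D)" by simp
  also have "det (?S * ?W) = det ?S * det ?W"
    by (rule det_mult[OF sylvester_mat_sub_carrier W])
  also have "det ((?S1 * ?W) * ?D) = det (?S1 * ?W) * det ?D"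
    by (rule det_mult[of _ ?N]) (auto intro: mult_carrier_mat[OF sylvester_mat_sub_carrier W])
  also have "det (?S1 * ?W) = det ?S1 * det ?W"
    by (rule det_mult[OF sylvester_mat_sub_carrier W])
  also have "det ?D = (\<Prod>i<?N. 1 - u * \<sigma> (t i))"
    by (subst det_upper_triangular[of _ ?N])
       (auto simp: mat_diag_def diag_mat_def prod.list_conv_set_nth atLeast0LessThan)
  also have "\<dots> = (\<Prod>t\<in>T. 1 - u * \<sigma> t)"
    by (rule prod.reindex_bij_betw[OF t])
  finally show ?thesis
    using vandermonde_nonzero[of t ?N] t by (simp add: resultant_sub_def bij_betw_def)
qed

section \<open>Parallel values of univariate families\<close>

definition wronskian :: "complex poly \<Rightarrow> complex poly \<Rightarrow> complex poly" where
  "wronskian f g = f * pderiv g - g * pderiv f"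

text \<open>All 2x2 minors of the two value vectors vanish. A zero vector is parallel to everything,
  so a factor of proportionality exists only next to a nonzero value.\<close>

definition par :: "'i set \<Rightarrow> ('i \<Rightarrow> complex poly) \<Rightarrow> complex \<Rightarrow> complex \<Rightarrow> bool" where
  "par X A t u \<longleftrightarrow> (\<forall>i\<in>X. \<forall>j\<in>X. poly (A i) t * poly (A j) u = poly (A j) t * poly (A i) u)"

lemma par_scalar:
  assumes "par X A t u" "i \<in> X" "poly (A i) u \<noteq> 0"
  shows "\<exists>r. \<forall>j\<in>X. poly (A j) t = r * poly (A j) u"
  using assms by (intro exI[of _ "poly (A i) t / poly (A i) u"]) (auto simp: par_def field_simps)

text \<open>A relation with constant coefficients can be differentiated, and eliminating between it
  and its derivative leaves multiples of the Wronskian.\<close>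

lemma wronskian_imp_independent:
  assumes "wronskian f g \<noteq> 0" "smult a f = smult b g"
  shows "a = 0 \<and> b = 0"
proof -
  have 1: "[:a:] * f = [:b:] * g" using assms(2) by simp
  have 2: "[:a:] * pderiv f = [:b:] * pderiv g"
    using arg_cong[OF assms(2), of pderiv] by (simp add: pderiv_smult)
  have "[:a:] * wronskian f g = ([:a:] * f) * pderiv g - ([:a:] * pderiv f) * g"
    by (simp only: wronskian_def algebra_simps)
  also have "\<dots> = 0" by (simp only: 1 2) (simp add: mult_ac)
  finally have "a = 0" using assms(1) by simp
  have "[:b:] * wronskian f g = f * ([:b:] * pderiv g) - ([:b:] * g) * pderiv f"
    by (simp only: wronskian_def algebra_simps)
  also have "\<dots> = 0" by (simp only: 1[symmetric] 2[symmetric]) (simp add: mult_ac)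
  finally show ?thesis using assms(1) \<open>a = 0\<close> by simp
qed

lemma poly_wronskian: "poly (wronskian f g) t = poly f t * poly (pderiv g) t - poly g t * poly (pderiv f) t"
  by (simp add: wronskian_def)

text \<open>A member of the pencil of \<open>f\<close> and \<open>g\<close> can only have a multiple root where their Wronskian vanishes.\<close>

lemma finite_multiple_members:
  assumes cz: "\<And>t. \<not> (poly f t = 0 \<and> poly g t = 0)" and W: "wronskian f g \<noteq> 0"
  shows "finite {u. \<exists>t. poly f t * poly g u = poly g t * poly f u \<and>
    poly (pderiv f) t * poly g u = poly (pderiv g) t * poly f u}"
proof (rule finite_subset)
  let ?H = "\<lambda>t. smult (poly f t) g - smult (poly g t) f"
  have "?H t \<noteq> 0" for t
    using wronskian_imp_independent[OF W, of "poly g t" "poly f t"] cz[of t] by auto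
  \<comment> \<open>A multiple root \<open>t\<close> is one of the finitely many roots of the
    Wronskian, and each of them belongs to the members indexed by the finitely many roots
    \<open>u\<close> of \<open>?H t\<close>.\<close>
  then show "finite (\<Union>t\<in>{t. poly (wronskian f g) t = 0}. {u. poly (?H t) u = 0})"
    using W by (intro finite_UN_I poly_roots_finite) auto
  show "{u. \<exists>t. poly f t * poly g u = poly g t * poly f u \<and> poly (pderiv f) t * poly g u = poly (pderiv g) t * poly f u}
      \<subseteq> (\<Union>t\<in>{t. poly (wronskian f g) t = 0}. {u. poly (?H t) u = 0})"
  proof clarify
    fix u t assume 1: "poly f t * poly g u = poly g t * poly f u"
      and 2: "poly (pderiv f) t * poly g u = poly (pderiv g) t * poly f u"
    have "poly (wronskian f g) t * poly f u =
        poly f t * (poly (pderiv g) t * poly f u) - poly (pderiv f) t * (poly g t * poly f u)"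
      by (simp add: poly_wronskian algebra_simps)
    also have "\<dots> = 0" by (simp only: 1[symmetric] 2[symmetric]) (simp add: mult_ac)
    finally have *: "poly (wronskian f g) t * poly f u = 0" .
    have "poly (wronskian f g) t * poly g u =
        poly (pderiv g) t * (poly f t * poly g u) - poly g t * (poly (pderiv f) t * poly g u)"
      by (simp add: poly_wronskian algebra_simps)
    also have "\<dots> = 0" by (simp only: 1 2) (simp add: mult_ac)
    finally have "poly (wronskian f g) t * poly g u = 0" .
    with * have "poly (wronskian f g) t = 0" using cz[of u] by auto
    then show "u \<in> (\<Union>t\<in>{t. poly (wronskian f g) t = 0}. {u. poly (?H t) u = 0})" using 1 by auto
  qed
qed

text \<open>
  Polynomials in two variables \<open>t\<close> and \<open>u\<close> are polynomials in \<open>t\<close> with coefficients in \<open>\<complex>[u]\<close>.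
\<close>

definition ev2 :: "complex poly poly \<Rightarrow> complex \<Rightarrow> complex \<Rightarrow> complex" where
  "ev2 P t u = poly (poly P [:t:]) u"

lemma ev2_simps [simp]:
  "ev2 0 t u = 0" "ev2 (P + Q) t u = ev2 P t u + ev2 Q t u" "ev2 (P - Q) t u = ev2 P t u - ev2 Q t u"
  "ev2 (P * Q) t u = ev2 P t u * ev2 Q t u" "ev2 (smult c P) t u = poly c u * ev2 P t u"
  by (simp_all add: ev2_def)

lemma ev2_sum [simp]: "ev2 (sum P S) t u = (\<Sum>i\<in>S. ev2 (P i) t u)"
  by (induction S rule: infinite_finite_induct) simp_all

definition lift2 :: "complex poly \<Rightarrow> complex poly poly" where
  "lift2 p = map_poly (\<lambda>c. [:c:]) p"

lemma poly_lift2 [simp]: "poly (lift2 p) [:t:] = [:poly p t:]"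
  by (induction p) (simp_all add: lift2_def map_poly_pCons)

lemma ev2_lift2 [simp]: "ev2 (lift2 p) t u = poly p t"
  by (simp add: ev2_def)

lemma pderiv_lift2: "pderiv (lift2 p) = lift2 (pderiv p)"
  by (rule poly_eqI) (simp add: coeff_pderiv lift2_def coeff_map_poly of_nat_poly)

definition at_u :: "complex \<Rightarrow> complex poly poly \<Rightarrow> complex poly" where
  "at_u u P = map_poly (\<lambda>p. poly p u) P"

lemma poly_at_u [simp]: "poly (at_u u P) t = ev2 P t u"
  by (induction P) (simp_all add: at_u_def ev2_def map_poly_pCons)

lemma coeff_at_u [simp]: "coeff (at_u u P) n = poly (coeff P n) u"
  by (simp add: at_u_def coeff_map_poly)

lemma pderiv_at_u: "pderiv (at_u u P) = at_u u (pderiv P)"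
  by (rule poly_eqI) (simp add: coeff_pderiv of_nat_poly)

lemma degree_at_u:
  assumes "poly (lead_coeff P) u \<noteq> 0"
  shows "degree (at_u u P) = degree P"
  using assms by (intro antisym degree_le le_degree) (auto simp: coeff_eq_0)

lemma complex_card_roots:
  fixes p :: "complex poly"
  assumes "p \<noteq> 0" "\<And>t. poly p t = 0 \<Longrightarrow> poly (pderiv p) t \<noteq> 0"
  shows "card {t. poly p t = 0} = degree p"
proof -
  have rs: "rsquarefree p" using assms by (auto simp: rsquarefree_roots)
  have "degree p = degree (smult (lead_coeff p) (\<Prod>z | poly p z = 0. [:-z, 1:]))"
    by (simp only: complex_poly_decompose_rsquarefree[OF rs])
  also have "\<dots> = (\<Sum>z | poly p z = 0. degree [:-z, 1:])"
    using assms(1) by (simp add: degree_prod_sum_eq)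
  finally show ?thesis by simp
qed

section \<open>Elimination for pairs of parameters with parallel values\<close>

definition minors2 :: "'i set \<Rightarrow> ('i \<Rightarrow> complex poly) \<Rightarrow> complex poly poly set" where
  "minors2 X A = (\<lambda>(i, j). smult (A j) (lift2 (A i)) - smult (A i) (lift2 (A j))) ` (X \<times> X)"

lemma par_iff_minors2: "par X A t u \<longleftrightarrow> (\<forall>P\<in>minors2 X A. ev2 P t u = 0)"
  by (auto simp: par_def minors2_def mult.commute)

text \<open>\<open>G\<close> plays the role of a gcd over \<complex>(u). It has least degree in
  \<open>t\<close> among the nonzero polynomials that vanish at the common zeros of
  \<open>S\<close>; pseudo-remainders vanish there too, so they are 0. The factor \<open>c\<close>
  collects the multipliers of the pseudo-divisions.\<close>

lemma elimination:
  fixes S :: "complex poly poly set"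
  assumes "finite S"
  shows "\<exists>G c. c \<noteq> 0 \<and> (\<forall>P\<in>S. \<exists>B. smult c P = G * B) \<and>
    (\<forall>t u. (\<forall>P\<in>S. ev2 P t u = 0) \<longrightarrow> ev2 G t u = 0)"
proof (cases "S \<subseteq> {0}")
  case True
  show ?thesis by (rule exI[of _ 0], rule exI[of _ 1]) (use True in auto)
next
  case False
  define J where "J = {P. \<forall>t u. (\<forall>P\<in>S. ev2 P t u = 0) \<longrightarrow> ev2 P t u = 0}"
  obtain P0 where "P0 \<in> S" "P0 \<noteq> 0" using False by auto
  then have "P0 \<in> J \<and> P0 \<noteq> 0" by (auto simp: J_def)
  then obtain G where G: "G \<in> J" "G \<noteq> 0" "\<And>P. P \<in> J \<Longrightarrow> P \<noteq> 0 \<Longrightarrow> degree G \<le> degree P"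
    using ex_has_least_nat[of "\<lambda>P. P \<in> J \<and> P \<noteq> 0" P0 degree] by blast
  have "\<exists>a B. a \<noteq> 0 \<and> smult a P = G * B" if "P \<in> S" for P
  proof -
    obtain a B where aB: "a \<noteq> 0" "smult a P = G * B + pseudo_mod P G"
      using pseudo_mod(1)[OF G(2)] by blast
    have "pseudo_mod P G = smult a P - G * B" using aB by simp
    then have "pseudo_mod P G \<in> J" using that G(1) by (simp add: J_def)
    then have "pseudo_mod P G = 0" using G(3) pseudo_mod(2)[OF G(2), of P] by force
    then show ?thesis using aB by auto
  qed
  then obtain a B where aB: "\<And>P. P \<in> S \<Longrightarrow> a P \<noteq> 0 \<and> smult (a P) P = G * B P" by metis
  show ?thesis
  proof (rule exI[of _ G], rule exI[of _ "\<Prod>P\<in>S. a P"], intro conjI ballI allI impI)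
    show "(\<Prod>P\<in>S. a P) \<noteq> 0" using aB assms by simp
    fix P assume P: "P \<in> S"
    have "smult (\<Prod>P\<in>S. a P) P = smult (\<Prod>P\<in>S - {P}. a P) (smult (a P) P)"
      using prod.remove[OF assms P, of a] by (simp add: mult.commute)
    also have "\<dots> = G * smult (\<Prod>P\<in>S - {P}. a P) (B P)" using aB[OF P] by simp
    finally show "\<exists>B. smult (\<Prod>P\<in>S. a P) P = G * B" by blast
  next
    fix t u assume "\<forall>P\<in>S. ev2 P t u = 0"
    then show "ev2 G t u = 0" using G(1) by (auto simp: J_def)
  qed
qed

lemma elimination_minors:
  assumes "finite X"
  shows "\<exists>G c B. c \<noteq> 0 \<and> (\<forall>i\<in>X. \<forall>j\<in>X.
      smult c (smult (A j) (lift2 (A i)) - smult (A i) (lift2 (A j))) = G * B i j) \<and>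
    (\<forall>t u. par X A t u \<longrightarrow> ev2 G t u = 0)"
proof -
  have "finite (minors2 X A)" using assms by (simp add: minors2_def)
  from elimination[OF this] obtain G c where G: "c \<noteq> 0" "\<forall>P\<in>minors2 X A. \<exists>B. smult c P = G * B"
    "\<forall>t u. (\<forall>P\<in>minors2 X A. ev2 P t u = 0) \<longrightarrow> ev2 G t u = 0"
    by blast
  have "\<forall>i\<in>X. \<forall>j\<in>X. \<exists>B. smult c (smult (A j) (lift2 (A i)) - smult (A i) (lift2 (A j))) = G * B"
    using G(2) by (auto simp: minors2_def)
  then obtain B where "\<forall>i\<in>X. \<forall>j\<in>X. smult c (smult (A j) (lift2 (A i)) - smult (A i) (lift2 (A j))) = G * B i j"
    by metis
  then show ?thesis using G(1,3) unfolding par_iff_minors2 by blast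
qed

text \<open>
  The correspondence \<open>{(t, u). A(t) is parallel to A(u)}\<close> is cut out by \<open>G\<close>. Differentiating
  \<open>c (A(t) \<and> A(u)) = G B\<close> with respect to \<open>t\<close> and to \<open>u\<close> shows that both
  \<open>A(t) \<and> A'(t)\<close> and \<open>A(u) \<and> A'(u)\<close> are multiples of \<open>B(t, u)\<close>.
\<close>

lemma par_imp_par_tangent:
  assumes X: "finite X"
  shows "\<exists>Z. finite Z \<and> (\<forall>t u. u \<notin> Z \<longrightarrow> par X A t u \<longrightarrow>
    (\<exists>i\<in>X. poly (A i) t \<noteq> 0) \<longrightarrow> (\<exists>i\<in>X. poly (A i) u \<noteq> 0) \<longrightarrow>
    par (X \<times> X) (\<lambda>(i, j). wronskian (A i) (A j)) t u)"
proof -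
  obtain G c B where G: "c \<noteq> 0"
    "\<And>i j. i \<in> X \<Longrightarrow> j \<in> X \<Longrightarrow> smult c (smult (A j) (lift2 (A i)) - smult (A i) (lift2 (A j))) = G * B i j"
    "\<And>t u. par X A t u \<Longrightarrow> ev2 G t u = 0"
    using elimination_minors[OF X, of A] by blast
  have "par (X \<times> X) (\<lambda>(i, j). wronskian (A i) (A j)) t u"
    if u: "u \<notin> {u. poly c u = 0}" and p: "par X A t u"
      and nz: "\<exists>i\<in>X. poly (A i) t \<noteq> 0" "\<exists>i\<in>X. poly (A i) u \<noteq> 0" for t u
  proof -
    obtain r where r: "\<forall>i\<in>X. poly (A i) t = r * poly (A i) u"
      using nz(2) par_scalar[OF p] by blast
    have r0: "r \<noteq> 0" using r nz(1) by auto
    have G0: "ev2 G t u = 0" by (rule G(3)[OF p])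
    \<comment> \<open>\<open>G\<close> vanishes at \<open>(t, u)\<close>, so a derivative of
      \<open>G B\<close> keeps only the term with the derivative of \<open>G\<close>;
      \<open>x\<close> and \<open>y\<close> are the two partial derivatives of \<open>G\<close> at
      this point.\<close>
    define x where "x = ev2 (pderiv G) t u"
    define y where "y = poly (pderiv (poly G [:t:])) u"
    have 1: "poly c u * poly (wronskian (A i) (A j)) t = - r * x * ev2 (B i j) t u" if ij: "i \<in> X" "j \<in> X" for i j
    proof -
      have "ev2 (pderiv (smult c (smult (A j) (lift2 (A i)) - smult (A i) (lift2 (A j))))) t u = ev2 (pderiv (G * B i j)) t u"
        by (simp only: G(2)[OF ij])
      then have "poly c u * (poly (A j) u * poly (pderiv (A i)) t - poly (A i) u * poly (pderiv (A j)) t) = x * ev2 (B i j) t u"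
        using G0 by (simp add: pderiv_smult pderiv_diff pderiv_lift2 pderiv_mult x_def algebra_simps)
      moreover have "poly c u * poly (wronskian (A i) (A j)) t =
          - r * (poly c u * (poly (A j) u * poly (pderiv (A i)) t - poly (A i) u * poly (pderiv (A j)) t))"
        using r ij by (simp add: poly_wronskian algebra_simps)
      ultimately show ?thesis by simp
    qed
    have 2: "r * (poly c u * poly (wronskian (A i) (A j)) u) = y * ev2 (B i j) t u" if ij: "i \<in> X" "j \<in> X" for i j
    proof -
      have "poly (pderiv (poly (smult c (smult (A j) (lift2 (A i)) - smult (A i) (lift2 (A j)))) [:t:])) u
          = poly (pderiv (poly (G * B i j) [:t:])) u"
        by (simp only: G(2)[OF ij])
      moreover have e: "poly (A i) t * poly (A j) u = poly (A i) u * poly (A j) t"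
        using p ij by (simp add: par_def mult.commute)
      moreover have "poly (A i) t * (poly (A j) u * z) = poly (A i) u * (poly (A j) t * z)" for z
        by (simp only: mult.assoc[symmetric] e)
      ultimately have "poly c u * (poly (A i) t * poly (pderiv (A j)) u - poly (A j) t * poly (pderiv (A i)) u)
          = y * ev2 (B i j) t u"
        using G0 by (simp add: pderiv_mult pderiv_smult pderiv_diff pderiv_pCons y_def ev2_def algebra_simps)
      then show ?thesis using r ij by (simp add: poly_wronskian algebra_simps)
    qed
    have "poly (wronskian (A i) (A j)) t * poly (wronskian (A k) (A l)) u =
      poly (wronskian (A k) (A l)) t * poly (wronskian (A i) (A j)) u"
      if ijkl: "i \<in> X" "j \<in> X" "k \<in> X" "l \<in> X" for i j k l
    proof -
    \<comment> \<open>By \<open>1\<close> and \<open>2\<close> the product is \<open>- r x y\<close>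
      times the values of \<open>B i j\<close> and \<open>B k l\<close>, which is symmetric in the
      two index pairs.\<close>
    have "r * (poly c u) ^ 2 * (poly (wronskian (A i) (A j)) t * poly (wronskian (A k) (A l)) u)
        = (poly c u * poly (wronskian (A i) (A j)) t) * (r * (poly c u * poly (wronskian (A k) (A l)) u))"
      by (simp add: power2_eq_square algebra_simps)
    also have "\<dots> = (poly c u * poly (wronskian (A k) (A l)) t) * (r * (poly c u * poly (wronskian (A i) (A j)) u))"
      unfolding 1[OF ijkl(1,2)] 2[OF ijkl(3,4)] 1[OF ijkl(3,4)] 2[OF ijkl(1,2)] by (simp add: algebra_simps)
    also have "\<dots> = r * (poly c u) ^ 2 * (poly (wronskian (A k) (A l)) t * poly (wronskian (A i) (A j)) u)"
      by (simp add: power2_eq_square algebra_simps)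
    finally show ?thesis using r0 u by simp
    qed
    then show ?thesis by (auto simp: par_def)
  qed
  then show ?thesis using G(1) by (intro exI[of _ "{u. poly c u = 0}"]) (simp add: poly_roots_finite)
qed

lemma ev2_eqI:
  assumes "\<And>t u. ev2 P t u = ev2 Q t u"
  shows "P = Q"
proof (rule poly_eqI)
  fix n
  have "at_u u P = at_u u Q" for u
    using assms by (intro poly_ext) simp
  then have "poly (coeff P n) u = poly (coeff Q n) u" for u
    by (metis coeff_at_u)
  then show "coeff P n = coeff Q n" by (rule poly_ext)
qed

text \<open>Up to the factor \<open>c\<close>, the eliminant \<open>G\<close> divides
  \<open>f(t) g(u) - g(t) f(u)\<close>, whose roots \<open>t\<close> are simple for all but finitely
  many \<open>u\<close>. Hence \<open>at_u u G\<close> has exactly \<open>degree G\<close> roots,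
  and away from the zeros of \<open>c\<close> these are the fibre.\<close>

lemma par_fibre_poly:
  assumes X: "finite X" and fg: "f = (\<Sum>i\<in>X. smult (\<alpha> i) (A i))" "g = (\<Sum>i\<in>X. smult (\<beta> i) (A i))"
    and cz: "\<And>t. \<not> (poly f t = 0 \<and> poly g t = 0)" and W: "wronskian f g \<noteq> 0"
  shows "\<exists>G Z. finite Z \<and> G \<noteq> 0 \<and> (\<forall>u. u \<notin> Z \<longrightarrow> {t. par X A t u} = {t. poly (at_u u G) t = 0} \<and>
    finite {t. par X A t u} \<and> card {t. par X A t u} = degree G)"
proof -
  obtain G c B where G: "c \<noteq> 0"
    "\<And>i j. i \<in> X \<Longrightarrow> j \<in> X \<Longrightarrow> smult c (smult (A j) (lift2 (A i)) - smult (A i) (lift2 (A j))) = G * B i j"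
    "\<And>t u. par X A t u \<Longrightarrow> ev2 G t u = 0"
    using elimination_minors[OF X, of A] by blast
  define H where "H = smult g (lift2 f) - smult f (lift2 g)"
  define C where "C = (\<Sum>i\<in>X. \<Sum>j\<in>X. smult [:\<alpha> i * \<beta> j:] (B i j))"
  have evH: "ev2 H t u = poly f t * poly g u - poly g t * poly f u" for t u
    by (simp add: H_def mult.commute)
  have cH: "smult c H = G * C"
  proof (rule ev2_eqI)
    fix t u
    have B: "poly c u * (poly (A i) t * poly (A j) u - poly (A j) t * poly (A i) u) = ev2 G t u * ev2 (B i j) t u"
      if "i \<in> X" "j \<in> X" for i j
      using arg_cong[OF G(2)[OF that], of "\<lambda>P. ev2 P t u"] by (simp add: mult.commute)
    have "ev2 H t u = (\<Sum>i\<in>X. \<alpha> i * poly (A i) t) * (\<Sum>j\<in>X. \<beta> j * poly (A j) u)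
        - (\<Sum>i\<in>X. \<alpha> i * poly (A i) u) * (\<Sum>j\<in>X. \<beta> j * poly (A j) t)"
      by (simp add: evH fg poly_sum mult.commute)
    also have "\<dots> = (\<Sum>i\<in>X. \<Sum>j\<in>X. \<alpha> i * \<beta> j * (poly (A i) t * poly (A j) u - poly (A j) t * poly (A i) u))"
      unfolding sum_product sum_subtractf[symmetric] by (intro sum.cong refl) (simp add: algebra_simps)
    finally have "poly c u * ev2 H t u =
        (\<Sum>i\<in>X. \<Sum>j\<in>X. \<alpha> i * \<beta> j * (poly c u * (poly (A i) t * poly (A j) u - poly (A j) t * poly (A i) u)))"
      by (simp only: sum_distrib_left mult.left_commute)
    also have "\<dots> = (\<Sum>i\<in>X. \<Sum>j\<in>X. \<alpha> i * \<beta> j * (ev2 G t u * ev2 (B i j) t u))"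
      by (intro sum.cong refl) (simp only: B)
    also have "\<dots> = ev2 G t u * ev2 C t u"
      by (simp add: C_def sum_distrib_left mult_ac)
    finally show "ev2 (smult c H) t u = ev2 (G * C) t u" by simp
  qed
  have "H \<noteq> 0"
  proof
    assume "H = 0"
    obtain u where u: "poly f u \<noteq> 0 \<or> poly g u \<noteq> 0" using cz by blast
    have "poly (smult (poly g u) f) t = poly (smult (poly f u) g) t" for t
      using evH[of t u] \<open>H = 0\<close> by (simp add: mult.commute)
    then have "smult (poly g u) f = smult (poly f u) g" by (metis poly_ext)
    then show False using wronskian_imp_independent[OF W] u by blast
  qed
  then have "G \<noteq> 0" using cH G(1) by auto
  define Z where "Z = {u. poly c u = 0} \<union> {u. poly (lead_coeff G) u = 0} \<union> {u. \<exists>t. poly f t * poly g u = poly g t * poly f u \<and>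
    poly (pderiv f) t * poly g u = poly (pderiv g) t * poly f u}"
  have roots: "{t. par X A t u} = {t. poly (at_u u G) t = 0}" if "u \<notin> Z" for u
  proof -
    have "par X A t u" if t: "ev2 G t u = 0" for t
      unfolding par_def
    proof (intro ballI)
      fix i j assume ij: "i \<in> X" "j \<in> X"
      have "ev2 (smult c (smult (A j) (lift2 (A i)) - smult (A i) (lift2 (A j)))) t u = ev2 (G * B i j) t u"
        by (simp only: G(2)[OF ij])
      then show "poly (A i) t * poly (A j) u = poly (A j) t * poly (A i) u"
        using t \<open>u \<notin> Z\<close> by (simp add: Z_def mult.commute)
    qed
    then show ?thesis using G(3) by auto
  qed
  have nz: "at_u u G \<noteq> 0" if "u \<notin> Z" for u
  proof -
    have "coeff (at_u u G) (degree G) \<noteq> 0" using that by (simp add: Z_def)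
    then show ?thesis by fastforce
  qed
  have sq: "poly (pderiv (at_u u G)) t \<noteq> 0" if "u \<notin> Z" "poly (at_u u G) t = 0" for u t
  proof
    assume d: "poly (pderiv (at_u u G)) t = 0"
    have "ev2 H t u = 0"
      using arg_cong[OF cH, of "\<lambda>P. ev2 P t u"] that by (simp add: Z_def)
    moreover have "ev2 (pderiv H) t u = 0"
      using arg_cong[OF cH, of "\<lambda>P. ev2 (pderiv P) t u"] that d
      by (simp add: Z_def pderiv_smult pderiv_mult pderiv_at_u)
    moreover have "ev2 (pderiv H) t u = poly (pderiv f) t * poly g u - poly (pderiv g) t * poly f u"
      by (simp add: H_def pderiv_diff pderiv_smult pderiv_lift2 mult.commute)
    ultimately show False using that(1) evH[of t u] by (auto simp: Z_def)
  qed
  show ?thesis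
  proof (intro exI[of _ G] exI[of _ Z] conjI allI impI)
    show "finite Z"
      unfolding Z_def using G(1) \<open>G \<noteq> 0\<close> finite_multiple_members[OF cz W] by (auto intro!: poly_roots_finite)
    fix u assume u: "u \<notin> Z"
    show "{t. par X A t u} = {t. poly (at_u u G) t = 0}" by (rule roots[OF u])
    show "finite {t. par X A t u}" unfolding roots[OF u] by (rule poly_roots_finite[OF nz[OF u]])
    show "card {t. par X A t u} = degree G"
      unfolding roots[OF u] using complex_card_roots[OF nz[OF u] sq[OF u]] u
      by (simp add: degree_at_u Z_def)
  qed (rule \<open>G \<noteq> 0\<close>)
qed

text \<open>A nonzero linear form restricts to a nonzero polynomial on the moment curve. So one
  parameter \<open>\<mu>\<close> can be chosen off countably many hyperplanes.\<close>

lemma finite_moment_zeros: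
  fixes v :: "nat \<Rightarrow> complex"
  assumes "i < d" "v i \<noteq> 0"
  shows "finite {\<mu>. (\<Sum>i<d. v i * \<mu> ^ i) = 0}"
proof -
  have "coeff (\<Sum>i<d. monom (v i) i) i = v i" using assms(1) by (simp add: coeff_sum)
  then have "(\<Sum>i<d. monom (v i) i) \<noteq> 0" using assms(2) by auto
  then have "finite {\<mu>. poly (\<Sum>i<d. monom (v i) i) \<mu> = 0}" by (rule poly_roots_finite)
  then show ?thesis by (simp add: poly_sum poly_monom)
qed

definition dotp :: "nat \<Rightarrow> (nat \<Rightarrow> complex poly) \<Rightarrow> (nat \<Rightarrow> complex) \<Rightarrow> complex poly" where
  "dotp d A x = (\<Sum>i<d. smult (x i) (A i))"

lemma poly_dotp: "poly (dotp d A x) t = (\<Sum>i<d. x i * poly (A i) t)"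
  by (simp add: dotp_def poly_sum)

definition triple :: "complex poly \<Rightarrow> complex poly \<Rightarrow> complex poly \<Rightarrow> nat \<Rightarrow> complex poly" where
  "triple f g h i = (if i = 0 then f else if i = 1 then g else h)"

lemma par_triple: "par {0,1,2} (triple f g h) t u \<longleftrightarrow>
    poly f t * poly g u = poly g t * poly f u \<and> poly f t * poly h u = poly h t * poly f u \<and>
    poly g t * poly h u = poly h t * poly g u"
  by (auto simp: par_def triple_def)

text \<open>
  A projection to a plane that separates the points of countably many fibres is generically as
  injective as \<open>A\<close> itself.
\<close>

lemma generic_projection:
  assumes cz: "\<And>t. \<not> (poly (dotp d A x) t = 0 \<and> poly (dotp d A y) t = 0)"
    and W: "wronskian (dotp d A x) (dotp d A y) \<noteq> 0"
  shows "\<exists>N. countable N \<and> (\<forall>\<mu>. \<mu> \<notin> N \<longrightarrow> (\<exists>Z. finite Z \<and> (\<forall>t u. u \<notin> Z \<longrightarrow>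
    par {0,1,2} (triple (dotp d A x) (dotp d A y) (dotp d A (\<lambda>i. \<mu> ^ i))) t u \<longrightarrow> par {..<d} A t u)))"
proof -
  define f where "f = dotp d A x"
  define g where "g = dotp d A y"
  define H where "H u = smult (poly g u) f - smult (poly f u) g" for u
  have cz': "\<not> (poly f t = 0 \<and> poly g t = 0)" for t using cz by (simp add: f_def g_def)
  have W': "wronskian f g \<noteq> 0" using W by (simp add: f_def g_def)
  have H0: "H u \<noteq> 0" for u
    using wronskian_imp_independent[OF W', of "poly g u" "poly f u"] cz'[of u] by (auto simp: H_def)
  \<comment> \<open>The factor between the values at \<open>t\<close> and at \<open>u\<close>, read
    off from whichever of \<open>f\<close> and \<open>g\<close> is nonzero at \<open>u\<close>. The
    vector \<open>v t u\<close> below measures how far \<open>A(t)\<close> is from being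
    \<open>r t u\<close> times \<open>A(u)\<close>.\<close>
  define r where "r t u = (if poly f u \<noteq> 0 then poly f t / poly f u else poly g t / poly g u)" for t u
  have r: "poly f t = r t u * poly f u" "poly g t = r t u * poly g u" if "poly (H u) t = 0" for t u
    using that cz'[of u] by (auto simp: r_def H_def field_simps)
  define v where "v t u i = poly (A i) t - r t u * poly (A i) u" for t u i
  \<comment> \<open>Only natural numbers \<open>u\<close> are tested: countably many, so that a good
    \<open>\<mu>\<close> exists, and infinitely many, so that polynomial identities in
    \<open>u\<close> follow.\<close>
  define N where "N = (\<Union>u\<in>range of_nat. \<Union>t\<in>{t. poly (H u) t = 0 \<and> \<not> par {..<d} A t u}. {\<mu>. (\<Sum>i<d. v t u i * \<mu> ^ i) = 0})"
  have vnz: "\<exists>i<d. v t u i \<noteq> 0" if np: "\<not> par {..<d} A t u" for t u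
  proof (rule ccontr)
    assume "\<not> ?thesis"
    then have "poly (A i) t = r t u * poly (A i) u" if "i < d" for i using that by (simp add: v_def)
    then have "par {..<d} A t u" by (simp add: par_def)
    then show False using np by simp
  qed
  show ?thesis
  proof (rule exI[of _ N], intro conjI allI impI)
    show "countable N"
      unfolding N_def
    proof (intro countable_UN)
      show "countable (range (of_nat :: nat \<Rightarrow> complex))" by simp
      show "countable {t. poly (H u) t = 0 \<and> \<not> par {..<d} A t u}" for u
        by (rule countable_finite, rule finite_subset[OF _ poly_roots_finite[OF H0[of u]]]) auto
      show "countable {\<mu>. (\<Sum>i<d. v t u i * \<mu> ^ i) = 0}"
        if "t \<in> {t. poly (H u) t = 0 \<and> \<not> par {..<d} A t u}" for u t
        using that vnz[of t u] finite_moment_zeros by (blast intro: countable_finite)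
    qed
  next
    fix \<mu> assume \<mu>: "\<mu> \<notin> N"
    define h where "h = dotp d A (\<lambda>i. \<mu> ^ i)"
    have sep: "par {..<d} A t u" if p: "par {0,1,2} (triple f g h) t u" and u: "u \<in> range of_nat" for t u
    proof (rule ccontr)
      assume np: "\<not> ?thesis"
      have Ht: "poly (H u) t = 0" using p unfolding par_triple by (simp add: H_def mult.commute)
      have "poly h t = r t u * poly h u"
      proof (cases "poly f u = 0")
        case True
        then have "poly g u \<noteq> 0" using cz' by blast
        moreover have "r t u * poly g u * poly h u = poly h t * poly g u"
          using p unfolding par_triple r(2)[OF Ht] by blast
        ultimately show ?thesis by (simp add: mult_ac)
      next
        case False
        moreover have "r t u * poly f u * poly h u = poly h t * poly f u"
          using p unfolding par_triple r(1)[OF Ht] by blast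
        ultimately show ?thesis by (simp add: mult_ac)
      qed
      then have "(\<Sum>i<d. v t u i * \<mu> ^ i) = 0"
        by (simp add: h_def poly_dotp v_def right_diff_distrib sum_subtractf sum_distrib_left mult_ac)
      then show False using \<mu> u np Ht by (auto simp: N_def)
    qed
    have "\<exists>G Z. finite Z \<and> G \<noteq> 0 \<and> (\<forall>u. u \<notin> Z \<longrightarrow>
      {t. par {0,1,2} (triple f g h) t u} = {t. poly (at_u u G) t = 0} \<and>
      finite {t. par {0,1,2} (triple f g h) t u} \<and> card {t. par {0,1,2} (triple f g h) t u} = degree G)"
    proof (rule par_fibre_poly[OF _ _ _ cz' W'])
      show "finite {0, 1, 2 :: nat}" by simp
      show "f = (\<Sum>i\<in>{0,1,2}. smult (if i = 0 then 1 else 0) (triple f g h i))" by (simp add: triple_def)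
      show "g = (\<Sum>i\<in>{0,1,2}. smult (if i = 1 then 1 else 0) (triple f g h i))" by (simp add: triple_def)
    qed
    then obtain G Z where G: "finite Z" "\<And>u. u \<notin> Z \<Longrightarrow> {t. par {0,1,2} (triple f g h) t u} = {t. poly (at_u u G) t = 0}"
      "\<And>u. u \<notin> Z \<Longrightarrow> finite {t. par {0,1,2} (triple f g h) t u}"
      "\<And>u. u \<notin> Z \<Longrightarrow> card {t. par {0,1,2} (triple f g h) t u} = degree G" "G \<noteq> 0"
      by blast
    \<comment> \<open>For each tested \<open>u\<close> outside \<open>Z\<close>, the
      pseudo-remainder of a minor by \<open>G\<close> vanishes at the \<open>degree G\<close> points
      of the projected fibre. Having smaller degree in \<open>t\<close>, it vanishes for infinitely
      many \<open>u\<close>, hence identically.\<close>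
    have "\<exists>a B. a \<noteq> 0 \<and> smult a P = G * B" if P: "P \<in> minors2 {..<d} A" for P
    proof -
      obtain a B where aB: "a \<noteq> 0" "smult a P = G * B + pseudo_mod P G"
        using pseudo_mod(1)[OF G(5)] by blast
      define R where "R = pseudo_mod P G"
      have Ru: "at_u u R = 0" if u: "u \<in> range of_nat - Z" for u
      proof (rule ccontr)
        assume nz: "at_u u R \<noteq> 0"
        then have "R \<noteq> 0" by (auto simp: at_u_def)
        have "{t. par {0,1,2} (triple f g h) t u} \<subseteq> {t. poly (at_u u R) t = 0}"
        proof clarify
          fix t assume t: "par {0,1,2} (triple f g h) t u"
          then have "par {..<d} A t u" using sep u by blast
          then have "ev2 P t u = 0" using P by (simp add: par_iff_minors2)
          moreover have "ev2 G t u = 0" using G(2)[of u] t u by auto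
          ultimately show "poly (at_u u R) t = 0"
            using arg_cong[OF aB(2), of "\<lambda>P. ev2 P t u"] by (simp add: R_def)
        qed
        then have "card {t. par {0,1,2} (triple f g h) t u} \<le> card {t. poly (at_u u R) t = 0}"
          by (rule card_mono[OF poly_roots_finite[OF nz]])
        then have "degree G \<le> card {t. poly (at_u u R) t = 0}"
          using G(4)[of u] u by simp
        also have "\<dots> \<le> degree (at_u u R)" using nz by (rule card_poly_roots_bound)
        also have "\<dots> \<le> degree R" by (auto intro: degree_le simp: coeff_eq_0)
        also have "\<dots> < degree G" using pseudo_mod(2)[OF G(5), of P] \<open>R \<noteq> 0\<close> by (simp add: R_def)
        finally show False by simp
      qed
      have inf: "infinite (range (of_nat :: nat \<Rightarrow> complex) - Z)"
        using G(1) by (intro Diff_infinite_finite range_inj_infinite) (auto simp: inj_on_def)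
      have "coeff R n = 0" for n
      proof (rule ccontr)
        assume "coeff R n \<noteq> 0"
        then have "finite {u. poly (coeff R n) u = 0}" by (rule poly_roots_finite)
        moreover have "range of_nat - Z \<subseteq> {u. poly (coeff R n) u = 0}"
          using arg_cong[OF Ru, of _ "\<lambda>p. coeff p n"] by auto
        ultimately show False using inf finite_subset by blast
      qed
      then have "R = 0" by (simp add: poly_eq_iff)
      then show ?thesis using aB by (auto simp: R_def)
    qed
    then obtain a B where aB: "\<And>P. P \<in> minors2 {..<d} A \<Longrightarrow> a P \<noteq> 0 \<and> smult (a P) P = G * B P" by metis
    define Z' where "Z' = Z \<union> (\<Union>P\<in>minors2 {..<d} A. {u. poly (a P) u = 0})"
    have "finite Z'" unfolding Z'_def using G(1) aB by (auto simp: minors2_def intro!: poly_roots_finite)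
    moreover have "par {..<d} A t u" if u: "u \<notin> Z'" and p: "par {0,1,2} (triple f g h) t u" for t u
      unfolding par_iff_minors2
    proof
      fix P assume P: "P \<in> minors2 {..<d} A"
      have "ev2 G t u = 0" using G(2)[of u] p u by (auto simp: Z'_def)
      then have "poly (a P) u * ev2 P t u = 0"
        using arg_cong[OF conjunct2[OF aB[OF P]], of "\<lambda>P. ev2 P t u"] by simp
      then show "ev2 P t u = 0" using u P by (auto simp: Z'_def)
    qed
    ultimately show "\<exists>Z. finite Z \<and> (\<forall>t u. u \<notin> Z \<longrightarrow>
        par {0,1,2} (triple (dotp d A x) (dotp d A y) (dotp d A (\<lambda>i. \<mu> ^ i))) t u \<longrightarrow> par {..<d} A t u)"
      unfolding f_def[symmetric] g_def[symmetric] h_def[symmetric] by blast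
  qed
qed

text \<open>
  Biduality of plane curves: the tangent lines \<open>a = F \<times> F'\<close> determine the points of tangency,
  because \<open>a \<times> a' = det (F, F', F'') F\<close>.
\<close>

definition det3 :: "complex poly \<Rightarrow> complex poly \<Rightarrow> complex poly \<Rightarrow> complex poly" where
  "det3 f g h = wronskian f g * pderiv (pderiv h) - wronskian f h * pderiv (pderiv g)
     + wronskian g h * pderiv (pderiv f)"

lemma plane_biduality:
  assumes D: "det3 f g h \<noteq> 0"
  shows "\<exists>Z. finite Z \<and> (\<forall>t u. t \<notin> Z \<longrightarrow> u \<notin> Z \<longrightarrow>
    par {0,1,2} (triple (wronskian g h) (wronskian h f) (wronskian f g)) t u \<longrightarrow> par {0,1,2} (triple f g h) t u)"
proof -
  let ?a = "triple (wronskian g h) (wronskian h f) (wronskian f g)"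
  have cross: "wronskian (wronskian h f) (wronskian f g) = det3 f g h * f"
    "wronskian (wronskian f g) (wronskian g h) = det3 f g h * g"
    "wronskian (wronskian g h) (wronskian h f) = det3 f g h * h"
    by (simp_all only: wronskian_def det3_def pderiv_mult pderiv_diff) (simp_all only: algebra_simps)
  obtain Z where Z: "finite Z" "\<And>t u. u \<notin> Z \<Longrightarrow> par {0,1,2} ?a t u \<Longrightarrow>
    \<exists>i\<in>{0,1,2}. poly (?a i) t \<noteq> 0 \<Longrightarrow> \<exists>i\<in>{0,1,2}. poly (?a i) u \<noteq> 0 \<Longrightarrow>
    par ({0,1,2} \<times> {0,1,2}) (\<lambda>(i, j). wronskian (?a i) (?a j)) t u"
    using par_imp_par_tangent[of "{0,1,2::nat}" ?a] by blast
  have anz: "\<exists>i\<in>{0,1,2}. poly (?a i) t \<noteq> 0" if "poly (det3 f g h) t \<noteq> 0" for t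
  proof (rule ccontr)
    assume "\<not> ?thesis"
    then have "poly (wronskian g h) t = 0" "poly (wronskian h f) t = 0" "poly (wronskian f g) t = 0"
      by (auto simp: triple_def)
    then show False using that by (simp add: det3_def poly_wronskian algebra_simps)
  qed
  \<comment> \<open>Off the roots of the determinant the tangent vector is nonzero, and the factor
    \<open>det3 f g h\<close> of the cross products can be cancelled.\<close>
  show ?thesis
  proof (rule exI[of _ "Z \<union> {t. poly (det3 f g h) t = 0}"], intro conjI allI impI)
    show "finite (Z \<union> {t. poly (det3 f g h) t = 0})" using Z(1) D by (simp add: poly_roots_finite)
    fix t u assume t: "t \<notin> Z \<union> {t. poly (det3 f g h) t = 0}" and u: "u \<notin> Z \<union> {t. poly (det3 f g h) t = 0}"
      and p: "par {0,1,2} ?a t u"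
    have P: "par ({0,1,2} \<times> {0,1,2}) (\<lambda>(i, j). wronskian (?a i) (?a j)) t u"
      by (rule Z(2)[OF _ p anz anz]) (use t u in auto)
    have *: "poly (wronskian (?a i) (?a j)) t * poly (wronskian (?a k) (?a l)) u =
      poly (wronskian (?a k) (?a l)) t * poly (wronskian (?a i) (?a j)) u"
      if "i \<in> {0,1,2}" "j \<in> {0,1,2}" "k \<in> {0,1,2}" "l \<in> {0,1,2}" for i j k l
    proof -
      have ij: "(i, j) \<in> {0,1,2} \<times> {0,1,2}" and kl: "(k, l) \<in> {0,1,2} \<times> {0,1,2}" using that by blast+
      show ?thesis using bspec[OF bspec[OF P[unfolded par_def] ij] kl] by (simp only: prod.case)
    qed
    show "par {0,1,2} (triple f g h) t u"
      unfolding par_triple using *[of 1 2 2 0] *[of 1 2 0 1] *[of 2 0 0 1] t u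
      by (simp add: par_triple triple_def cross mult_ac)
  qed
qed

text \<open>Leading coefficients in \<open>f * pderiv p = p * pderiv f\<close> show that every
  nonzero solution \<open>p\<close> has the degree of \<open>f\<close>. Subtracting from
  \<open>h\<close> the multiple of \<open>f\<close> that cancels the leading term leaves a solution
  that must be 0.\<close>

lemma wronskian_eq_0_imp:
  assumes W: "wronskian f h = 0" and f: "f \<noteq> 0"
  shows "\<exists>c. h = smult c f"
proof -
  have deg: "degree p = degree f" if "wronskian f p = 0" "p \<noteq> 0" for p
  proof (rule ccontr)
    assume ne: "degree p \<noteq> degree f"
    have eq: "f * pderiv p = p * pderiv f" using that(1) by (simp add: wronskian_def)
    have c1: "coeff (f * pderiv p) (degree f + (degree p - 1)) = lead_coeff f * (of_nat (degree p) * lead_coeff p)" if "degree p > 0"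
      using that coeff_mult_degree_sum[of f "pderiv p"] by (simp add: degree_pderiv coeff_pderiv)
    have c2: "coeff (p * pderiv f) (degree p + (degree f - 1)) = lead_coeff p * (of_nat (degree f) * lead_coeff f)" if "degree f > 0"
      using that coeff_mult_degree_sum[of p "pderiv f"] by (simp add: degree_pderiv coeff_pderiv)
    consider "degree p = 0" "degree f > 0" | "degree f = 0" "degree p > 0" | "degree f > 0" "degree p > 0" using ne by linarith
    then show False
    proof cases
      case 1
      then have "pderiv p = 0" by (simp add: pderiv_eq_0_iff)
      then have "pderiv f = 0" using eq that(2) by (metis mult_eq_0_iff mult_zero_right)
      then show ?thesis using 1 by (simp add: pderiv_eq_0_iff)
    next
      case 2
      then have "pderiv f = 0" by (simp add: pderiv_eq_0_iff)
      then have "pderiv p = 0" using eq f by (metis mult_eq_0_iff mult_zero_right)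
      then show ?thesis using 2 by (simp add: pderiv_eq_0_iff)
    next
      case 3
      then have "degree f + (degree p - 1) = degree p + (degree f - 1)" by simp
      then have "lead_coeff f * (of_nat (degree p) * lead_coeff p) = lead_coeff p * (of_nat (degree f) * lead_coeff f)"
        using c1 c2 3 eq by metis
      then have "of_nat (degree p) = (of_nat (degree f) :: complex)" using f that(2) by simp
      then show ?thesis using ne by simp
    qed
  qed
  show ?thesis
  proof (cases "h = 0")
    case True
    then show ?thesis by (intro exI[of _ 0]) simp
  next
    case False
    define c where "c = lead_coeff h / lead_coeff f"
    define p where "p = h - smult c f"
    have "wronskian f p = 0" using W by (simp add: wronskian_def p_def pderiv_diff pderiv_smult algebra_simps)
    moreover have "coeff p (degree f) = 0" using deg[OF W False] f by (simp add: p_def c_def)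
    ultimately have "p = 0" using deg[of p] leading_coeff_0_iff[of p] by metis
    then show ?thesis by (auto simp: p_def)
  qed
qed

lemma coeff_mult_bounds:
  assumes "degree p \<le> m" "degree q \<le> n"
  shows "coeff (p * q) (m + n) = coeff p m * coeff q n"
proof -
  have "coeff p i * coeff q (m + n - i) = 0" if "i \<in> {..m + n} - {m}" for i
    using that assms by (cases "i < m") (auto simp: coeff_eq_0)
  then have "coeff (p * q) (m + n) = (\<Sum>i\<in>{m}. coeff p i * coeff q (m + n - i))"
    unfolding coeff_mult by (intro sum.mono_neutral_right) auto
  then show ?thesis by simp
qed

lemma polyfam_dotp: "polyfam d (dotp d A)"
  unfolding dotp_def by (intro polyfam_sum polyfam_smult polyfam_const polyfun.coord) auto

lemma polyfam_diff: "polyfam d p \<Longrightarrow> polyfam d q \<Longrightarrow> polyfam d (\<lambda>x. p x - q x)"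
  using polyfam_add[OF _ polyfam_smult[OF polyfun.const[of d "-1"], of q], of p] by simp

lemma dotp_add: "dotp d A (\<lambda>i. x i + c * y i) = dotp d A x + smult c (dotp d A y)"
  by (simp add: dotp_def smult_add_left sum.distrib smult_sum2)

lemma dotp_scale: "dotp d A (\<lambda>i. c * x i) = smult c (dotp d A x)"
  by (simp add: dotp_def smult_sum2)

lemma degree_dotp: "(\<And>i. i < d \<Longrightarrow> degree (A i) \<le> n) \<Longrightarrow> degree (dotp d A x) \<le> n"
  unfolding dotp_def by (intro degree_sum_le) (auto intro: order_trans[OF degree_smult_le])

lemma coeff_dotp: "coeff (dotp d A x) n = (\<Sum>i<d. x i * coeff (A i) n)"
  by (simp add: dotp_def coeff_sum)

section \<open>Pencils of hyperplanes with independent values\<close>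

definition unit_fun :: "nat \<Rightarrow> nat \<Rightarrow> complex" where
  "unit_fun i = (\<lambda>j. if j = i then 1 else 0)"

lemma dotp_unit_fun: "i < d \<Longrightarrow> dotp d A (unit_fun i) = A i"
proof -
  assume "i < d"
  then have "(\<Sum>j<d. smult (unit_fun i j) (A j)) = (\<Sum>j<d. if j = i then A j else 0)"
    by (intro sum.cong) (auto simp: unit_fun_def)
  then show ?thesis using \<open>i < d\<close> by (simp add: dotp_def)
qed

lemma polyfun_compose:
  assumes "polyfun d f" "\<And>i. i < d \<Longrightarrow> polyfun e (\<lambda>z. g z i)"
  shows "polyfun e (\<lambda>z. f (g z))"
  using assms(1) by induction (use assms(2) in \<open>auto intro: polyfun.intros\<close>)

text \<open>Every requirement is the nonvanishing of a polynomial function of \<open>y\<close>: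
  common zeros are tested at the finitely many roots of \<open>f\<close>, and the Wronskian at the
  single point \<open>t0\<close>. \<open>D\<close> carries a further generic condition
  along.\<close>

lemma generic_partner:
  assumes cz: "\<And>t. \<exists>i<d. poly (C i) t \<noteq> 0" and f: "f \<noteq> 0" and W: "i < d" "wronskian f (C i) \<noteq> 0"
    and D: "polyfun d D" "D x0 \<noteq> 0"
  shows "\<exists>y. D y \<noteq> 0 \<and> (\<forall>t. \<not> (poly f t = 0 \<and> poly (dotp d C y) t = 0)) \<and> wronskian f (dotp d C y) \<noteq> 0"
proof -
  obtain t0 where t0: "poly (wronskian f (C i)) t0 \<noteq> 0" using W(2) by (metis poly_all_0_iff_0)
  define D1 where "D1 y = poly (wronskian f (dotp d C y)) t0" for y
  define D2 where "D2 y = (\<Prod>t\<in>{t. poly f t = 0}. poly (dotp d C y) t)" for y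
  have p: "polyfun d D1" unfolding D1_def wronskian_def
    by (intro polyfun_poly polyfun.const polyfam_diff polyfam_mult polyfam_const polyfam_pderiv polyfam_dotp)
  have pp: "polyfun d (\<lambda>y. poly (dotp d C y) t)" for t
    by (intro polyfun_poly polyfun.const polyfam_dotp)
  have p2: "polyfun d D2" unfolding D2_def by (intro polyfun_prod pp)
  have ex: "\<exists>y. poly (dotp d C y) t \<noteq> 0" for t
  proof -
    obtain j where "j < d" "poly (C j) t \<noteq> 0" using cz by blast
    then show ?thesis by (intro exI[of _ "unit_fun j"]) (simp add: dotp_unit_fun)
  qed
  have fin: "finite {t. poly f t = 0}" using f by (rule poly_roots_finite)
  obtain y2 where y2: "\<forall>t\<in>{t. poly f t = 0}. poly (dotp d C y2) t \<noteq> 0"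
    using polyfun_common_nonzero[OF fin, of d "\<lambda>t y. poly (dotp d C y) t"] pp ex by blast
  then have "D2 y2 \<noteq> 0" using fin by (simp add: D2_def)
  moreover have "D1 (unit_fun i) \<noteq> 0" using t0 W(1) by (simp add: D1_def dotp_unit_fun)
  ultimately obtain y where y: "D2 y \<noteq> 0 \<and> D1 y \<noteq> 0" using polyfun_mult_nonzero[OF p2 p] by blast
  then have "D2 y * D1 y \<noteq> 0" by simp
  then obtain z where "D2 z * D1 z \<noteq> 0 \<and> D z \<noteq> 0"
    using polyfun_mult_nonzero[OF polyfun.mult[OF p2 p] D(1)] D(2) by blast
  then have "D z \<noteq> 0" "D2 z \<noteq> 0" "D1 z \<noteq> 0" by auto
  then show ?thesis using fin by (intro exI[of _ z]) (auto simp: D1_def D2_def)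
qed

text \<open>Otherwise all \<open>C i\<close> are multiples of \<open>f\<close>. The coefficient of
  degree \<open>n\<close> makes \<open>f\<close> nonconstant, and a root of \<open>f\<close> would
  be a common zero.\<close>

lemma exists_wronskian:
  assumes cz: "\<And>t. \<exists>i<d. poly (C i) t \<noteq> 0" and n: "n > 0" "i < d" "coeff (C i) n \<noteq> 0" and f: "f \<noteq> 0"
  shows "\<exists>i<d. wronskian f (C i) \<noteq> 0"
proof (rule ccontr)
  assume "\<not> ?thesis"
  then have "\<forall>i<d. \<exists>c. C i = smult c f" using wronskian_eq_0_imp[OF _ f] by blast
  then obtain c where c: "\<forall>i<d. C i = smult (c i) f" by metis
  then have "coeff f n \<noteq> 0" using n by auto
  then have "degree f \<noteq> 0" using n(1) coeff_eq_0[of f n] by (cases "degree f = 0") auto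
  then have "\<not> constant (poly f)" by (simp add: constant_degree)
  then obtain t where "poly f t = 0" using fundamental_theorem_of_algebra by blast
  then show False using cz[of t] c by auto
qed

text \<open>\<open>n1\<close> and \<open>n2\<close> are formal degrees. The two independence
  conditions say that the minors, as forms of degree \<open>n1 + n2\<close>, have no common zero on
  the projective line, infinity included.\<close>

locale line_family =
  fixes d n1 n2 :: nat and A B :: "nat \<Rightarrow> complex poly"
  assumes degA: "\<And>i. i < d \<Longrightarrow> degree (A i) \<le> n1" and degB: "\<And>i. i < d \<Longrightarrow> degree (B i) \<le> n2"
    and indep: "\<And>t. \<exists>i<d. \<exists>j<d. poly (A i) t * poly (B j) t \<noteq> poly (A j) t * poly (B i) t"
    and indep_inf: "\<exists>i<d. \<exists>j<d. coeff (A i) n1 * coeff (B j) n2 \<noteq> coeff (A j) n1 * coeff (B i) n2"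
    and pos: "n1 + n2 > 0"
begin

abbreviation "n \<equiv> n1 + n2"
abbreviation "a x \<equiv> dotp d A x"
abbreviation "b x \<equiv> dotp d B x"

definition res :: "(nat \<Rightarrow> complex) \<Rightarrow> complex" where
  "res x = resultant_sub n1 n2 (a x) (b x)"

text \<open>The subspace of codimension two dual to the line spanned by \<open>A(t)\<close> and \<open>B(t)\<close>.\<close>

definition on_line :: "complex \<Rightarrow> (nat \<Rightarrow> complex) \<Rightarrow> bool" where
  "on_line t x \<longleftrightarrow> poly (a x) t = 0 \<and> poly (b x) t = 0"

definition w :: "nat \<times> nat \<Rightarrow> complex poly" where
  "w = (\<lambda>(i, j). A i * B j - A j * B i)"

abbreviation "I2 \<equiv> {..<d} \<times> {..<d}"

lemma deg_a: "degree (a x) \<le> n1" and deg_b: "degree (b x) \<le> n2"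
  using degA degB by (auto intro: degree_dotp)

lemma polyfun_res: "polyfun d res"
  unfolding res_def[abs_def] by (intro polyfun_resultant_sub polyfam_dotp)

lemma res_eq_0_iff: "res x = 0 \<longleftrightarrow> (\<exists>t. on_line t x) \<or> (coeff (a x) n1 = 0 \<and> coeff (b x) n2 = 0)"
  unfolding res_def on_line_def by (rule resultant_sub_eq_0_iff[OF deg_a deg_b pos])

lemma w_nonzero: "\<exists>p\<in>I2. poly (w p) t \<noteq> 0"
proof -
  obtain i j where "i < d" "j < d" "poly (A i) t * poly (B j) t \<noteq> poly (A j) t * poly (B i) t" using indep by blast
  then show ?thesis by (intro bexI[of _ "(i, j)"]) (auto simp: w_def)
qed

text \<open>The subspace depends only on the Pluecker coordinates: it is the common kernel of the
  linear forms with coefficients \<open>w (i, j)\<close>, whose values at \<open>x\<close> are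
  \<open>A i * b x - B i * a x\<close>.\<close>

lemma on_line_par:
  assumes p: "par I2 w t u" and u: "on_line u x"
  shows "on_line t x"
proof -
  obtain i j where ij: "i < d" "j < d" "poly (w (i, j)) u \<noteq> 0" using w_nonzero[of u] by auto
  obtain r where r: "\<forall>p\<in>I2. poly (w p) t = r * poly (w p) u"
    using par_scalar[OF p, of "(i, j)"] ij by auto
  have id: "poly (A i) s * poly (b x) s - poly (B i) s * poly (a x) s = (\<Sum>j<d. x j * poly (w (i, j)) s)" for i s
    by (simp add: poly_dotp w_def sum_distrib_left sum_subtractf right_diff_distrib mult_ac)
  have z: "poly (A i) t * poly (b x) t - poly (B i) t * poly (a x) t = 0" if "i < d" for i
  proof -
    have "(\<Sum>j<d. x j * poly (w (i, j)) t) = r * (\<Sum>j<d. x j * poly (w (i, j)) u)"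
      using r that by (simp add: sum_distrib_left mult_ac)
    also have "\<dots> = 0" using u by (simp add: on_line_def flip: id)
    finally show ?thesis by (simp add: id)
  qed
  obtain i j where ij: "i < d" "j < d" "poly (A i) t * poly (B j) t \<noteq> poly (A j) t * poly (B i) t" using indep by blast
  have e: "poly (A i) t * poly (b x) t = poly (B i) t * poly (a x) t" "poly (A j) t * poly (b x) t = poly (B j) t * poly (a x) t"
    using z[OF ij(1)] z[OF ij(2)] by simp_all
  have "(poly (A i) t * poly (B j) t - poly (A j) t * poly (B i) t) * poly (a x) t =
      poly (A i) t * (poly (B j) t * poly (a x) t) - poly (A j) t * (poly (B i) t * poly (a x) t)" by (simp add: algebra_simps)
  also have "\<dots> = 0" by (simp only: e[symmetric]) (simp add: mult_ac)
  finally have 1: "poly (a x) t = 0" using ij by simp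
  have "(poly (A i) t * poly (B j) t - poly (A j) t * poly (B i) t) * poly (b x) t =
      poly (B j) t * (poly (A i) t * poly (b x) t) - poly (B i) t * (poly (A j) t * poly (b x) t)" by (simp add: algebra_simps)
  also have "\<dots> = 0" by (simp only: e) (simp add: mult_ac)
  finally have 2: "poly (b x) t = 0" using ij by simp
  show ?thesis using 1 2 by (simp add: on_line_def)
qed

lemma par_w_sym: "par I2 w t u \<Longrightarrow> par I2 w u t"
  by (auto simp: par_def mult_ac)

lemma par_w_trans: "par I2 w s t \<Longrightarrow> par I2 w t u \<Longrightarrow> par I2 w s u"
proof -
  assume p: "par I2 w s t" "par I2 w t u"
  obtain i where i: "i \<in> I2" "poly (w i) t \<noteq> 0" using w_nonzero[of t] by blast
  obtain j where j: "j \<in> I2" "poly (w j) u \<noteq> 0" using w_nonzero[of u] by blast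
  obtain r where r: "\<forall>p\<in>I2. poly (w p) s = r * poly (w p) t" using par_scalar[OF p(1) i] by blast
  obtain r' where r': "\<forall>p\<in>I2. poly (w p) t = r' * poly (w p) u" using par_scalar[OF p(2) j] by blast
  have "poly (w p) s = r * (r' * poly (w p) u)" if "p \<in> I2" for p
    using bspec[OF r that] bspec[OF r' that] by (simp only:)
  note * = this
  show ?thesis
    unfolding par_def
  proof (intro ballI)
    fix p p' assume "p \<in> I2" "p' \<in> I2"
    then show "poly (w p) s * poly (w p') u = poly (w p') s * poly (w p) u"
      using *[of p] *[of p'] by (simp add: mult_ac)
  qed
qed

text \<open>Points of a pencil \<open>q + l z\<close> lie in a subspace only at roots
  \<open>t\<close> of \<open>Dl\<close>; each of these finitely many parameters rules out one
  \<open>l\<close>, and infinity rules out one more.\<close>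

lemma res_nonzero: "\<exists>q. res q \<noteq> 0"
proof -
  obtain i0 j0 where ij0: "i0 < d" "j0 < d" "coeff (A i0) n1 * coeff (B j0) n2 \<noteq> coeff (A j0) n1 * coeff (B i0) n2"
    using indep_inf by blast
  then obtain i1 where i1: "i1 < d" "coeff (A i1) n1 \<noteq> 0" by (metis mult_eq_0_iff)
  \<comment> \<open>The coefficient of degree \<open>n1\<close> of \<open>a ?q\<close> is nonzero,
    so at most one \<open>l\<close> lets the leading coefficient vanish.\<close>
  let ?q = "unit_fun i1"
  have aq: "a ?q = A i1" using i1 by (simp add: dotp_unit_fun)
  have A1: "A i1 \<noteq> 0" using i1 by auto
  then obtain s where s: "poly (A i1) s \<noteq> 0" by (metis poly_all_0_iff_0)
  \<comment> \<open>Chosen so that the sum of the \<open>z i * C i\<close> is the value of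
    \<open>Dl\<close> at \<open>s\<close>; a nonzero sum keeps \<open>Dl\<close> from vanishing
    identically.\<close>
  define C where "C i = poly (A i1) s * poly (B i) s - poly (b ?q) s * poly (A i) s" for i
  have C: "\<exists>i<d. C i \<noteq> 0"
  proof (rule ccontr)
    assume "\<not> ?thesis"
    then have c: "poly (B i) s = poly (b ?q) s / poly (A i1) s * poly (A i) s" if "i < d" for i
      using that s by (auto simp: C_def field_simps)
    obtain i j where "i < d" "j < d" "poly (A i) s * poly (B j) s \<noteq> poly (A j) s * poly (B i) s" using indep by blast
    then show False using c[of i] c[of j] by simp
  qed
  define T where "T = {t. poly (A i1) t = 0}"
  have fin: "finite T" unfolding T_def using A1 by (rule poly_roots_finite)
  text \<open>Second point of a pencil \<open>q + l z\<close>: off the hyperplanes of \<open>A\<close> at the roots of \<open>A \<cdot> q\<close>,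
    or of \<open>B\<close> where \<open>A\<close> vanishes identically.\<close>
  have ex: "\<exists>z. poly (a z) t \<noteq> 0 \<or> poly (b z) t \<noteq> 0" for t
  proof -
    obtain i j where "i < d" "j < d" "poly (A i) t * poly (B j) t \<noteq> poly (A j) t * poly (B i) t" using indep by blast
    then have "poly (A i) t \<noteq> 0 \<or> poly (B i) t \<noteq> 0" by auto
    then show ?thesis using \<open>i < d\<close> by (intro exI[of _ "unit_fun i"]) (simp add: dotp_unit_fun)
  qed
  define h where "h t z = (if \<exists>z. poly (a z) t \<noteq> 0 then poly (a z) t else poly (b z) t)" for t z
  have ph: "polyfun d (h t)" for t
    unfolding h_def[abs_def] by (cases "\<exists>z. poly (a z) t \<noteq> 0") (auto intro!: polyfun_poly polyfam_dotp polyfun.const)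
  have hex: "\<exists>z. h t z \<noteq> 0" for t unfolding h_def using ex[of t] by (cases "\<exists>z. poly (a z) t \<noteq> 0") auto
  obtain z1 where z1: "\<forall>t\<in>T. h t z1 \<noteq> 0"
    using polyfun_common_nonzero[OF fin, of d h] ph hex by blast
  obtain i where i: "i < d" "C i \<noteq> 0" using C by blast
  have "\<exists>z. (\<Prod>t\<in>T. h t z) \<noteq> 0 \<and> (\<Sum>i<d. z i * C i) \<noteq> 0"
  proof (rule polyfun_mult_nonzero[of d _ _ z1 "unit_fun i"])
    show "polyfun d (\<lambda>z. \<Prod>t\<in>T. h t z)" by (intro polyfun_prod ph)
    show "polyfun d (\<lambda>z. \<Sum>i<d. z i * C i)" by (intro polyfun_intros) auto
    show "(\<Prod>t\<in>T. h t z1) \<noteq> 0" using z1 fin by simp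
    have "(\<Sum>j<d. unit_fun i j * C j) = (\<Sum>j<d. if j = i then C j else 0)" by (intro sum.cong) (auto simp: unit_fun_def)
    then show "(\<Sum>j<d. unit_fun i j * C j) \<noteq> 0" using i by simp
  qed
  then obtain z where z: "(\<Prod>t\<in>T. h t z) \<noteq> 0" "(\<Sum>i<d. z i * C i) \<noteq> 0" by blast
  define Dl where "Dl = a ?q * b z - a z * b ?q"
  have "(\<Sum>i<d. z i * C i) = poly (A i1) s * poly (b z) s - poly (b ?q) s * poly (a z) s"
    unfolding C_def poly_dotp[of d B z] poly_dotp[of d A z]
    by (simp add: right_diff_distrib sum_subtractf sum_distrib_left mult.left_commute)
  then have "poly Dl s = (\<Sum>i<d. z i * C i)" by (simp add: Dl_def aq)
  then have "Dl \<noteq> 0" using z(2) by auto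
  then have finD: "finite {t. poly Dl t = 0}" by (rule poly_roots_finite)
  define pt where "pt l = (\<lambda>i. ?q i + l * z i)" for l
  \<comment> \<open>The only \<open>l\<close> for which \<open>q + l z\<close> can lie in the
    subspace at \<open>t\<close>. The value 0 is a dummy: by the choice of \<open>z\<close>, no
    point of the pencil lies there when both denominators vanish.\<close>
  define F where "F t = (if poly (a z) t = 0 then (if poly (b z) t = 0 then 0 else - poly (b ?q) t / poly (b z) t) else - poly (a ?q) t / poly (a z) t)" for t
  have "finite (insert (- coeff (a ?q) n1 / coeff (a z) n1) (F ` {t. poly Dl t = 0}))" using finD by simp
  then obtain l where l: "l \<notin> insert (- coeff (a ?q) n1 / coeff (a z) n1) (F ` {t. poly Dl t = 0})"
    using ex_new_if_finite[OF infinite_UNIV_char_0] by blast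
  have "res (pt l) \<noteq> 0"
  proof
    assume "res (pt l) = 0"
    then consider t where "on_line t (pt l)" | "coeff (a (pt l)) n1 = 0" using res_eq_0_iff by blast
    then show False
    proof cases
      case (1 t)
      then have e: "poly (a ?q) t + l * poly (a z) t = 0" "poly (b ?q) t + l * poly (b z) t = 0"
        by (simp_all add: on_line_def pt_def dotp_add)
      have e': "poly (a ?q) t = - l * poly (a z) t" "poly (b ?q) t = - l * poly (b z) t"
        using e by (simp_all add: eq_neg_iff_add_eq_0)
      have Dt: "poly Dl t = 0" using e' by (simp add: Dl_def)
      have "poly (a z) t \<noteq> 0 \<or> poly (b z) t \<noteq> 0"
      proof (rule ccontr)
        assume n: "\<not> ?thesis"
        then have "t \<in> T" using e'(1) aq by (simp add: T_def)
        then have "h t z \<noteq> 0" using z(1) fin by auto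
        then show False using n by (simp add: h_def split: if_splits)
      qed
      then have "l = F t" using e' by (auto simp: F_def)
      then show False using l Dt by blast
    next
      case 2
      then have "coeff (a ?q) n1 + l * coeff (a z) n1 = 0" by (simp add: pt_def dotp_add)
      then have "l = - coeff (a ?q) n1 / coeff (a z) n1"
        using i1 aq by (cases "coeff (a z) n1 = 0") (auto simp: field_simps eq_neg_iff_add_eq_0)
      then show False using l by simp
    qed
  qed
  then show ?thesis by blast
qed

end

text \<open>Comparison of coefficients in \<open>pderiv F * G = k F * pderiv G\<close>. The top
  coefficient of \<open>G\<close> occurs only once, multiplied by the integer
  \<open>k * Suc i\<close>.\<close>

lemma kth_root_coeffs:
  fixes G :: "complex poly"
  assumes "k > 0" "coeff G 0 = 1" "F = G ^ k"
  shows "of_nat (k * Suc i) * coeff G (Suc i) =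
    (\<Sum>j\<le>i. (of_nat (Suc j) - of_nat k * of_nat (i - j)) * coeff F (Suc j) * coeff G (i - j))"
proof -
  have F0: "coeff F 0 = 1" using assms by (simp add: coeff_0_power)
  have "pderiv F * G = smult (of_nat k) (F * pderiv G)"
  proof -
    obtain l where k: "k = Suc l" using assms(1) by (cases k) auto
    show ?thesis unfolding assms(3) k pderiv_power_Suc by (simp add: mult_ac del: of_nat_Suc)
  qed
  then have "coeff (pderiv F * G) i = coeff (smult (of_nat k) (F * pderiv G)) i" by simp
  then have eq: "(\<Sum>j\<le>i. of_nat (Suc j) * coeff F (Suc j) * coeff G (i - j)) =
      of_nat k * (\<Sum>j\<le>i. coeff F j * (of_nat (Suc (i - j)) * coeff G (Suc (i - j))))"
    by (simp add: coeff_mult coeff_pderiv del: of_nat_Suc)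
  have "(\<Sum>j\<le>i. coeff F j * (of_nat (Suc (i - j)) * coeff G (Suc (i - j)))) =
      (\<Sum>j\<le>Suc i. coeff F j * (of_nat (Suc i - j) * coeff G (Suc i - j)))"
    by (simp add: Suc_diff_le del: of_nat_Suc of_nat_diff)
  also have "\<dots> = of_nat (Suc i) * coeff G (Suc i) + (\<Sum>j\<le>i. coeff F (Suc j) * (of_nat (i - j) * coeff G (i - j)))"
    by (subst sum.atMost_Suc_shift) (simp add: F0 del: of_nat_Suc of_nat_diff sum.atMost_Suc)
  finally have T: "(\<Sum>j\<le>i. of_nat (Suc j) * coeff F (Suc j) * coeff G (i - j)) = of_nat k * (of_nat (Suc i) * coeff G (Suc i)
      + (\<Sum>j\<le>i. coeff F (Suc j) * (of_nat (i - j) * coeff G (i - j))))"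
    by (simp only: eq)
  have "(\<Sum>j\<le>i. (of_nat (Suc j) - of_nat k * of_nat (i - j)) * coeff F (Suc j) * coeff G (i - j)) =
      (\<Sum>j\<le>i. of_nat (Suc j) * coeff F (Suc j) * coeff G (i - j))
       - of_nat k * (\<Sum>j\<le>i. coeff F (Suc j) * (of_nat (i - j) * coeff G (i - j)))"
    unfolding sum_distrib_left sum_subtractf[symmetric]
    by (intro sum.cong refl) (simp add: algebra_simps del: of_nat_Suc of_nat_diff)
  then show ?thesis
    unfolding T by (simp only: of_nat_mult distrib_left add_diff_cancel_right' mult.assoc)
qed

text \<open>The recursion defines polynomial functions \<open>h j\<close> for every
  \<open>y\<close>. They are the coefficients of a root only where a normalized root exists, which
  suffices since this holds on a dense set.\<close>

lemma kth_root_family: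
  assumes F: "polyfam d F" and k: "k > 0"
  shows "\<exists>h. (\<forall>j. polyfun d (h j)) \<and> (\<forall>y G j. F y = G ^ k \<longrightarrow> coeff G 0 = 1 \<longrightarrow> coeff G j = h j y)"
proof -
  define step :: "nat \<Rightarrow> (nat \<Rightarrow> (nat \<Rightarrow> complex) \<Rightarrow> complex) \<Rightarrow> (nat \<Rightarrow> complex) \<Rightarrow> complex" where
    "step i g y = (\<Sum>j\<le>i. (of_nat (Suc j) - of_nat k * of_nat (i - j)) * coeff (F y) (Suc j) * g (i - j) y) * inverse (of_nat (k * Suc i))" for i g y
  have "\<exists>g. \<forall>j\<le>n. polyfun d (g j) \<and> (\<forall>y G. F y = G ^ k \<longrightarrow> coeff G 0 = 1 \<longrightarrow> coeff G j = g j y)" for n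
  proof (induction n)
    case 0
    then show ?case by (intro exI[of _ "\<lambda>j y. 1"]) (auto intro: polyfun.const)
  next
    case (Suc n)
    then obtain g where g: "\<forall>j\<le>n. polyfun d (g j) \<and> (\<forall>y G. F y = G ^ k \<longrightarrow> coeff G 0 = 1 \<longrightarrow> coeff G j = g j y)" by blast
    have p: "polyfun d (step n g)"
      unfolding step_def[abs_def] using g F by (intro polyfun_intros polyfam_coeff) auto
    have c: "coeff G (Suc n) = step n g y" if "F y = G ^ k" "coeff G 0 = 1" for y G
    proof -
      have "of_nat (k * Suc n) * coeff G (Suc n) =
          (\<Sum>j\<le>n. (of_nat (Suc j) - of_nat k * of_nat (n - j)) * coeff (F y) (Suc j) * coeff G (n - j))"
        by (rule kth_root_coeffs[OF k that(2,1)])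
      also have "\<dots> = (\<Sum>j\<le>n. (of_nat (Suc j) - of_nat k * of_nat (n - j)) * coeff (F y) (Suc j) * g (n - j) y)"
        using g that by (intro sum.cong refl) (metis diff_le_self)
      finally have eq: "of_nat (k * Suc n) * coeff G (Suc n) = (\<Sum>j\<le>n. (of_nat (Suc j) - of_nat k * of_nat (n - j)) * coeff (F y) (Suc j) * g (n - j) y)" .
      have nz: "(of_nat (k * Suc n) :: complex) \<noteq> 0" using k by (simp only: of_nat_eq_0_iff) simp
      show ?thesis unfolding step_def eq[symmetric] using nz by (simp del: of_nat_Suc of_nat_mult)
    qed
    show ?case
      by (rule exI[of _ "\<lambda>j. if j \<le> n then g j else step n g"]) (use g p c in \<open>auto simp: le_Suc_eq\<close>)
  qed
  then obtain g where g: "\<And>n j. j \<le> n \<Longrightarrow> polyfun d (g n j) \<and> (\<forall>y G. F y = G ^ k \<longrightarrow> coeff G 0 = 1 \<longrightarrow> coeff G j = g n j y)"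
    by metis
  show ?thesis by (rule exI[of _ "\<lambda>j. g j j"]) (use g in blast)
qed

definition cform :: "nat \<Rightarrow> (nat \<Rightarrow> complex poly) \<Rightarrow> complex mpoly poly" where
  "cform d A = (\<Sum>i<d. smult (MVar i) (map_poly MConst (A i)))"

lemma coeff_cform: "coeff (cform d A) j = (\<Sum>i<d. MVar i * MConst (coeff (A i) j))"
  by (simp add: cform_def coeff_sum coeff_map_poly MConst_simps)

lemma is_form_cform: "is_form d 1 (coeff (cform d A) j)"
  unfolding coeff_cform using is_form_mult[OF is_form_simps(4) is_form_simps(2)]
  by (intro is_form_sum) simp

lemma is_form_uminus: "is_form d n F \<Longrightarrow> is_form d n (- F)"
  by (auto simp: is_form_def in_keys_iff)

lemma is_form_resultant_sub:
  assumes "\<And>j. is_form d 1 (coeff p j)" "\<And>j. is_form d 1 (coeff r j)"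
  shows "is_form d (m + n) (resultant_sub m n p r)"
  unfolding resultant_sub_def det_def'[OF sylvester_mat_sub_carrier]
proof (rule is_form_sum)
  fix \<pi> assume "\<pi> \<in> {\<pi>. \<pi> permutes {0..<m + n}}"
  then have lt: "\<pi> i < m + n" if "i < m + n" for i using that permutes_in_image[of \<pi> "{0..<m + n}" i] by auto
  have "is_form d (card {0..<m + n}) (\<Prod>i = 0..<m + n. sylvester_mat_sub m n p r $$ (i, \<pi> i))"
    using lt assms by (intro is_form_prod) (auto simp: sylvester_mat_sub_index is_form_simps)
  then show "is_form d (m + n) (signof \<pi> * (\<Prod>i = 0..<m + n. sylvester_mat_sub m n p r $$ (i, \<pi> i)))"
    by (auto simp: sign_def intro: is_form_uminus)
qed

lemma comm_ring_hom_mev: "comm_ring_hom (\<lambda>F. mev F x)"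
  by unfold_locales simp_all

lemma hom_resultant_sub:
  assumes "comm_ring_hom h"
  shows "h (resultant_sub m n p r) = resultant_sub m n (map_poly h p) (map_poly h r)"
proof -
  interpret comm_ring_hom h by fact
  show ?thesis
    unfolding resultant_sub_def by (simp only: sylvester_mat_sub_map[of h, OF hom_zero, symmetric] hom_det)
qed

lemma map_poly_mev_cform: "map_poly (\<lambda>F. mev F x) (cform d A) = dotp d A x"
  by (rule poly_eqI) (simp add: coeff_map_poly coeff_cform coeff_dotp)

text \<open>Long division by monic polynomials creates no denominators, so quotient and remainder
  are polynomial families as well.\<close>

lemma polyfam_division:
  assumes phi: "polyfam d \<phi>" and psi: "polyfam d \<psi>" and monic: "\<And>y. coeff (\<psi> y) m = 1" "\<And>y. degree (\<psi> y) \<le> m"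
  shows "\<exists>Q S. polyfam d Q \<and> polyfam d S \<and> (\<forall>y. \<phi> y = \<psi> y * Q y + S y) \<and> (\<forall>y j. j \<ge> m \<longrightarrow> coeff (S y) j = 0)"
proof -
  have "\<exists>Q S. polyfam d Q \<and> polyfam d S \<and> (\<forall>y. \<phi> y = \<psi> y * Q y + S y) \<and> (\<forall>y j. j \<ge> m \<longrightarrow> coeff (S y) j = 0)"
    if "polyfam d \<phi>" "\<forall>y. degree (\<phi> y) \<le> N" for N \<phi>
    using that
  proof (induction N arbitrary: \<phi>)
    case 0
    show ?case
    proof (cases "m = 0")
      case True
      then have "\<psi> y = 1" for y using monic[of y] by (metis degree_0_id le_zero_eq one_pCons)
      then show ?thesis using 0 by (intro exI[of _ \<phi>] exI[of _ "\<lambda>y. 0"]) (auto intro: polyfam_const)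
    next
      case False
      then show ?thesis using 0 by (intro exI[of _ "\<lambda>y. 0"] exI[of _ \<phi>]) (auto intro: polyfam_const coeff_eq_0)
    qed
  next
    case (Suc N)
    show ?case
    proof (cases "Suc N < m")
      case True
      then have "coeff (\<phi> y) j = 0" if "m \<le> j" for y j
        using that Suc.prems(2)[rule_format, of y] by (intro coeff_eq_0) linarith
      then show ?thesis using Suc.prems
        by (intro exI[of _ "\<lambda>y. 0"] exI[of _ \<phi>]) (auto intro: polyfam_const)
    next
      case False
      define M where "M y = smult (coeff (\<phi> y) (Suc N)) (monom 1 (Suc N - m))" for y
      have pM: "polyfam d M" unfolding M_def using Suc.prems by (intro polyfam_smult polyfam_const polyfam_coeff)
      define \<phi>' where "\<phi>' y = \<phi> y - \<psi> y * M y" for y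
      have p: "polyfam d \<phi>'" unfolding \<phi>'_def using Suc.prems pM psi by (intro polyfam_diff polyfam_mult)
      have deg: "degree (\<phi>' y) \<le> N" for y
      proof (rule degree_le, intro allI impI)
        fix i assume i: "N < i"
        have dM: "degree (M y) \<le> Suc N - m" unfolding M_def
          by (rule order_trans[OF degree_smult_le degree_monom_le])
        show "coeff (\<phi>' y) i = 0"
        proof (cases "i = Suc N")
          case True
          have "coeff (\<psi> y * M y) (m + (Suc N - m)) = coeff (\<psi> y) m * coeff (M y) (Suc N - m)"
            by (rule coeff_mult_bounds[OF monic(2) dM])
          then show ?thesis using True False monic(1) by (simp add: \<phi>'_def M_def)
        next
          case ne: False
          have "degree (\<psi> y * M y) \<le> Suc N"
            using degree_mult_le[of "\<psi> y" "M y"] monic(2)[of y] dM False by linarith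
          then have "degree (\<psi> y * M y) < i" "degree (\<phi> y) < i" using ne i Suc.prems(2)[rule_format, of y] by linarith+
          then show ?thesis by (simp add: \<phi>'_def coeff_eq_0)
        qed
      qed
      obtain Q S where QS: "polyfam d Q" "polyfam d S" "\<forall>y. \<phi>' y = \<psi> y * Q y + S y" "\<forall>y j. j \<ge> m \<longrightarrow> coeff (S y) j = 0"
        using Suc.IH[OF p] deg by blast
      have "\<phi> y = \<psi> y * (Q y + M y) + S y" for y
        using QS(3)[rule_format, of y] by (simp add: \<phi>'_def algebra_simps)
      then show ?thesis using QS pM
        by (intro exI[of _ "\<lambda>y. Q y + M y"] exI[of _ S]) (auto intro: polyfam_add)
    qed
  qed
  then show ?thesis using phi unfolding polyfam_def by blast
qed

section \<open>The resultant as a form, and primality of its zero set\<close>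

context line_family
begin

definition R :: "complex mpoly" where
  "R = resultant_sub n1 n2 (cform d A) (cform d B)"

lemma is_form_R: "is_form d n R"
  unfolding R_def by (intro is_form_resultant_sub is_form_cform)

lemma mev_R: "mev R x = res x"
  by (simp add: R_def hom_resultant_sub[OF comm_ring_hom_mev] map_poly_mev_cform res_def)

text \<open>
  The family of the points of the lines is parametrized by polynomials, so products that vanish
  on it have a vanishing factor.
\<close>

lemma on_line_prime:
  assumes GH: "vars_below d G" "vars_below d H" "\<And>t x. on_line t x \<Longrightarrow> mev G x * mev H x = 0"
  shows "(\<forall>t x. on_line t x \<longrightarrow> mev G x = 0) \<or> (\<forall>t x. on_line t x \<longrightarrow> mev H x = 0)"
proof (rule ccontr)
  assume "\<not> ?thesis"
  then obtain t1 x1 t2 x2 where x: "on_line t1 x1" "mev G x1 \<noteq> 0" "on_line t2 x2" "mev H x2 \<noteq> 0" by blast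
  have path: "\<exists>X :: nat \<Rightarrow> complex poly. (\<forall>t. on_line t (\<lambda>i. poly (X i) t)) \<and> (\<forall>i<d. poly (X i) t0 = x0 i)"
    if x0: "on_line t0 x0" for t0 x0
  proof -
    obtain i j where ij: "i < d" "j < d" "poly (A i) t0 * poly (B j) t0 \<noteq> poly (A j) t0 * poly (B i) t0" using indep by blast
    define W where "W = A i * B j - A j * B i"
    \<comment> \<open>Cramer's rule in the coordinates \<open>i\<close> and \<open>j\<close> moves
      \<open>x0\<close> into the subspace at every parameter. Multiplication by \<open>W\<close>
      clears the denominator, and the factor \<open>inverse (poly W t0)\<close> restores the value
      \<open>x0\<close> at \<open>t0\<close>.\<close>
    define X where "X l = smult (inverse (poly W t0)) (smult (x0 l) W
        - (if l = i then a x0 * B j - b x0 * A j else 0) - (if l = j then A i * b x0 - B i * a x0 else 0))" for l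
    have Wt0: "poly W t0 \<noteq> 0" using ij by (simp add: W_def)
    have ne: "i \<noteq> j" using ij by auto
    have val: "poly (dotp d C (\<lambda>i. poly (X i) t)) t = inverse (poly W t0) *
        (poly W t * poly (dotp d C x0) t - (poly (a x0) t * poly (B j) t - poly (b x0) t * poly (A j) t) * poly (C i) t
         - (poly (A i) t * poly (b x0) t - poly (B i) t * poly (a x0) t) * poly (C j) t)" for C t
    proof -
      define p1 where "p1 = poly (a x0) t * poly (B j) t - poly (b x0) t * poly (A j) t"
      define p2 where "p2 = poly (A i) t * poly (b x0) t - poly (B i) t * poly (a x0) t"
      have "poly (dotp d C (\<lambda>i. poly (X i) t)) t = (\<Sum>l<d. inverse (poly W t0) * (poly W t * (x0 l * poly (C l) t)
          - (if l = i then p1 * poly (C l) t else 0) - (if l = j then p2 * poly (C l) t else 0)))"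
        by (subst poly_dotp, unfold X_def p1_def p2_def, intro sum.cong refl) (auto simp: algebra_simps)
      also have "\<dots> = inverse (poly W t0) * (poly W t * (\<Sum>l<d. x0 l * poly (C l) t)
          - (\<Sum>l<d. if l = i then p1 * poly (C l) t else 0) - (\<Sum>l<d. if l = j then p2 * poly (C l) t else 0))"
        by (simp only: sum_distrib_left[symmetric] sum_subtractf)
      also have "\<dots> = inverse (poly W t0) * (poly W t * poly (dotp d C x0) t - p1 * poly (C i) t - p2 * poly (C j) t)"
        using ij(1,2) by (simp add: poly_dotp[of d C x0])
      finally show ?thesis unfolding p1_def p2_def .
    qed
    have "on_line t (\<lambda>i. poly (X i) t)" for t
      unfolding on_line_def val by (simp add: W_def algebra_simps)
    moreover have "poly (X l) t0 = x0 l" for l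
      using x0 Wt0 by (auto simp: X_def on_line_def)
    ultimately show ?thesis by blast
  qed
  obtain X1 where X1: "\<forall>t. on_line t (\<lambda>i. poly (X1 i) t)" "\<forall>i<d. poly (X1 i) t1 = x1 i" using path[OF x(1)] by blast
  obtain X2 where X2: "\<forall>t. on_line t (\<lambda>i. poly (X2 i) t)" "\<forall>i<d. poly (X2 i) t2 = x2 i" using path[OF x(3)] by blast
  \<comment> \<open>\<open>z 0\<close> is the parameter, while \<open>z 1\<close> and
    \<open>z 2\<close> combine the two paths inside the subspace at that parameter. This one family
    contains both \<open>x1\<close> and \<open>x2\<close>.\<close>
  define Y where "Y z = (\<lambda>i. z 1 * poly (X1 i) (z 0) + z 2 * poly (X2 i) (z 0))" for z :: "nat \<Rightarrow> complex"
  have Yline: "on_line (z 0) (Y z)" for z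
  proof -
    have "dotp d C (Y z) = smult (z 1) (dotp d C (\<lambda>i. poly (X1 i) (z 0))) + smult (z 2) (dotp d C (\<lambda>i. poly (X2 i) (z 0)))" for C
      by (simp add: Y_def dotp_def smult_add_left sum.distrib smult_sum2)
    then show ?thesis using X1(1)[rule_format, of "z 0"] X2(1)[rule_format, of "z 0"] by (simp add: on_line_def)
  qed
  have pY: "polyfun 3 (\<lambda>z. Y z i)" for i
    unfolding Y_def by (intro polyfun_intros polyfun_poly polyfam_const) auto
  have pG: "polyfun 3 (\<lambda>z. mev G (Y z))" and pH: "polyfun 3 (\<lambda>z. mev H (Y z))"
    using polyfun_compose[where g = Y, OF polyfun_mev[OF GH(1)] pY] polyfun_compose[where g = Y, OF polyfun_mev[OF GH(2)] pY]
    by blast+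
  have "mev G (Y (\<lambda>i. if i = 0 then t1 else if i = 1 then 1 else 0)) = mev G x1"
    by (rule mev_cong[OF GH(1)]) (simp add: Y_def X1)
  moreover have "mev H (Y (\<lambda>i. if i = 0 then t2 else if i = 1 then 0 else 1)) = mev H x2"
    by (rule mev_cong[OF GH(2)]) (simp add: Y_def X2)
  ultimately obtain z where "mev G (Y z) \<noteq> 0" "mev H (Y z) \<noteq> 0"
    using polyfun_mult_nonzero[OF pG pH] x by metis
  then show False using GH(3)[OF Yline[of z]] by simp
qed

end

section \<open>Pencils through a point with nonzero resultant\<close>

locale line_family_q = line_family +
  fixes q :: "nat \<Rightarrow> complex"
  assumes resq: "res q \<noteq> 0"
begin

text \<open>Eliminating \<open>s\<close> from the two equations for \<open>y + s q\<close> leaves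
  \<open>delta y = 0\<close>; its roots are the parameters whose subspace meets the pencil.\<close>

definition C :: "nat \<Rightarrow> complex poly" where "C i = b q * A i - a q * B i"

abbreviation "delta y \<equiv> dotp d C y"

lemma delta_eq: "delta y = b q * a y - a q * b y"
  by (simp add: C_def dotp_def smult_diff_right sum_subtractf sum_distrib_left)

lemma not_on_line_q: "\<not> on_line t q"
  using resq res_eq_0_iff by blast

text \<open>\<open>C(t)\<close> is a combination of the independent vectors \<open>A(t)\<close> and
  \<open>B(t)\<close> with coefficients \<open>b q\<close> and \<open>- a q\<close>. These do not
  both vanish at \<open>t\<close>, because the resultant at \<open>q\<close> is nonzero.\<close>

lemma C_nonzero: "\<exists>i<d. poly (C i) t \<noteq> 0"
proof (rule ccontr)
  assume "\<not> ?thesis"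
  then have e: "poly (b q) t * poly (A i) t = poly (a q) t * poly (B i) t" if "i < d" for i using that by (simp add: C_def)
  obtain i j where ij: "i < d" "j < d" "poly (A i) t * poly (B j) t \<noteq> poly (A j) t * poly (B i) t" using indep by blast
  have "poly (b q) t * (poly (A i) t * poly (B j) t) = poly (b q) t * (poly (A j) t * poly (B i) t)"
    unfolding mult.assoc[symmetric] e[OF ij(1)] e[OF ij(2)] by (simp add: mult_ac)
  moreover have "poly (a q) t * (poly (A i) t * poly (B j) t) = poly (A i) t * (poly (a q) t * poly (B j) t)" by (simp add: mult_ac)
  then have "poly (a q) t * (poly (A i) t * poly (B j) t) = poly (A j) t * (poly (b q) t * poly (A i) t)"
    unfolding e[OF ij(2), symmetric] by (simp add: mult_ac)
  then have "poly (a q) t * (poly (A i) t * poly (B j) t) = poly (a q) t * (poly (A j) t * poly (B i) t)"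
    unfolding e[OF ij(1)] by (simp add: mult_ac)
  ultimately show False using ij(3) not_on_line_q[of t] by (auto simp: on_line_def)
qed

lemma C_inf: "\<exists>i<d. coeff (C i) n \<noteq> 0"
proof (rule ccontr)
  assume "\<not> ?thesis"
  then have z: "coeff (C i) n = 0" if "i < d" for i using that by blast
  have cC: "coeff (C i) n = coeff (b q) n2 * coeff (A i) n1 - coeff (a q) n1 * coeff (B i) n2" if "i < d" for i
    using coeff_mult_bounds[OF deg_b[of q] degA[OF that]] coeff_mult_bounds[OF deg_a[of q] degB[OF that]]
    by (simp add: C_def add.commute)
  have e: "coeff (b q) n2 * coeff (A i) n1 = coeff (a q) n1 * coeff (B i) n2" if "i < d" for i
    using z[OF that] cC[OF that] by simp
  obtain i j where ij: "i < d" "j < d" "coeff (A i) n1 * coeff (B j) n2 \<noteq> coeff (A j) n1 * coeff (B i) n2" using indep_inf by blast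
  have "coeff (b q) n2 * (coeff (A i) n1 * coeff (B j) n2) = coeff (b q) n2 * (coeff (A j) n1 * coeff (B i) n2)"
    unfolding mult.assoc[symmetric] e[OF ij(1)] e[OF ij(2)] by (simp add: mult_ac)
  moreover have "coeff (a q) n1 * (coeff (A i) n1 * coeff (B j) n2) = coeff (A i) n1 * (coeff (a q) n1 * coeff (B j) n2)" by (simp add: mult_ac)
  then have "coeff (a q) n1 * (coeff (A i) n1 * coeff (B j) n2) = coeff (A j) n1 * (coeff (b q) n2 * coeff (A i) n1)"
    unfolding e[OF ij(2), symmetric] by (simp add: mult_ac)
  then have "coeff (a q) n1 * (coeff (A i) n1 * coeff (B j) n2) = coeff (a q) n1 * (coeff (A j) n1 * coeff (B i) n2)"
    unfolding e[OF ij(1)] by (simp add: mult_ac)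
  ultimately have "coeff (a q) n1 = 0 \<and> coeff (b q) n2 = 0" using ij(3) by auto
  then show False using resq res_eq_0_iff by blast
qed

lemma deg_delta: "degree (delta y) \<le> n"
  unfolding delta_eq
  using degree_mult_le[of "b q" "a y"] degree_mult_le[of "a q" "b y"] deg_a[of y] deg_b[of q] deg_a[of q] deg_b[of y]
  by (intro degree_diff_le) linarith+

text \<open>The conditions are a leading coefficient, a discriminant and finitely many values, each
  polynomial in \<open>y\<close>. That the discriminant is not identically zero follows from a
  pencil of two polynomials without common root, since only finitely many of its members have a
  multiple root.\<close>

lemma generic_section:
  assumes Z: "finite Z"
  shows "\<exists>D. polyfun d D \<and> (\<exists>y. D y \<noteq> 0) \<and> (\<forall>y. D y \<noteq> 0 \<longrightarrow> coeff (delta y) n \<noteq> 0 \<and>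
    card {t. poly (delta y) t = 0} = n \<and> (\<forall>z\<in>Z. poly (delta y) z \<noteq> 0))"
proof -
  define D1 where "D1 y = coeff (delta y) n" for y
  \<comment> \<open>With a nonzero coefficient of degree \<open>n\<close>, this discriminant
    vanishes exactly when \<open>delta y\<close> has a multiple root.\<close>
  define D2 where "D2 y = resultant_sub n (n - 1) (delta y) (pderiv (delta y))" for y
  define D3 where "D3 y = (\<Prod>z\<in>Z. poly (delta y) z)" for y
  have pp: "polyfun d (\<lambda>y. poly (delta y) z)" for z by (intro polyfun_poly polyfam_dotp polyfun.const)
  have p: "polyfun d D1" "polyfun d D2" "polyfun d D3"
    unfolding D1_def D2_def D3_def
    by (intro polyfam_coeff polyfam_dotp polyfun_resultant_sub polyfam_pderiv polyfun_prod pp)+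
  obtain i where i: "i < d" "coeff (C i) n \<noteq> 0" using C_inf by blast
  have D1: "D1 (unit_fun i) \<noteq> 0" using i by (simp add: D1_def dotp_unit_fun)
  have "\<exists>y. poly (delta y) t \<noteq> 0" for t
  proof -
    obtain j where "j < d" "poly (C j) t \<noteq> 0" using C_nonzero by blast
    then show ?thesis by (intro exI[of _ "unit_fun j"]) (simp add: dotp_unit_fun)
  qed
  then obtain y3 where y3: "\<forall>z\<in>Z. poly (delta y3) z \<noteq> 0"
    using polyfun_common_nonzero[OF Z, of d "\<lambda>z y. poly (delta y) z"] pp by blast
  then have D3: "D3 y3 \<noteq> 0" using Z by (simp add: D3_def)
  have sq: "poly (pderiv (delta y)) t \<noteq> 0" if "D1 y \<noteq> 0" "D2 y \<noteq> 0" "poly (delta y) t = 0" for y t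
  proof -
    have "degree (pderiv (delta y)) \<le> n - 1" using deg_delta[of y] by (simp add: degree_pderiv diff_le_mono)
    then show ?thesis
      using that resultant_sub_eq_0_iff[OF deg_delta[of y], of "pderiv (delta y)" "n - 1"] pos
      by (auto simp: D2_def)
  qed
  have "\<exists>y. D2 y \<noteq> 0"
  proof -
    define f where "f = delta (unit_fun i)"
    have f: "coeff f n \<noteq> 0" using D1 by (simp add: f_def D1_def)
    then have f0: "f \<noteq> 0" by auto
    obtain j where j: "j < d" "wronskian f (C j) \<noteq> 0"
      using exists_wronskian[OF C_nonzero pos i f0] by blast
    obtain y where y: "\<forall>t. \<not> (poly f t = 0 \<and> poly (delta y) t = 0)" "wronskian f (delta y) \<noteq> 0"
      using generic_partner[OF C_nonzero f0 j polyfun.const[of d 1]] by auto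
    define g where "g = delta y"
    have "smult (coeff f n) g - smult (coeff g n) f \<noteq> 0"
      using wronskian_imp_independent[of f g "coeff g n" "coeff f n"] y(2) f by (auto simp: g_def)
    then have "finite {u. poly (smult (coeff f n) g - smult (coeff g n) f) u = 0}" by (rule poly_roots_finite)
    moreover have "finite {u. \<exists>t. poly f t * poly g u = poly g t * poly f u \<and>
        poly (pderiv f) t * poly g u = poly (pderiv g) t * poly f u}"
      using y by (intro finite_multiple_members) (auto simp: g_def)
    ultimately have fin: "finite ({u. poly (smult (coeff f n) g - smult (coeff g n) f) u = 0} \<union>
        {u. \<exists>t. poly f t * poly g u = poly g t * poly f u \<and> poly (pderiv f) t * poly g u = poly (pderiv g) t * poly f u})"
      by (rule finite_UnI)
    obtain u where u: "u \<notin> {u. poly (smult (coeff f n) g - smult (coeff g n) f) u = 0} \<union>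
        {u. \<exists>t. poly f t * poly g u = poly g t * poly f u \<and> poly (pderiv f) t * poly g u = poly (pderiv g) t * poly f u}"
      using ex_new_if_finite[OF infinite_UNIV_char_0 fin] by blast
    \<comment> \<open>The member of the pencil of \<open>f\<close> and \<open>g\<close> that
      vanishes at \<open>u\<close>.\<close>
    define y' where "y' = (\<lambda>l. poly g u * unit_fun i l + (- poly f u) * y l)"
    have dy: "delta y' = smult (poly g u) f - smult (poly f u) g"
      unfolding y'_def dotp_add dotp_scale f_def g_def by simp
    have "coeff (delta y') n \<noteq> 0" using u by (simp add: dy mult.commute)
    moreover have "\<not> (poly (delta y') t = 0 \<and> poly (pderiv (delta y')) t = 0)" for t
      using u by (auto simp: dy pderiv_diff pderiv_smult mult.commute)
    moreover have "degree (pderiv (delta y')) \<le> n - 1" using deg_delta[of y'] by (simp add: degree_pderiv diff_le_mono)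
    ultimately have "D2 y' \<noteq> 0"
      unfolding D2_def using resultant_sub_eq_0_iff[OF deg_delta[of y'], of "pderiv (delta y')" "n - 1"] pos by auto
    then show ?thesis by blast
  qed
  then obtain y2 where D2: "D2 y2 \<noteq> 0" by blast
  obtain z where z: "D1 z \<noteq> 0 \<and> D2 z \<noteq> 0" using polyfun_mult_nonzero[OF p(1,2) D1 D2] by blast
  have "\<exists>y. D1 y * D2 y \<noteq> 0 \<and> D3 y \<noteq> 0"
    by (rule polyfun_mult_nonzero[OF polyfun.mult[OF p(1,2)] p(3)]) (use z D3 in auto)
  then obtain y0 where y0: "D1 y0 * D2 y0 * D3 y0 \<noteq> 0" by auto
  have card: "card {t. poly (delta y) t = 0} = n" if "D1 y \<noteq> 0" "D2 y \<noteq> 0" for y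
  proof -
    have "delta y \<noteq> 0" using that by (auto simp: D1_def)
    moreover have "degree (delta y) = n" using that(1) deg_delta[of y] le_degree[of "delta y" n] by (simp add: D1_def)
    ultimately show ?thesis using complex_card_roots[OF _ sq[OF that]] by metis
  qed
  show ?thesis
  proof (intro exI[of _ "\<lambda>y. D1 y * D2 y * D3 y"] conjI allI impI ballI)
    show "polyfun d (\<lambda>y. D1 y * D2 y * D3 y)" by (intro polyfun.mult p)
    show "\<exists>y. D1 y * D2 y * D3 y \<noteq> 0" using y0 by blast
    fix y assume "D1 y * D2 y * D3 y \<noteq> 0"
    then have D: "D1 y \<noteq> 0" "D2 y \<noteq> 0" "D3 y \<noteq> 0" by auto
    show "coeff (delta y) n \<noteq> 0" "card {t. poly (delta y) t = 0} = n" using D card by (auto simp: D1_def)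
    show "poly (delta y) z \<noteq> 0" if "z \<in> Z" for z using D(3) Z that by (auto simp: D3_def)
  qed
qed

text \<open>At a root \<open>t\<close> of \<open>delta y\<close>, the value \<open>s\<close> for which \<open>y + s q\<close> lies in the subspace at \<open>t\<close>.\<close>

definition sig :: "(nat \<Rightarrow> complex) \<Rightarrow> complex \<Rightarrow> complex" where
  "sig y t = (if poly (a q) t = 0 then - poly (b y) t / poly (b q) t else - poly (a y) t / poly (a q) t)"

lemma on_line_pencil_iff: "on_line t (\<lambda>i. y i + s * q i) \<longleftrightarrow> poly (delta y) t = 0 \<and> s = sig y t"
proof
  assume "on_line t (\<lambda>i. y i + s * q i)"
  then have e: "poly (a y) t = - s * poly (a q) t" "poly (b y) t = - s * poly (b q) t"
    by (simp_all add: on_line_def dotp_add eq_neg_iff_add_eq_0)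
  then show "poly (delta y) t = 0 \<and> s = sig y t"
    using not_on_line_q[of t] by (auto simp: delta_eq sig_def on_line_def)
next
  assume r: "poly (delta y) t = 0 \<and> s = sig y t"
  then have e: "poly (b q) t * poly (a y) t = poly (a q) t * poly (b y) t" by (simp add: delta_eq)
  have "poly (a y) t + s * poly (a q) t = 0 \<and> poly (b y) t + s * poly (b q) t = 0"
  proof (cases "poly (a q) t = 0")
    case True
    then have "poly (b q) t \<noteq> 0" using not_on_line_q[of t] by (simp add: on_line_def)
    then show ?thesis using True r e by (simp add: sig_def)
  next
    case False
    then have s: "s * poly (a q) t = - poly (a y) t" using r by (simp add: sig_def)
    have "poly (a q) t * (poly (b y) t + s * poly (b q) t) = poly (a q) t * poly (b y) t + (s * poly (a q) t) * poly (b q) t"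
      by (simp add: algebra_simps)
    also have "\<dots> = 0" by (simp only: s e[symmetric]) (simp add: mult.commute)
    finally show ?thesis using False s by simp
  qed
  then show "on_line t (\<lambda>i. y i + s * q i)" by (simp add: on_line_def dotp_add)
qed

text \<open>The \<open>n\<close> roots of \<open>delta y\<close> are the common roots that
  \<open>resultant_sub_pencil\<close> asks for. The line starts at \<open>q\<close>, where the
  resultant is nonzero, so \<open>u\<close> is inverse to the parameter of
  \<open>y + s q\<close>.\<close>

lemma res_line:
  assumes "card {t. poly (delta y) t = 0} = n"
  shows "res (\<lambda>i. q i + u * y i) = res q * (\<Prod>t | poly (delta y) t = 0. 1 - u * sig y t)"
proof -
  have fin: "finite {t. poly (delta y) t = 0}" using assms pos by (metis card.infinite less_irrefl)
  have "res (\<lambda>i. q i + u * y i) = resultant_sub n1 n2 (a q + smult u (a y)) (b q + smult u (b y))"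
    by (simp add: res_def dotp_add)
  also have "\<dots> = resultant_sub n1 n2 (a q) (b q) * (\<Prod>t | poly (delta y) t = 0. 1 - u * sig y t)"
  proof (rule resultant_sub_pencil[OF deg_a deg_a deg_b deg_b fin assms])
    fix t assume "t \<in> {t. poly (delta y) t = 0}"
    then have "on_line t (\<lambda>i. y i + sig y t * q i)" using on_line_pencil_iff by simp
    then show "poly (a y) t + sig y t * poly (a q) t = 0 \<and> poly (b y) t + sig y t * poly (b q) t = 0"
      by (simp add: on_line_def dotp_add)
  qed
  finally show ?thesis by (simp add: res_def)
qed

end

lemma poly_eqI_nonzero:
  fixes p r :: "complex poly"
  assumes "\<And>s. s \<noteq> 0 \<Longrightarrow> poly p s = poly r s"
  shows "p = r"
proof (rule ccontr)
  assume "p \<noteq> r"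
  then have "finite {s. poly (p - r) s = 0}" by (intro poly_roots_finite) simp
  moreover have "UNIV - {0} \<subseteq> {s. poly (p - r) s = 0}" using assms by auto
  moreover have "infinite (UNIV - {0 :: complex})" by (simp add: infinite_UNIV_char_0)
  ultimately show False using finite_subset by blast
qed

lemma ex_line_from:
  assumes "polyfun d f"
  shows "\<exists>p. polyfam d p \<and> (\<forall>y u. f (\<lambda>i. q i + u * y i) = poly (p y) u)"
  by (rule polyfun_line[OF assms, of "\<lambda>x i. q i" "\<lambda>x i. x i"]) (auto intro: polyfun.intros)

lemma ex_line_along:
  assumes "polyfun d f"
  shows "\<exists>p. polyfam d p \<and> (\<forall>y s. f (\<lambda>i. y i + s * q i) = poly (p y) s)"
  by (rule polyfun_line[OF assms, of "\<lambda>x i. x i" "\<lambda>x i. q i"]) (auto intro: polyfun.intros)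

lemma mev_0:
  assumes "is_form d e F" "e > 0" "\<And>i. i < d \<Longrightarrow> x i = 0"
  shows "mev F x = 0"
proof -
  have "mev F x = mev F (\<lambda>i. 0 * x i)"
    using assms by (intro mev_cong[OF is_form_vars_below]) auto
  also have "\<dots> = 0" using assms(2) by (subst mev_scale[OF assms(1)]) simp
  finally show ?thesis .
qed

section \<open>The root of the resultant determined by the fibres\<close>

locale line_family_fibres = line_family_q +
  fixes k :: nat and D :: "(nat \<Rightarrow> complex) \<Rightarrow> complex"
  assumes pD: "polyfun d D" and exD: "\<exists>y. D y \<noteq> 0"
    and D_card: "D y \<noteq> 0 \<Longrightarrow> card {t. poly (delta y) t = 0} = n"
    and D_fibre: "D y \<noteq> 0 \<Longrightarrow> poly (delta y) t = 0 \<Longrightarrow> card {s. par I2 w s t} = k"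
begin

abbreviation "roots y \<equiv> {t. poly (delta y) t = 0}"
abbreviation "fibre t \<equiv> {s. par I2 w s t}"
abbreviation "fibres y \<equiv> fibre ` roots y"

definition sg :: "(nat \<Rightarrow> complex) \<Rightarrow> complex set \<Rightarrow> complex" where
  "sg y p = sig y (SOME t. t \<in> p)"

text \<open>On the line \<open>q + u y\<close> the resultant is \<open>res q\<close> times the
  \<open>k\<close>-th power of this polynomial. Its constant term 1 singles it out among the
  \<open>k\<close>-th roots.\<close>

definition G :: "(nat \<Rightarrow> complex) \<Rightarrow> complex poly" where
  "G y = (\<Prod>p\<in>fibres y. [:1, - sg y p:])"

lemma fin_roots: "D y \<noteq> 0 \<Longrightarrow> finite (roots y)"
  using D_card[of y] pos by (metis card.infinite less_irrefl)

lemma par_w_refl: "par I2 w t t"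
  by (simp add: par_def mult.commute)

lemma fibre_eq_iff: "fibre s = fibre t \<longleftrightarrow> par I2 w s t"
proof
  assume "fibre s = fibre t"
  then have "s \<in> fibre t" using par_w_refl[of s] by blast
  then show "par I2 w s t" by simp
next
  assume p: "par I2 w s t"
  show "fibre s = fibre t" using par_w_trans[OF _ p] par_w_trans[OF _ par_w_sym[OF p]] by blast
qed

lemma fibre_roots:
  assumes "t \<in> roots y" "par I2 w s t"
  shows "s \<in> roots y" "sig y s = sig y t"
proof -
  have "on_line t (\<lambda>i. y i + sig y t * q i)" using assms(1) on_line_pencil_iff by simp
  then have "on_line s (\<lambda>i. y i + sig y t * q i)" by (rule on_line_par[OF assms(2)])
  then show "s \<in> roots y" "sig y s = sig y t" using on_line_pencil_iff by auto
qed

lemma sg_fibre: "t \<in> roots y \<Longrightarrow> sg y (fibre t) = sig y t"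
proof -
  assume t: "t \<in> roots y"
  have "(SOME s. s \<in> fibre t) \<in> fibre t" using someI[of "\<lambda>s. s \<in> fibre t" t] par_w_refl[of t] by simp
  then show ?thesis using fibre_roots(2)[OF t] by (simp add: sg_def)
qed

lemma fibre_class: "t \<in> roots y \<Longrightarrow> {s \<in> roots y. fibre s = fibre t} = fibre t"
  unfolding fibre_eq_iff using fibre_roots(1)[of t y] by blast

lemma prod_sig:
  fixes \<phi> :: "complex \<Rightarrow> complex"
  assumes "D y \<noteq> 0"
  shows "(\<Prod>t\<in>roots y. \<phi> (sig y t)) = (\<Prod>p\<in>fibres y. \<phi> (sg y p)) ^ k"
proof -
  have "(\<Prod>t\<in>roots y. \<phi> (sig y t)) = (\<Prod>p\<in>fibres y. \<Prod>s\<in>{s \<in> roots y. fibre s = p}. \<phi> (sig y s))"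
    by (rule prod.image_gen[OF fin_roots[OF assms]])
  also have "\<dots> = (\<Prod>p\<in>fibres y. \<phi> (sg y p) ^ k)"
  proof (rule prod.cong[OF refl])
    fix p assume "p \<in> fibres y"
    then obtain t where t: "t \<in> roots y" "p = fibre t" by blast
    have "(\<Prod>s\<in>{s \<in> roots y. fibre s = p}. \<phi> (sig y s)) = (\<Prod>s\<in>fibre t. \<phi> (sg y p))"
      unfolding t(2) fibre_class[OF t(1)] using fibre_roots(2)[OF t(1)] sg_fibre[OF t(1)]
      by (intro prod.cong refl) simp
    then show "(\<Prod>s\<in>{s \<in> roots y. fibre s = p}. \<phi> (sig y s)) = \<phi> (sg y p) ^ k"
      using D_fibre[OF assms, of t] t(1) by simp
  qed
  finally show ?thesis by (simp only: prod_power_distrib)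
qed

lemma card_fibres:
  assumes "D y \<noteq> 0"
  shows "k * card (fibres y) = n"
proof -
  have "n = (\<Sum>t\<in>roots y. 1)" using D_card[OF assms] by simp
  also have "\<dots> = (\<Sum>p\<in>fibres y. \<Sum>s\<in>{s \<in> roots y. fibre s = p}. 1)"
    by (rule sum.image_gen[OF fin_roots[OF assms]])
  also have "\<dots> = (\<Sum>p\<in>fibres y. k)"
  proof (rule sum.cong[OF refl])
    fix p assume "p \<in> fibres y"
    then obtain t where t: "t \<in> roots y" "p = fibre t" by blast
    then show "(\<Sum>s\<in>{s \<in> roots y. fibre s = p}. 1) = k"
      unfolding t(2) fibre_class[OF t(1)] using D_fibre[OF assms, of t] t(1) by simp
  qed
  finally show ?thesis by (simp add: mult.commute)
qed

definition m :: nat where "m = n div k"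

lemma km: "k * m = n" and k_pos: "k > 0" and m_pos: "m > 0"
  and card_fibres_m: "D y \<noteq> 0 \<Longrightarrow> card (fibres y) = m"
proof -
  obtain y0 where y0: "D y0 \<noteq> 0" using exD by blast
  show k: "k > 0" using card_fibres[OF y0] pos by (cases k) auto
  show c: "card (fibres y) = m" if "D y \<noteq> 0" for y
  proof -
    have "m = (k * card (fibres y)) div k" unfolding m_def by (simp only: card_fibres[OF that])
    then show ?thesis using k by simp
  qed
  show km: "k * m = n" using card_fibres[OF y0] c[OF y0] by simp
  then show "m > 0" using pos by (cases m) auto
qed

lemma G_0: "coeff (G y) 0 = 1"
  by (simp add: poly_0_coeff_0[symmetric] G_def poly_prod)

lemma res_line_G: "D y \<noteq> 0 \<Longrightarrow> res (\<lambda>i. q i + u * y i) = res q * poly (G y) u ^ k"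
  unfolding res_line[OF D_card] prod_sig[where \<phi> = "\<lambda>s. 1 - u * s"] by (simp add: G_def poly_prod)

lemma degree_G: "D y \<noteq> 0 \<Longrightarrow> degree (G y) \<le> m"
proof -
  assume y: "D y \<noteq> 0"
  have "degree (G y) \<le> (\<Sum>p\<in>fibres y. degree [:1, - sg y p:])"
    unfolding G_def using degree_prod_sum_le[of "fibres y" "\<lambda>p. [:1, - sg y p:]"] fin_roots[OF y] by (simp add: o_def)
  also have "\<dots> \<le> (\<Sum>p\<in>fibres y. 1)" by (intro sum_mono) simp
  finally show ?thesis using card_fibres_m[OF y] by simp
qed

text \<open>\<open>kth_root_family\<close> makes the coefficients of \<open>G y\<close> polynomial
  in \<open>y\<close>. Their sum is the value at \<open>u = 1\<close>; as a function of the point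
  \<open>q + y\<close> it is the required root, on a dense set and hence everywhere.\<close>

lemma ex_root_form: "\<exists>P. is_form d m P \<and> R = MConst (res q) * P ^ k \<and>
  (\<forall>y u. D y \<noteq> 0 \<longrightarrow> mev P (\<lambda>i. q i + u * y i) = poly (G y) u)"
proof -
  obtain F where F: "polyfam d F" "\<And>y u. res (\<lambda>i. q i + u * y i) = poly (F y) u"
    using ex_line_from[OF polyfun_res, of q] by blast
  define F' where "F' y = smult (inverse (res q)) (F y)" for y
  have pF': "polyfam d F'" unfolding F'_def by (intro polyfam_smult polyfun.const F(1))
  \<comment> \<open>\<open>D\<close> need not be nonzero at the scaled direction, but a root there
    arises from \<open>G y\<close> by substitution. This shows that the \<open>j\<close>-th
    coefficient function is homogeneous of degree \<open>j\<close> along the ray.\<close>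
  have F'G: "F' (\<lambda>i. u * y i) = (pcompose (G y) [:0, u:]) ^ k" if "D y \<noteq> 0" for y u
  proof (rule poly_ext)
    fix v
    have "poly (F' (\<lambda>i. u * y i)) v = inverse (res q) * res (\<lambda>i. q i + (v * u) * y i)"
      by (simp add: F'_def F(2)[symmetric] mult.assoc)
    also have "\<dots> = poly (G y) (v * u) ^ k" using resq by (simp add: res_line_G[OF that])
    finally show "poly (F' (\<lambda>i. u * y i)) v = poly ((pcompose (G y) [:0, u:]) ^ k) v"
      by (simp add: poly_pcompose mult.commute)
  qed
  from kth_root_family[OF pF' k_pos] obtain h where h: "\<forall>j. polyfun d (h j)"
    "\<forall>y G j. F' y = G ^ k \<longrightarrow> coeff G 0 = 1 \<longrightarrow> coeff G j = h j y"
    by (elim exE conjE)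
  have hG: "h j (\<lambda>i. u * y i) = u ^ j * coeff (G y) j" if "D y \<noteq> 0" for j y u
  proof -
    have "coeff (pcompose (G y) [:0, u:]) j = h j (\<lambda>i. u * y i)"
      by (rule h(2)[rule_format, OF F'G[OF that]])
         (simp add: poly_0_coeff_0[symmetric] poly_pcompose, simp add: poly_0_coeff_0 G_0)
    then show ?thesis by (simp add: coeff_pcompose_linear)
  qed
  \<comment> \<open>The point \<open>x\<close> is reached from \<open>q\<close> in direction
    \<open>x - q\<close> at \<open>u = 1\<close>, and a root has degree at most
    \<open>m\<close>.\<close>
  define p where "p x = (\<Sum>j\<le>m. h j (\<lambda>i. x i - q i))" for x
  have pp: "polyfun d p"
    unfolding p_def
    by (intro polyfun_sum polyfun_compose[where g = "\<lambda>x i. x i - q i", OF h(1)[rule_format]] polyfun_diff polyfun.const polyfun.coord)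
  have pG: "p (\<lambda>i. q i + u * y i) = poly (G y) u" if "D y \<noteq> 0" for y u
  proof -
    have "p (\<lambda>i. q i + u * y i) = (\<Sum>j\<le>m. coeff (G y) j * u ^ j)"
      by (simp add: p_def hG[OF that] mult.commute)
    also have "\<dots> = poly (G y) u"
      unfolding poly_altdef using degree_G[OF that] by (intro sum.mono_neutral_right) (auto simp: coeff_eq_0)
    finally show ?thesis .
  qed
  obtain y0 where y0: "D y0 \<noteq> 0" using exD by blast
  have pk: "res q * p x ^ k = res x" for x
  proof -
    have "res q * p (\<lambda>i. q i + y i) ^ k = res (\<lambda>i. q i + y i)" for y
    proof (rule polyfun_eq_dense[where f = "\<lambda>y. res q * p (\<lambda>i. q i + y i) ^ k" and g = "\<lambda>y. res (\<lambda>i. q i + y i)", OF _ _ pD y0])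
      show "polyfun d (\<lambda>y. res q * p (\<lambda>i. q i + y i) ^ k)"
        by (intro polyfun_intros polyfun_compose[where g = "\<lambda>y i. q i + y i", OF pp]) auto
      show "polyfun d (\<lambda>y. res (\<lambda>i. q i + y i))"
        by (intro polyfun_intros polyfun_compose[where g = "\<lambda>y i. q i + y i", OF polyfun_res]) auto
      show "res q * p (\<lambda>i. q i + y i) ^ k = res (\<lambda>i. q i + y i)" if "D y \<noteq> 0" for y
        using pG[OF that, of 1] res_line_G[OF that, of 1] by simp
    qed
    from this[of "\<lambda>i. x i - q i"] show ?thesis by simp
  qed
  obtain P where P: "vars_below d P" "p = mev P" using polyfun_imp_mev[OF pp] .
  have RP: "R = MConst (res q) * P ^ k"
    by (rule mev_eqI[of d]) (use P pk is_form_vars_below[OF is_form_R] mev_R in \<open>auto intro!: vars_below_mult vars_below_power\<close>)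
  have R0: "R \<noteq> 0" using mev_R[of q] resq by auto
  \<comment> \<open>\<open>P\<close> becomes a form because it is a factor of one; comparing degrees
    in \<open>R\<close> then gives the degree \<open>m\<close>.\<close>
  obtain l where l: "k = Suc l" using k_pos by (cases k) auto
  have "is_form d n ((MConst (res q) * P ^ l) * P)" using is_form_R RP by (simp add: l mult_ac)
  moreover have "(MConst (res q) * P ^ l) * P \<noteq> 0" using R0 RP by (simp add: l mult_ac)
  ultimately obtain e where e: "is_form d e P" using is_form_factor by blast
  have "is_form d (0 + k * e) R" unfolding RP by (intro is_form_mult is_form_power e is_form_simps)
  then have "k * e = n" using is_form_unique[OF _ is_form_R R0] by simp
  then have "e = m" using km k_pos by (metis mult_cancel1 less_irrefl)
  then show ?thesis using e RP pG P(2) by blast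
qed

definition P :: "complex mpoly" where
  "P = (SOME P. is_form d m P \<and> R = MConst (res q) * P ^ k \<and>
    (\<forall>y u. D y \<noteq> 0 \<longrightarrow> mev P (\<lambda>i. q i + u * y i) = poly (G y) u))"

lemma P_props: "is_form d m P \<and> R = MConst (res q) * P ^ k \<and>
    (\<forall>y u. D y \<noteq> 0 \<longrightarrow> mev P (\<lambda>i. q i + u * y i) = poly (G y) u)"
  unfolding P_def by (rule someI_ex[OF ex_root_form])

lemmas is_form_P = P_props[THEN conjunct1]
  and R_eq = P_props[THEN conjunct2, THEN conjunct1]
  and P_line = P_props[THEN conjunct2, THEN conjunct2, rule_format]

lemma P_eq_0_iff: "mev P x = 0 \<longleftrightarrow> res x = 0"
proof -
  have "res x = mev R x" by (simp only: mev_R)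
  also have "\<dots> = res q * mev P x ^ k" by (subst R_eq) simp
  finally show ?thesis using resq k_pos by simp
qed

text \<open>By homogeneity \<open>P\<close> at \<open>y + s q\<close> is \<open>s ^ m\<close> times
  \<open>G y\<close> at the inverse of \<open>s\<close>. Reversal turns the constant term 1 into the
  leading coefficient, and density extends monicity to all \<open>y\<close>.\<close>

lemma ex_pencil: "\<exists>Q. polyfam d Q \<and> (\<forall>y s. mev P (\<lambda>i. y i + s * q i) = poly (Q y) s) \<and>
  (\<forall>y. coeff (Q y) m = 1 \<and> degree (Q y) \<le> m) \<and>
  (\<forall>y. D y \<noteq> 0 \<longrightarrow> Q y = (\<Prod>p\<in>fibres y. [:- sg y p, 1:]))"
proof -
  obtain Q where Q: "polyfam d Q" "\<And>y s. mev P (\<lambda>i. y i + s * q i) = poly (Q y) s"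
    using ex_line_along[OF polyfun_mev[OF is_form_vars_below[OF is_form_P]], of q] by blast
  have Qp: "Q y = (\<Prod>p\<in>fibres y. [:- sg y p, 1:])" if y: "D y \<noteq> 0" for y
  proof (rule poly_eqI_nonzero)
    fix s :: complex assume s: "s \<noteq> 0"
    have "poly (Q y) s = mev P (\<lambda>i. s * (q i + inverse s * y i))"
      using s by (simp add: Q(2)[symmetric] distrib_left add.commute mult.assoc[symmetric])
    also have "\<dots> = s ^ m * poly (G y) (inverse s)"
      by (simp add: mev_scale[OF is_form_P] P_line[OF y])
    also have "\<dots> = (\<Prod>p\<in>fibres y. s * (1 - inverse s * sg y p))"
      by (simp add: G_def poly_prod prod.distrib card_fibres_m[OF y])
    also have "\<dots> = poly (\<Prod>p\<in>fibres y. [:- sg y p, 1:]) s"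
      using s by (simp add: poly_prod right_diff_distrib mult.assoc[symmetric])
    finally show "poly (Q y) s = poly (\<Prod>p\<in>fibres y. [:- sg y p, 1:]) s" .
  qed
  have dQ: "degree (Q y) = m" if y: "D y \<noteq> 0" for y
    unfolding Qp[OF y] by (subst degree_prod_sum_eq) (simp_all add: card_fibres_m[OF y])
  have lQ: "lead_coeff (Q y) = 1" if y: "D y \<noteq> 0" for y
    unfolding Qp[OF y] by (simp add: lead_coeff_prod)
  obtain y0 where y0: "D y0 \<noteq> 0" using exD by blast
  have c: "coeff (Q y) m = 1" for y
    by (rule polyfun_eq_dense[OF polyfam_coeff[OF Q(1)] polyfun.const pD y0]) (use dQ lQ in metis)
  have "coeff (Q y) j = 0" if "j > m" for j y
    by (rule polyfun_eq_dense[OF polyfam_coeff[OF Q(1)] polyfun.const pD y0]) (use dQ that in \<open>simp add: coeff_eq_0\<close>)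
  then have "degree (Q y) \<le> m" for y by (intro degree_le) simp
  then show ?thesis using Q Qp c by blast
qed

end

section \<open>Irreducibility and uniqueness of the root\<close>

locale line_family_separated = line_family_fibres +
  assumes sep: "\<exists>y. D y \<noteq> 0 \<and> inj_on (sg y) (fibres y)"
begin

text \<open>Separation at a single \<open>y\<close> makes the discriminant of the pencil polynomial
  a nonzero function, so simple roots are generic.\<close>

lemma ex_simple_pencil: "\<exists>Q D'. polyfam d Q \<and> (\<forall>y s. mev P (\<lambda>i. y i + s * q i) = poly (Q y) s) \<and>
  (\<forall>y. coeff (Q y) m = 1 \<and> degree (Q y) \<le> m) \<and> polyfun d D' \<and> (\<exists>y. D' y \<noteq> 0) \<and>
  (\<forall>y. D' y \<noteq> 0 \<longrightarrow> card {s. poly (Q y) s = 0} = m \<and>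
     (\<forall>s. poly (Q y) s = 0 \<longrightarrow> (\<exists>t. on_line t (\<lambda>i. y i + s * q i))))"
proof -
  obtain Q where Q: "polyfam d Q" "\<forall>y s. mev P (\<lambda>i. y i + s * q i) = poly (Q y) s"
    "\<forall>y. coeff (Q y) m = 1 \<and> degree (Q y) \<le> m"
    "\<forall>y. D y \<noteq> 0 \<longrightarrow> Q y = (\<Prod>p\<in>fibres y. [:- sg y p, 1:])"
    using ex_pencil by blast
  define E where "E y = resultant_sub m (m - 1) (Q y) (pderiv (Q y))" for y
  have pE: "polyfun d E" unfolding E_def by (intro polyfun_resultant_sub polyfam_pderiv Q(1))
  have E_iff: "E y \<noteq> 0 \<longleftrightarrow> (\<forall>s. poly (Q y) s = 0 \<longrightarrow> poly (pderiv (Q y)) s \<noteq> 0)" for y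
    unfolding E_def using resultant_sub_eq_0_iff[of "Q y" m "pderiv (Q y)" "m - 1"] Q(3) m_pos
    by (auto simp: degree_pderiv diff_le_mono)
  obtain y0 where y0: "D y0 \<noteq> 0" "inj_on (sg y0) (fibres y0)" using sep by blast
  have Q0: "Q y0 \<noteq> 0" using Q(3) by (metis coeff_0 zero_neq_one)
  have "E y0 \<noteq> 0"
  proof -
    have roots: "{s. poly (Q y0) s = 0} = sg y0 ` fibres y0"
      using Q(4) y0(1) fin_roots[OF y0(1)] by (auto simp: poly_prod)
    have Qeq: "Q y0 = (\<Prod>s\<in>sg y0 ` fibres y0. [:-s, 1:])"
      using Q(4) y0 by (simp add: prod.reindex)
    have fin: "finite (sg y0 ` fibres y0)" using fin_roots[OF y0(1)] by simp
    have nz: "poly (pderiv (\<Prod>s\<in>S. [:-s, 1:])) r \<noteq> 0" if "finite S" "r \<in> S" for S and r :: complex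
    proof -
      have "(\<Prod>s\<in>S. [:-s, 1:]) = [:-r, 1:] * (\<Prod>s\<in>S - {r}. [:-s, 1:])" using that by (rule prod.remove)
      then have "poly (pderiv (\<Prod>s\<in>S. [:-s, 1:])) r = (\<Prod>s\<in>S - {r}. r - s)"
        by (simp add: pderiv_mult pderiv_pCons poly_prod del: mult_pCons_left)
      then show ?thesis using that by simp
    qed
    show ?thesis
      unfolding E_iff
    proof (intro allI impI)
      fix s assume "poly (Q y0) s = 0"
      then have "s \<in> sg y0 ` fibres y0" using roots by blast
      then show "poly (pderiv (Q y0)) s \<noteq> 0" unfolding Qeq by (rule nz[OF fin])
    qed
  qed
  then have ex: "\<exists>y. D y * E y \<noteq> 0" using y0(1) by auto
  have "card {s. poly (Q y) s = 0} = m \<and> (\<forall>s. poly (Q y) s = 0 \<longrightarrow> (\<exists>t. on_line t (\<lambda>i. y i + s * q i)))"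
    if "D y * E y \<noteq> 0" for y
  proof
    have y: "D y \<noteq> 0" "E y \<noteq> 0" using that by auto
    have "Q y \<noteq> 0" using Q(3) by (metis coeff_0 zero_neq_one)
    moreover have "degree (Q y) = m" using Q(3) by (metis antisym le_degree zero_neq_one)
    ultimately show "card {s. poly (Q y) s = 0} = m" using complex_card_roots[of "Q y"] y(2) E_iff by metis
    show "\<forall>s. poly (Q y) s = 0 \<longrightarrow> (\<exists>t. on_line t (\<lambda>i. y i + s * q i))"
    proof (intro allI impI)
      fix s assume "poly (Q y) s = 0"
      then obtain t where t: "t \<in> roots y" "s = sg y (fibre t)" using Q(4) y(1) fin_roots[OF y(1)] by (auto simp: poly_prod)
      then have "on_line t (\<lambda>i. y i + s * q i)" using sg_fibre[OF t(1)] on_line_pencil_iff by simp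
      then show "\<exists>t. on_line t (\<lambda>i. y i + s * q i)" by blast
    qed
  qed
  then show ?thesis
    using Q(1-3) polyfun.mult[OF pD pE] ex
    by (intro exI[of _ Q] exI[of _ "\<lambda>y. D y * E y"] conjI) simp_all
qed

text \<open>On a generic pencil the restriction of \<open>F\<close> vanishes at the \<open>m\<close>
  distinct roots of \<open>Q y\<close>, so its remainder, of degree below \<open>m\<close>, is 0.
  The remainder is a polynomial family and thus vanishes for all \<open>y\<close>.\<close>

lemma P_dvd:
  assumes F: "vars_below d F" and van: "\<And>t x. on_line t x \<Longrightarrow> mev F x = 0"
  shows "P dvd F"
proof -
  obtain Q D' where Q: "polyfam d Q" "\<forall>y s. mev P (\<lambda>i. y i + s * q i) = poly (Q y) s"
    "\<forall>y. coeff (Q y) m = 1 \<and> degree (Q y) \<le> m" "polyfun d D'" "\<exists>y. D' y \<noteq> 0"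
    "\<forall>y. D' y \<noteq> 0 \<longrightarrow> card {s. poly (Q y) s = 0} = m \<and>
     (\<forall>s. poly (Q y) s = 0 \<longrightarrow> (\<exists>t. on_line t (\<lambda>i. y i + s * q i)))"
    using ex_simple_pencil by blast
  obtain \<phi> where \<phi>: "polyfam d \<phi>" "\<And>y s. mev F (\<lambda>i. y i + s * q i) = poly (\<phi> y) s"
    using ex_line_along[OF polyfun_mev[OF F], of q] by blast
  obtain T S where TS: "polyfam d T" "polyfam d S" "\<forall>y. \<phi> y = Q y * T y + S y" "\<forall>y j. j \<ge> m \<longrightarrow> coeff (S y) j = 0"
    using polyfam_division[OF \<phi>(1) Q(1) Q(3)[rule_format, THEN conjunct1] Q(3)[rule_format, THEN conjunct2]] by blast
  have S0: "S y = 0" if y: "D' y \<noteq> 0" for y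
  proof (rule ccontr)
    assume nz: "S y \<noteq> 0"
    have "poly (S y) s = 0" if s: "poly (Q y) s = 0" for s
    proof -
      obtain t where "on_line t (\<lambda>i. y i + s * q i)" using Q(6) y s by blast
      from van[OF this] have "poly (\<phi> y) s = 0" by (simp only: \<phi>(2))
      then show ?thesis using TS(3) s by simp
    qed
    then have "{s. poly (Q y) s = 0} \<subseteq> {s. poly (S y) s = 0}" by blast
    then have "m \<le> card {s. poly (S y) s = 0}" using card_mono[OF poly_roots_finite[OF nz]] Q(6) y by metis
    also have "\<dots> \<le> degree (S y)" by (rule card_poly_roots_bound[OF nz])
    finally show False using TS(4) nz leading_coeff_0_iff by blast
  qed
  obtain y0 where y0: "D' y0 \<noteq> 0" using Q(5) by blast
  have "coeff (S y) j = 0" for y j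
    by (rule polyfun_eq_dense[OF polyfam_coeff[OF TS(2)] polyfun.const Q(4) y0]) (simp add: S0)
  then have "S y = 0" for y by (simp add: poly_eq_iff)
  \<comment> \<open>At \<open>s = 0\<close> the pencil passes through \<open>y\<close>, so the
    quotient there is the cofactor of \<open>P\<close> as a function of \<open>y\<close>.\<close>
  then have eq: "poly (\<phi> y) 0 = poly (Q y) 0 * poly (T y) 0" for y using TS(3) by simp
  obtain U where U: "vars_below d U" "(\<lambda>y. poly (T y) 0) = mev U"
    using polyfun_imp_mev[OF polyfun_poly[OF TS(1) polyfun.const[of d 0]]] .
  have "F = P * U"
  proof (rule mev_eqI[OF F vars_below_mult[OF is_form_vars_below[OF is_form_P] U(1)]])
    fix y
    show "mev F y = mev (P * U) y"
      using eq[of y] \<phi>(2)[of y 0] Q(2)[rule_format, of y 0] fun_cong[OF U(2), of y] by simp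
  qed
  then show ?thesis by simp
qed

lemma P_nonzero: "P \<noteq> 0"
  using P_eq_0_iff[of q] resq by auto

lemma not_unit_form: "is_form d e F \<Longrightarrow> e > 0 \<Longrightarrow> \<not> F dvd 1"
proof
  assume F: "is_form d e F" "e > 0" "F dvd 1"
  then obtain H where H: "1 = F * H" by blast
  have "is_form d 0 (F * H)" unfolding H[symmetric] by (rule is_form_simps)
  moreover have "F * H \<noteq> 0" unfolding H[symmetric] by simp
  ultimately obtain a b where "is_form d a F" "a + b = 0" using is_form_factor by blast
  moreover have "F \<noteq> 0" using H by auto
  ultimately show False using is_form_unique[OF F(1)] F(2) by auto
qed

text \<open>\<open>P\<close> divides \<open>H1\<close>, so \<open>H1\<close> has the full degree
  \<open>m\<close> and nothing but degree 0 is left for \<open>H2\<close>.\<close>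

lemma factor_unit:
  assumes PGH: "P = H1 * H2" and van: "\<forall>t x. on_line t x \<longrightarrow> mev H1 x = 0"
  shows "H2 dvd 1"
proof -
  have "is_form d m (H1 * H2)" "H1 * H2 \<noteq> 0" using is_form_P P_nonzero PGH by simp_all
  then obtain e1 e2 where e: "is_form d e1 H1" "is_form d e2 H2" "e1 + e2 = m"
    using is_form_factor by blast
  obtain K where K: "H1 = P * K" using P_dvd[OF is_form_vars_below[OF e(1)]] van by blast
  have "H1 \<noteq> 0" using P_nonzero PGH by auto
  then obtain a b where ab: "is_form d a P" "a + b = e1" using is_form_factor[of d e1 P K] e(1) K by auto
  have "a = m" using is_form_unique[OF ab(1) is_form_P P_nonzero] .
  then have "e2 = 0" using ab(2) e(3) by simp
  then have c: "H2 = MConst (Poly_Mapping.lookup H2 0)" using e(2) is_form_0_const by blast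
  moreover have "H2 \<noteq> 0" using P_nonzero PGH by auto
  ultimately have "Poly_Mapping.lookup H2 0 \<noteq> 0" by (metis MConst_simps(1))
  then show ?thesis using c MConst_dvd_1 by metis
qed

text \<open>By \<open>on_line_prime\<close>, one of two factors vanishes on all the subspaces; by
  \<open>factor_unit\<close> the other one is a constant.\<close>

lemma irreducible_P: "irreducible P"
proof (rule irreducibleI)
  show "P \<noteq> 0" by (rule P_nonzero)
  show "\<not> P dvd 1" by (rule not_unit_form[OF is_form_P m_pos])
  fix H1 H2 assume PGH: "P = H1 * H2"
  have "is_form d m (H1 * H2)" "H1 * H2 \<noteq> 0" using is_form_P P_nonzero PGH by simp_all
  then obtain e1 e2 where e: "is_form d e1 H1" "is_form d e2 H2" using is_form_factor by blast
  have "mev H1 x * mev H2 x = 0" if "on_line t x" for t x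
  proof -
    have "mev P x = 0" using that by (auto simp: P_eq_0_iff res_eq_0_iff)
    then show ?thesis by (simp add: PGH)
  qed
  then consider "\<forall>t x. on_line t x \<longrightarrow> mev H1 x = 0" | "\<forall>t x. on_line t x \<longrightarrow> mev H2 x = 0"
    using on_line_prime[OF is_form_vars_below[OF e(1)] is_form_vars_below[OF e(2)]] by blast
  then show "H1 dvd 1 \<or> H2 dvd 1"
  proof cases
    case 1
    then show ?thesis using factor_unit[OF PGH] by blast
  next
    case 2
    have "P = H2 * H1" using PGH by (simp only: mult.commute)
    then show ?thesis using factor_unit 2 by blast
  qed
qed

text \<open>Vanishing is assumed at nonzero points only, as in projective space. An irreducible form
  has positive degree, so it also vanishes at the origin and \<open>P_dvd\<close> applies.\<close>

lemma irreducible_form_eq: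
  assumes F: "is_form d e F" "irreducible F"
    and van: "\<And>t x. on_line t x \<Longrightarrow> \<exists>i<d. x i \<noteq> 0 \<Longrightarrow> mev F x = 0"
  shows "\<exists>c. c \<noteq> 0 \<and> F = MConst c * P"
proof -
  have F0: "F \<noteq> 0" "\<not> F dvd 1" using F(2) by (auto simp: irreducible_def)
  have "e \<noteq> 0"
  proof
    assume "e = 0"
    then have "F = MConst (Poly_Mapping.lookup F 0)" using F(1) is_form_0_const by blast
    moreover from this have "Poly_Mapping.lookup F 0 \<noteq> 0" using F0(1) by (metis MConst_simps(1))
    ultimately show False using F0(2) MConst_dvd_1 by metis
  qed
  then have "mev F x = 0" if "on_line t x" for t x
    using van[OF that] mev_0[OF F(1), of x] by blast
  then obtain K where K: "F = P * K" using P_dvd[OF is_form_vars_below[OF F(1)]] by blast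
  have "\<not> P dvd 1" by (rule not_unit_form[OF is_form_P m_pos])
  then have K1: "K dvd 1" using F(2) K by (auto simp: irreducible_def)
  obtain a b where ab: "is_form d a P" "is_form d b K" using is_form_factor[of d e P K] F(1) F0(1) K by auto
  have "b = 0" using not_unit_form[OF ab(2)] K1 by blast
  then have c: "K = MConst (Poly_Mapping.lookup K 0)" using ab(2) is_form_0_const by blast
  moreover have "K \<noteq> 0" using F0 K by auto
  ultimately have "Poly_Mapping.lookup K 0 \<noteq> 0" by (metis MConst_simps(1))
  then show ?thesis using c K by (metis mult.commute)
qed

end

lemma ex_not_in_countable: "countable S \<Longrightarrow> \<exists>z :: complex. z \<notin> S"
proof (rule ccontr)
  assume S: "countable S" "\<not> (\<exists>z :: complex. z \<notin> S)"
  then have "range complex_of_real \<subseteq> S" by blast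
  then have "countable (range complex_of_real)" using S(1) by (rule countable_subset)
  then have "countable (UNIV :: real set)" by (rule countable_image_inj_on) (simp add: inj_on_def)
  then show False using uncountable_UNIV_real by simp
qed

section \<open>Pencils spanned by a curve and its derivative\<close>

lemma pderiv_dotp: "pderiv (dotp d A x) = dotp d (\<lambda>i. pderiv (A i)) x"
  by (simp add: dotp_def pderiv_sum pderiv_smult)

lemma dotp_mult: "dotp d (\<lambda>i. p * A i) x = p * dotp d A x"
  by (simp add: dotp_def sum_distrib_left)

lemma dotp_fun_add: "dotp d (\<lambda>i. A i + B i) x = dotp d A x + dotp d B x"
  by (simp add: dotp_def smult_add_right sum.distrib)

lemma dotp_fun_diff: "dotp d (\<lambda>i. A i - B i) x = dotp d A x - dotp d B x"
  by (simp add: dotp_def smult_diff_right sum_subtractf)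

lemma det3_eq: "det3 f g h = wronskian f g * pderiv (pderiv h)
    - (f * pderiv (pderiv g) - g * pderiv (pderiv f)) * pderiv h
    + (pderiv f * pderiv (pderiv g) - pderiv g * pderiv (pderiv f)) * h"
  by (simp add: det3_def wronskian_def algebra_simps)

lemma det3_dotp: "det3 f g (dotp d A y) = dotp d (\<lambda>i. det3 f g (A i)) y"
  unfolding det3_eq pderiv_dotp dotp_fun_add dotp_fun_diff dotp_mult ..

text \<open>The lines are the tangent lines of the curve \<open>Ev\<close>, whose Pluecker
  coordinates may carry an extra factor \<open>lam\<close>. The curve is to be free of common zeros,
  so that each value gives a projective point.\<close>

locale tangent_family = line_family +
  fixes Ev :: "nat \<Rightarrow> complex poly" and lam :: "complex poly"
  assumes lam: "lam \<noteq> 0"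
    and tangent: "\<And>i j. i < d \<Longrightarrow> j < d \<Longrightarrow> wronskian (Ev i) (Ev j) = lam * w (i, j)"
    and Ev_nonzero: "\<And>t. \<exists>i<d. poly (Ev i) t \<noteq> 0"
    and nonconst: "\<exists>t u. \<not> par I2 w t u"
begin

lemma wronskian_dotp: "wronskian (dotp d Ev x) (dotp d Ev y) = lam * (a x * b y - a y * b x)"
proof (rule poly_ext)
  fix t
  have "poly (wronskian (dotp d Ev x) (dotp d Ev y)) t =
      (\<Sum>i<d. x i * poly (Ev i) t) * (\<Sum>j<d. y j * poly (pderiv (Ev j)) t)
      - (\<Sum>i<d. x i * poly (pderiv (Ev i)) t) * (\<Sum>j<d. y j * poly (Ev j) t)"
    by (simp add: poly_wronskian pderiv_dotp poly_dotp mult.commute)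
  also have "\<dots> = (\<Sum>i<d. \<Sum>j<d. x i * y j * poly (wronskian (Ev i) (Ev j)) t)"
    unfolding sum_product sum_subtractf[symmetric]
    by (intro sum.cong refl) (simp add: poly_wronskian algebra_simps)
  also have "\<dots> = (\<Sum>i<d. \<Sum>j<d. x i * y j * poly (lam * w (i, j)) t)"
    by (intro sum.cong refl) (simp add: tangent)
  also have "\<dots> = poly lam t * (\<Sum>i<d. \<Sum>j<d. x i * y j * (poly (A i) t * poly (B j) t - poly (A j) t * poly (B i) t))"
    unfolding sum_distrib_left by (intro sum.cong refl) (simp add: w_def mult_ac)
  also have "(\<Sum>i<d. \<Sum>j<d. x i * y j * (poly (A i) t * poly (B j) t - poly (A j) t * poly (B i) t)) = ((\<Sum>i<d. x i * poly (A i) t) * (\<Sum>j<d. y j * poly (B j) t)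
      - (\<Sum>i<d. x i * poly (B i) t) * (\<Sum>j<d. y j * poly (A j) t))"
    unfolding sum_product sum_subtractf[symmetric]
    by (intro sum.cong refl) (simp add: algebra_simps)
  also have "poly lam t * \<dots> = poly (lam * (a x * b y - a y * b x)) t"
    by (simp add: poly_dotp mult.commute)
  finally show "poly (wronskian (dotp d Ev x) (dotp d Ev y)) t = poly (lam * (a x * b y - a y * b x)) t" .
qed

text \<open>If all the osculating determinants vanished, then \<open>Ev''\<close> would be a combination of \<open>Ev'\<close> and
  \<open>Ev\<close>, the derivative of \<open>Ev \<and> Ev'\<close> would be parallel to \<open>Ev \<and> Ev'\<close>, and the Pluecker map would
  be constant.\<close>

lemma ex_det3_nonzero:
  assumes W: "wronskian f g \<noteq> 0"
  shows "\<exists>i<d. det3 f g (Ev i) \<noteq> 0"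
proof (rule ccontr)
  assume "\<not> ?thesis"
  then have z: "det3 f g (Ev i) = 0" if "i < d" for i using that by blast
  define \<beta> where "\<beta> = f * pderiv (pderiv g) - g * pderiv (pderiv f)"
  define \<gamma> where "\<gamma> = pderiv f * pderiv (pderiv g) - pderiv g * pderiv (pderiv f)"
  have E2: "wronskian f g * pderiv (pderiv (Ev i)) = \<beta> * pderiv (Ev i) - \<gamma> * Ev i" if "i < d" for i
    using z[OF that] unfolding det3_eq \<beta>_def[symmetric] \<gamma>_def[symmetric] by (simp add: algebra_simps)
  have dW: "wronskian f g * pderiv (lam * w p) = \<beta> * (lam * w p)" if "p \<in> I2" for p
  proof -
    obtain i j where p: "p = (i, j)" "i < d" "j < d" using \<open>p \<in> I2\<close> by auto
    have "wronskian f g * pderiv (wronskian (Ev i) (Ev j)) =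
        Ev i * (wronskian f g * pderiv (pderiv (Ev j))) - Ev j * (wronskian f g * pderiv (pderiv (Ev i)))"
      by (simp add: wronskian_def[of "Ev i" "Ev j"] pderiv_diff pderiv_mult algebra_simps)
    also have "\<dots> = \<beta> * wronskian (Ev i) (Ev j)"
      unfolding E2[OF p(2)] E2[OF p(3)] by (simp add: wronskian_def[of "Ev i" "Ev j"] algebra_simps)
    finally show ?thesis using tangent[OF p(2,3)] p(1) by simp
  qed
  have W0: "wronskian (lam * w p) (lam * w r) = 0" if "p \<in> I2" "r \<in> I2" for p r
  proof -
    have "wronskian f g * wronskian (lam * w p) (lam * w r) =
        (lam * w p) * (wronskian f g * pderiv (lam * w r)) - (lam * w r) * (wronskian f g * pderiv (lam * w p))"
      by (simp add: wronskian_def[of "lam * w p"] algebra_simps)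
    also have "\<dots> = 0" unfolding dW[OF that(1)] dW[OF that(2)] by (simp add: mult_ac)
    finally show ?thesis using W by simp
  qed
  obtain r where r: "r \<in> I2" "poly (w r) 0 \<noteq> 0" using w_nonzero by blast
  then have lr: "lam * w r \<noteq> 0" using lam by auto
  have "\<exists>c. w p = smult c (w r)" if p: "p \<in> I2" for p
  proof -
    obtain c where "lam * w p = smult c (lam * w r)" using wronskian_eq_0_imp[OF W0[OF r(1) p] lr] by blast
    then have "lam * w p = lam * smult c (w r)" by simp
    then have "w p = smult c (w r)" using lam by (simp only: mult_cancel_left) simp
    then show ?thesis by blast
  qed
  then obtain c where c: "\<forall>p\<in>I2. w p = smult (c p) (w r)" by metis
  have "par I2 w t u" for t u
    unfolding par_def
  proof (intro ballI)
    fix p p' assume p: "p \<in> I2" "p' \<in> I2"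
    show "poly (w p) t * poly (w p') u = poly (w p') t * poly (w p) u"
      unfolding bspec[OF c p(1)] bspec[OF c p(2)] by (simp add: mult_ac)
  qed
  then show False using nonconst by blast
qed

end

section \<open>Separation of the fibres by biduality\<close>

locale tangent_fibres = line_family_fibres d n1 n2 A B q k D + tangent_family d n1 n2 A B Ev lam
  for d n1 n2 :: nat and A B q k D Ev lam
begin

text \<open>For the projection \<open>(f, g, h)\<close> of \<open>Ev\<close> given by
  \<open>q\<close>, \<open>y1\<close>, \<open>y2\<close>, lying on the subspace at \<open>t\<close>
  with \<open>y = y1 + l y2\<close> and \<open>s = \<sigma>\<close> makes the tangent vector
  proportional to \<open>(\<sigma>, 1, l)\<close>. Equal \<open>s\<close> thus means equal tangent
  lines. Biduality leads to equal points in the plane, the generic projection to equal points of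
  \<open>Ev\<close>, and \<open>par_imp_par_tangent\<close> to equal tangents of
  \<open>Ev\<close>.\<close>

lemma separated: "\<exists>y. D y \<noteq> 0 \<and> inj_on (sg y) (fibres y)"
proof -
  define f where "f = dotp d Ev q"
  have Wf: "wronskian f (dotp d Ev y) = - lam * delta y" for y
    by (simp add: f_def wronskian_dotp delta_eq algebra_simps)
  obtain i where i: "i < d" "poly (C i) 0 \<noteq> 0" using C_nonzero by blast
  have "wronskian f (Ev i) = - lam * C i"
    using Wf[of "unit_fun i"] i(1) by (simp add: dotp_unit_fun)
  then have Wi: "wronskian f (Ev i) \<noteq> 0" using i lam by auto
  then have f0: "f \<noteq> 0" by (auto simp: wronskian_def)
  obtain y00 where y00: "D y00 \<noteq> 0" using exD by blast
  obtain y1 where y1: "D y1 \<noteq> 0" "\<forall>t. \<not> (poly f t = 0 \<and> poly (dotp d Ev y1) t = 0)" "wronskian f (dotp d Ev y1) \<noteq> 0"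
    using generic_partner[OF Ev_nonzero f0 i(1) Wi pD y00] by blast
  define g where "g = dotp d Ev y1"
  have Wg: "wronskian f g \<noteq> 0" using y1 by (simp add: g_def)
  from generic_projection[of d Ev q y1] y1(2,3)
  obtain N where N: "countable N" "\<forall>\<mu>. \<mu> \<notin> N \<longrightarrow> (\<exists>Z. finite Z \<and> (\<forall>t u. u \<notin> Z \<longrightarrow>
    par {0,1,2} (triple f g (dotp d Ev (\<lambda>i. \<mu> ^ i))) t u \<longrightarrow> par {..<d} Ev t u))"
    unfolding f_def g_def by auto
  obtain j ts where j: "j < d" "poly (det3 f g (Ev j)) ts \<noteq> 0"
    using ex_det3_nonzero[OF Wg] by (metis poly_all_0_iff_0)
  \<comment> \<open>Avoiding \<open>M1\<close> leaves \<open>delta y1\<close> and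
    \<open>delta y2\<close> without common root, so that no parameter stays a root for all
    \<open>l\<close>; avoiding \<open>M2\<close> keeps the plane curve off a line.\<close>
  define M1 where "M1 = (\<Union>t\<in>roots y1. {\<mu>. (\<Sum>i<d. poly (C i) t * \<mu> ^ i) = 0})"
  define M2 where "M2 = {\<mu>. (\<Sum>i<d. poly (det3 f g (Ev i)) ts * \<mu> ^ i) = 0}"
  have "finite M1" unfolding M1_def
  proof (intro finite_UN_I fin_roots[OF y1(1)])
    fix t
    obtain l where "l < d" "poly (C l) t \<noteq> 0" using C_nonzero by blast
    then show "finite {\<mu>. (\<Sum>i<d. poly (C i) t * \<mu> ^ i) = 0}" by (rule finite_moment_zeros)
  qed
  moreover have "finite M2" unfolding M2_def using j by (rule finite_moment_zeros)
  ultimately have "countable (N \<union> (M1 \<union> M2))" using N(1) by (intro countable_Un) (simp_all add: countable_finite)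
  then obtain \<mu> where \<mu>: "\<mu> \<notin> N \<union> (M1 \<union> M2)" using ex_not_in_countable by blast
  define y2 where "y2 = (\<lambda>i. \<mu> ^ i)"
  define h where "h = dotp d Ev y2"
  have hm: "h = dotp d Ev (\<lambda>i. \<mu> ^ i)" by (simp add: h_def y2_def)
  have d2: "poly (delta y2) t \<noteq> 0" if "poly (delta y1) t = 0" for t
    using \<mu> that by (auto simp: M1_def poly_dotp y2_def mult.commute)
  have "poly (det3 f g h) ts \<noteq> 0"
    using \<mu> by (auto simp: M2_def h_def det3_dotp poly_dotp y2_def mult.commute)
  then have D3: "det3 f g h \<noteq> 0" by auto
  obtain Zg where Zg: "finite Zg" "\<forall>t u. u \<notin> Zg \<longrightarrow> par {0,1,2} (triple f g h) t u \<longrightarrow> par {..<d} Ev t u"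
    using N(2) \<mu> unfolding hm by blast
  obtain Zd where Zd: "finite Zd" "\<forall>t u. t \<notin> Zd \<longrightarrow> u \<notin> Zd \<longrightarrow>
    par {0,1,2} (triple (wronskian g h) (wronskian h f) (wronskian f g)) t u \<longrightarrow> par {0,1,2} (triple f g h) t u"
    using plane_biduality[OF D3] by blast
  obtain Zt where Zt: "finite Zt" "\<forall>t u. u \<notin> Zt \<longrightarrow> par {..<d} Ev t u \<longrightarrow>
    (\<exists>i\<in>{..<d}. poly (Ev i) t \<noteq> 0) \<longrightarrow> (\<exists>i\<in>{..<d}. poly (Ev i) u \<noteq> 0) \<longrightarrow>
    par I2 (\<lambda>(i, j). wronskian (Ev i) (Ev j)) t u"
    using par_imp_par_tangent[of "{..<d}" Ev] by blast
  define Z where "Z = Zg \<union> Zd \<union> Zt \<union> {t. poly lam t = 0}"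
  have finZ: "finite Z" using Zg(1) Zd(1) Zt(1) lam by (simp add: Z_def poly_roots_finite)
  have chain: "par I2 w t u" if tu: "t \<notin> Z" "u \<notin> Z"
    and p: "par {0,1,2} (triple (wronskian g h) (wronskian h f) (wronskian f g)) t u" for t u
  proof -
    have "par {0,1,2} (triple f g h) t u" using Zd(2) p tu by (simp add: Z_def)
    then have "par {..<d} Ev t u" using Zg(2) tu by (simp add: Z_def)
    moreover have "\<exists>i\<in>{..<d}. poly (Ev i) t \<noteq> 0" "\<exists>i\<in>{..<d}. poly (Ev i) u \<noteq> 0"
      using Ev_nonzero[of t] Ev_nonzero[of u] by auto
    ultimately have p2: "par I2 (\<lambda>(i, j). wronskian (Ev i) (Ev j)) t u" using Zt(2) tu by (simp add: Z_def)
    have l: "poly lam t \<noteq> 0" "poly lam u \<noteq> 0" using tu by (auto simp: Z_def)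
    show ?thesis
      unfolding par_def
    proof (intro ballI)
      fix r s assume rs: "r \<in> I2" "s \<in> I2"
      have e: "(case r of (i, j) \<Rightarrow> wronskian (Ev i) (Ev j)) = lam * w r" if "r \<in> I2" for r
        using that tangent by auto
      have "poly (lam * w r) t * poly (lam * w s) u = poly (lam * w s) t * poly (lam * w r) u"
        using bspec[OF bspec[OF p2[unfolded par_def] rs(1)] rs(2)] by (simp only: e[OF rs(1)] e[OF rs(2)])
      then have "(poly lam t * poly lam u) * (poly (w r) t * poly (w s) u) = (poly lam t * poly lam u) * (poly (w s) t * poly (w r) u)"
        by (simp add: mult_ac)
      then show "poly (w r) t * poly (w s) u = poly (w s) t * poly (w r) u" using l by simp
    qed
  qed
  \<comment> \<open>All but finitely many \<open>l\<close> keep \<open>D\<close> nonzero, as it is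
    at \<open>l = 0\<close>, and keep the roots of \<open>delta y\<close> away from the finite set
    \<open>Z\<close>.\<close>
  obtain p where p: "\<forall>y s. D (\<lambda>i. y i + s * y2 i) = poly (p y) s" using ex_line_along[OF pD, of y2] by blast
  have "poly (p y1) 0 \<noteq> 0" using p[rule_format, of y1 0] y1(1) by simp
  then have fin1: "finite {s. poly (p y1) s = 0}" by (intro poly_roots_finite) auto
  have "finite {s. poly (delta y1) z + s * poly (delta y2) z = 0}" for z
  proof (cases "poly (delta y2) z = 0")
    case True
    then show ?thesis using d2 by auto
  next
    case False
    then have "{s. poly (delta y1) z + s * poly (delta y2) z = 0} \<subseteq> {- poly (delta y1) z / poly (delta y2) z}"
      by (auto simp: field_simps eq_neg_iff_add_eq_0)
    then show ?thesis using finite_subset by blast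
  qed
  then have "finite ({s. poly (p y1) s = 0} \<union> (\<Union>z\<in>Z. {s. poly (delta y1) z + s * poly (delta y2) z = 0}))"
    using fin1 finZ by blast
  then obtain l where l: "l \<notin> {s. poly (p y1) s = 0} \<union> (\<Union>z\<in>Z. {s. poly (delta y1) z + s * poly (delta y2) z = 0})"
    using ex_new_if_finite[OF infinite_UNIV_char_0] by blast
  define y where "y = (\<lambda>i. y1 i + l * y2 i)"
  have Dy: "D y \<noteq> 0" using l p by (simp add: y_def)
  have avoid: "t \<notin> Z" if "t \<in> roots y" for t using that l by (auto simp: y_def dotp_add)
  have same: "fibre t = fibre u" if tu: "t \<in> roots y" "u \<in> roots y" and s: "sig y t = sig y u" for t u
  proof -
    define \<sigma> where "\<sigma> = sig y t"
    have val: "poly (wronskian g h) v = \<sigma> * poly (wronskian h f) v \<and> poly (wronskian f g) v = l * poly (wronskian h f) v"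
      if v: "v \<in> roots y" "sig y v = \<sigma>" for v
    proof -
      have "on_line v (\<lambda>i. y i + \<sigma> * q i)" using v on_line_pencil_iff by simp
      then have z: "poly (a y1) v + l * poly (a y2) v + \<sigma> * poly (a q) v = 0"
        "poly (b y1) v + l * poly (b y2) v + \<sigma> * poly (b q) v = 0"
        by (simp_all add: on_line_def dotp_add y_def)
      have lin: "X1 = - X2 - X3" if "X1 + X2 + X3 = 0" for X1 X2 X3 :: complex
      proof -
        have "X1 = (X1 + X2 + X3) - X2 - X3" by simp
        then show ?thesis by (simp only: that) simp
      qed
      note e = lin[OF z(1)] lin[OF z(2)]
      show ?thesis unfolding f_def g_def h_def wronskian_dotp poly_mult poly_diff e by (simp add: algebra_simps)
    qed
    \<comment> \<open>Both tangent vectors are multiples of \<open>(\<sigma>, 1, l)\<close>.\<close>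
    have "par {0,1,2} (triple (wronskian g h) (wronskian h f) (wronskian f g)) t u"
      unfolding par_triple using val[OF tu(1)] val[OF tu(2)] s by (simp add: \<sigma>_def mult_ac)
    then show ?thesis using chain avoid tu fibre_eq_iff by blast
  qed
  have "inj_on (sg y) (fibres y)"
  proof (rule inj_onI)
    fix p p' assume "p \<in> fibres y" "p' \<in> fibres y" and e: "sg y p = sg y p'"
    then obtain t u where tu: "t \<in> roots y" "p = fibre t" "u \<in> roots y" "p' = fibre u" by blast
    have "sig y t = sig y u" using e unfolding tu(2,4) sg_fibre[OF tu(1)] sg_fibre[OF tu(3)] .
    then show "p = p'" unfolding tu(2,4) by (rule same[OF tu(1,3)])
  qed
  then show ?thesis using Dy by blast
qed

end

context tangent_family
begin

text \<open>As a linear combination of the Pluecker coordinates, \<open>delta y\<close> can serve as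
  \<open>f\<close> or \<open>g\<close> in \<open>par_fibre_poly\<close>.\<close>

lemma delta_sum:
  "line_family_q d n1 n2 A B q \<Longrightarrow>
   dotp d (line_family_q.C d A B q) y = (\<Sum>p\<in>I2. smult (y (fst p) * q (snd p)) (w p))"
proof -
  assume "line_family_q d n1 n2 A B q"
  then interpret Q: line_family_q d n1 n2 A B q .
  show ?thesis
  proof (rule poly_ext)
    fix t
    have "poly (\<Sum>p\<in>I2. smult (y (fst p) * q (snd p)) (w p)) t = (\<Sum>i<d. \<Sum>j<d. y i * q j * poly (w (i, j)) t)"
      by (simp add: poly_sum sum.cartesian_product case_prod_unfold)
    also have "\<dots> = (\<Sum>i<d. y i * poly (A i) t) * (\<Sum>j<d. q j * poly (B j) t) - (\<Sum>i<d. y i * poly (B i) t) * (\<Sum>j<d. q j * poly (A j) t)"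
      unfolding sum_product sum_subtractf[symmetric] by (intro sum.cong refl) (simp add: w_def algebra_simps)
    also have "\<dots> = poly (Q.delta y) t" unfolding Q.delta_eq by (simp add: poly_dotp mult.commute)
    finally show "poly (Q.delta y) t = poly (\<Sum>p\<in>I2. smult (y (fst p) * q (snd p)) (w p)) t" by simp
  qed
qed

theorem implicitization:
  "\<exists>k m P Z c. k > 0 \<and> finite Z \<and> (\<forall>u. u \<notin> Z \<longrightarrow> finite {t. par I2 w t u} \<and> card {t. par I2 w t u} = k) \<and>
    k * m = n \<and> m > 0 \<and> is_form d m P \<and> irreducible P \<and> c \<noteq> 0 \<and> R = MConst c * P ^ k \<and>
    (\<forall>F. vars_below d F \<longrightarrow> (\<forall>t x. on_line t x \<longrightarrow> mev F x = 0) \<longrightarrow> P dvd F) \<and>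
    (\<forall>F e. is_form d e F \<longrightarrow> irreducible F \<longrightarrow>
      (\<forall>t x. on_line t x \<longrightarrow> (\<exists>i<d. x i \<noteq> 0) \<longrightarrow> mev F x = 0) \<longrightarrow> (\<exists>c. c \<noteq> 0 \<and> F = MConst c * P))"
proof -
  obtain q where q: "res q \<noteq> 0" using res_nonzero by blast
  have Q: "line_family_q d n1 n2 A B q" by unfold_locales (rule q)
  interpret Q: line_family_q d n1 n2 A B q by (rule Q)
  obtain i where i: "i < d" "coeff (Q.C i) n \<noteq> 0" using Q.C_inf by blast
  define f where "f = Q.delta (unit_fun i)"
  have f: "f = Q.C i" using i by (simp add: f_def dotp_unit_fun)
  then have f0: "f \<noteq> 0" using i by auto
  obtain j where j: "j < d" "wronskian f (Q.C j) \<noteq> 0"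
    using exists_wronskian[OF Q.C_nonzero pos i f0] by blast
  obtain y where y: "\<forall>t. \<not> (poly f t = 0 \<and> poly (Q.delta y) t = 0)" "wronskian f (Q.delta y) \<noteq> 0"
    using generic_partner[OF Q.C_nonzero f0 j polyfun.const[of d 1]] by auto
  have "\<exists>G Z. finite Z \<and> G \<noteq> 0 \<and> (\<forall>u. u \<notin> Z \<longrightarrow> {t. par I2 w t u} = {t. poly (at_u u G) t = 0} \<and>
    finite {t. par I2 w t u} \<and> card {t. par I2 w t u} = degree G)"
    by (rule par_fibre_poly[OF _ f_def[unfolded delta_sum[OF Q]] delta_sum[OF Q, of y] y(1)[rule_format] y(2)]) simp
  then obtain k Z where Z: "finite Z" "\<forall>u. u \<notin> Z \<longrightarrow> finite {t. par I2 w t u} \<and> card {t. par I2 w t u} = k"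
    by blast
  \<comment> \<open>Roots of \<open>delta y\<close> are kept out of \<open>Z\<close>, so each of
    them has a fibre of exactly \<open>k\<close> elements.\<close>
  obtain D where D: "polyfun d D" "\<exists>y. D y \<noteq> 0" "\<forall>y. D y \<noteq> 0 \<longrightarrow> coeff (Q.delta y) n \<noteq> 0 \<and>
    card {t. poly (Q.delta y) t = 0} = n \<and> (\<forall>z\<in>Z. poly (Q.delta y) z \<noteq> 0)"
    using Q.generic_section[OF Z(1)] by blast
  interpret F: line_family_fibres d n1 n2 A B q k D
    by unfold_locales (use D Z in auto)
  interpret T: tangent_fibres d n1 n2 A B q k D Ev lam ..
  interpret S: line_family_separated d n1 n2 A B q k D
    by unfold_locales (rule T.separated)
  show ?thesis
  proof (intro exI conjI)
    show "k > 0" by (rule F.k_pos)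
    show "finite Z" by (rule Z(1))
    show "\<forall>u. u \<notin> Z \<longrightarrow> finite {t. par I2 w t u} \<and> card {t. par I2 w t u} = k" by (rule Z(2))
    show "k * F.m = n" by (rule F.km)
    show "F.m > 0" by (rule F.m_pos)
    show "is_form d F.m F.P" by (rule F.is_form_P)
    show "irreducible F.P" by (rule S.irreducible_P)
    show "res q \<noteq> 0" by (rule q)
    show "R = MConst (res q) * F.P ^ k" by (rule F.R_eq)
    show "\<forall>F. vars_below d F \<longrightarrow> (\<forall>t x. on_line t x \<longrightarrow> mev F x = 0) \<longrightarrow> F.P dvd F"
    proof (intro allI impI)
      fix F assume F: "vars_below d F" and v: "\<forall>t x. on_line t x \<longrightarrow> mev F x = 0"
      show "F.P dvd F" by (rule S.P_dvd[OF F]) (use v in simp)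
    qed
    show "\<forall>F e. is_form d e F \<longrightarrow> irreducible F \<longrightarrow>
      (\<forall>t x. on_line t x \<longrightarrow> (\<exists>i<d. x i \<noteq> 0) \<longrightarrow> mev F x = 0) \<longrightarrow> (\<exists>c. c \<noteq> 0 \<and> F = MConst c * F.P)"
    proof (intro allI impI)
      fix F e assume F: "is_form d e F" "irreducible F"
        and v: "\<forall>t x. on_line t x \<longrightarrow> (\<exists>i<d. x i \<noteq> 0) \<longrightarrow> mev F x = 0"
      show "\<exists>c. c \<noteq> 0 \<and> F = MConst c * F.P"
        by (rule S.irreducible_form_eq[OF F]) (use v in simp)
    qed
  qed
qed

end

section \<open>Modules with two quasi-generators\<close>

abbreviation minor :: "real poly vec \<Rightarrow> real poly vec \<Rightarrow> nat \<Rightarrow> nat \<Rightarrow> real poly" where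
  "minor A B i j \<equiv> A $ i * B $ j - A $ j * B $ i"

lemma set_vec_of_list: "set\<^sub>v (vec_of_list xs) = set xs"
  using set_list_of_vec[of "vec_of_list xs"] by (simp add: list_vec)

lemma set_wedge: "A \<in> carrier_vec d \<Longrightarrow> set\<^sub>v (wedge A B) = {minor A B i j | i j. i < j \<and> j < d}"
  unfolding wedge_def set_vec_of_list by (auto; force)

text \<open>\<open>wedge\<close> lists only the minors with \<open>i < j\<close>; the others are
  their negatives or 0. Degree bounds, divisibility and proportionality all respect these.\<close>

lemma all_wedge_iff:
  assumes "A \<in> carrier_vec d" "\<And>x. P x \<Longrightarrow> P (- x)" "P 0"
  shows "(\<forall>x\<in>set\<^sub>v (wedge A B). P x) \<longleftrightarrow> (\<forall>i<d. \<forall>j<d. P (minor A B i j))"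
proof
  assume a: "\<forall>x\<in>set\<^sub>v (wedge A B). P x"
  show "\<forall>i<d. \<forall>j<d. P (minor A B i j)"
  proof (intro allI impI)
    fix i j assume ij: "i < d" "j < d"
    consider "i < j" | "i = j" | "j < i" by linarith
    then show "P (minor A B i j)"
    proof cases
      case 1
      then show ?thesis using a ij unfolding set_wedge[OF assms(1)] by blast
    next
      case 2
      then show ?thesis using assms(3) by (simp add: mult.commute)
    next
      case 3
      then have "P (minor A B j i)" using a ij unfolding set_wedge[OF assms(1)] by blast
      then have "P (- minor A B j i)" by (rule assms(2))
      then show ?thesis by simp
    qed
  qed
next
  assume "\<forall>i<d. \<forall>j<d. P (minor A B i j)"
  then show "\<forall>x\<in>set\<^sub>v (wedge A B). P x" unfolding set_wedge[OF assms(1)] by auto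
qed

lemma finite_set_vec: "finite (set\<^sub>v v)"
  by (simp add: vec_set_def)

lemma set_wedge_nonempty: "A \<in> carrier_vec d \<Longrightarrow> d > 1 \<Longrightarrow> set\<^sub>v (wedge A B) \<noteq> {}"
proof -
  assume A: "A \<in> carrier_vec d" and d: "d > 1"
  have "minor A B 0 1 \<in> set\<^sub>v (wedge A B)" unfolding set_wedge[OF A] using d by force
  then show ?thesis by blast
qed

lemma vdeg_wedge_le_iff:
  assumes "A \<in> carrier_vec d" "d > 1"
  shows "vdeg (wedge A B) \<le> N \<longleftrightarrow> (\<forall>i<d. \<forall>j<d. degree (minor A B i j) \<le> N)"
  unfolding vdeg_def using all_wedge_iff[OF assms(1), of "\<lambda>x. degree x \<le> N" B] set_wedge_nonempty[OF assms]
  by (simp add: finite_set_vec)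

lemma degree_le_vdeg: "i < dim_vec A \<Longrightarrow> degree (A $ i) \<le> vdeg A"
  unfolding vdeg_def by (intro Max_ge) (auto simp: vec_set_def)

lemma lin_indep_iff:
  assumes "A \<in> carrier_vec d" "B \<in> carrier_vec d"
  shows "lin_indep d A B \<longleftrightarrow> (\<exists>i<d. \<exists>j<d. minor A B i j \<noteq> 0)"
proof
  assume l: "lin_indep d A B"
  have ind: "a = 0 \<and> b = 0" if "\<And>i. i < d \<Longrightarrow> a * A $ i + b * B $ i = 0" for a b
  proof -
    have "a \<cdot>\<^sub>v A + b \<cdot>\<^sub>v B = 0\<^sub>v d" using that assms by (intro eq_vecI) auto
    then show ?thesis using l by (simp add: lin_indep_def)
  qed
  show "\<exists>i<d. \<exists>j<d. minor A B i j \<noteq> 0"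
  proof (rule ccontr)
    assume "\<not> ?thesis"
    then have z: "minor A B i j = 0" if "i < d" "j < d" for i j using that by blast
    have "\<exists>i<d. A $ i \<noteq> 0"
    proof (rule ccontr)
      assume "\<not> ?thesis"
      then show False using ind[of 1 0] by auto
    qed
    then obtain i where i: "i < d" "A $ i \<noteq> 0" by blast
    have "B $ i * A $ j + (- A $ i) * B $ j = 0" if "j < d" for j
      using z[OF i(1) that] by (simp add: mult.commute)
    then show False using ind[of "B $ i" "- A $ i"] i by simp
  qed
next
  assume "\<exists>i<d. \<exists>j<d. minor A B i j \<noteq> 0"
  then obtain i j where ij: "i < d" "j < d" "minor A B i j \<noteq> 0" by blast
  have "a = 0 \<and> b = 0" if z: "a \<cdot>\<^sub>v A + b \<cdot>\<^sub>v B = 0\<^sub>v d" for a b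
  proof -
    have e: "a * A $ l = - (b * B $ l)" if "l < d" for l
    proof -
      have "(a \<cdot>\<^sub>v A + b \<cdot>\<^sub>v B) $ l = 0" using z that by simp
      then show ?thesis using that assms by (simp add: eq_neg_iff_add_eq_0)
    qed
    have "a * minor A B i j = (a * A $ i) * B $ j - (a * A $ j) * B $ i" by (simp add: algebra_simps)
    also have "\<dots> = 0" unfolding e[OF ij(1)] e[OF ij(2)] by (simp add: algebra_simps)
    finally have a: "a = 0" using ij(3) by simp
    have "b * minor A B i j = (- (b * B $ i)) * A $ j - (- (b * B $ j)) * A $ i" by (simp add: algebra_simps)
    also have "\<dots> = 0" unfolding e[OF ij(1), symmetric] e[OF ij(2), symmetric] by (simp add: algebra_simps)
    finally show ?thesis using a ij(3) by simp
  qed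
  then show "lin_indep d A B" using assms by (simp add: lin_indep_def)
qed

text \<open>\<open>r\<close> is a common denominator of the two rational coefficients; from here on
  only polynomials occur.\<close>

lemma quasi_span_iff:
  assumes "A \<in> carrier_vec d" "B \<in> carrier_vec d"
  shows "C \<in> quasi_span d A B \<longleftrightarrow> C \<in> carrier_vec d \<and>
    (\<exists>r a b. r \<noteq> 0 \<and> (\<forall>i<d. r * C $ i = a * A $ i + b * B $ i))"
proof -
  have vec: "(map_vec to_fract C = a \<cdot>\<^sub>v map_vec to_fract A + b \<cdot>\<^sub>v map_vec to_fract B) \<longleftrightarrow>
      (\<forall>i<d. to_fract (C $ i) = a * to_fract (A $ i) + b * to_fract (B $ i))" if "C \<in> carrier_vec d" for a b
    using that assms by (auto simp: vec_eq_iff)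
  have clear: "(\<exists>a b :: real poly fract. \<forall>i<d. to_fract (C $ i) = a * to_fract (A $ i) + b * to_fract (B $ i)) \<longleftrightarrow>
     (\<exists>r a b. r \<noteq> 0 \<and> (\<forall>i<d. r * C $ i = a * A $ i + b * B $ i))"
  proof
    assume "\<exists>a b :: real poly fract. \<forall>i<d. to_fract (C $ i) = a * to_fract (A $ i) + b * to_fract (B $ i)"
    then obtain a b :: "real poly fract" where ab: "\<forall>i<d. to_fract (C $ i) = a * to_fract (A $ i) + b * to_fract (B $ i)" by blast
    obtain a1 a2 where a: "a = to_fract a1 / to_fract a2" "a2 \<noteq> 0"
      using Fract_cases[of a] Fract_conv_to_fract by metis
    obtain b1 b2 where b: "b = to_fract b1 / to_fract b2" "b2 \<noteq> 0"
      using Fract_cases[of b] Fract_conv_to_fract by metis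
    have "(a2 * b2) * C $ i = (a1 * b2) * A $ i + (b1 * a2) * B $ i" if "i < d" for i
    proof -
      have "to_fract ((a2 * b2) * C $ i) = to_fract a2 * to_fract b2 * (a * to_fract (A $ i) + b * to_fract (B $ i))"
        using ab that by simp
      also have "\<dots> = (to_fract a2 * a) * (to_fract b2 * to_fract (A $ i)) + (to_fract b2 * b) * (to_fract a2 * to_fract (B $ i))"
        by (simp add: algebra_simps)
      also have "\<dots> = to_fract ((a1 * b2) * A $ i + (b1 * a2) * B $ i)"
        using a b by simp
      finally show ?thesis by (simp only: to_fract_eq_iff)
    qed
    moreover have "a2 * b2 \<noteq> 0" using a b by simp
    ultimately show "\<exists>r a b. r \<noteq> 0 \<and> (\<forall>i<d. r * C $ i = a * A $ i + b * B $ i)" by blast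
  next
    assume "\<exists>r a b. r \<noteq> 0 \<and> (\<forall>i<d. r * C $ i = a * A $ i + b * B $ i)"
    then obtain r a b where r: "r \<noteq> 0" "\<forall>i<d. r * C $ i = a * A $ i + b * B $ i" by blast
    have "to_fract (C $ i) = (to_fract a / to_fract r) * to_fract (A $ i) + (to_fract b / to_fract r) * to_fract (B $ i)"
      if "i < d" for i
    proof -
      have "to_fract r * to_fract (C $ i) = to_fract a * to_fract (A $ i) + to_fract b * to_fract (B $ i)"
        using r(2) that by (simp flip: to_fract_mult to_fract_add)
      then show ?thesis using r(1) by (simp add: field_simps)
    qed
    then show "\<exists>a b :: real poly fract. \<forall>i<d. to_fract (C $ i) = a * to_fract (A $ i) + b * to_fract (B $ i)" by blast
  qed
  show ?thesis unfolding quasi_span_def mem_Collect_eq using vec clear by blast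
qed

lemma quasi_span_replace:
  assumes A: "A \<in> carrier_vec d" and B: "B \<in> carrier_vec d" and C: "C \<in> carrier_vec d"
    and rel: "\<And>i. i < d \<Longrightarrow> p * C $ i = a * A $ i + b * B $ i" and nz: "p \<noteq> 0" "b \<noteq> 0"
  shows "quasi_span d A C = quasi_span d A B"
proof -
  have eq: "(\<exists>r x y. r \<noteq> 0 \<and> (\<forall>i<d. r * X $ i = x * A $ i + y * C $ i)) \<longleftrightarrow>
      (\<exists>r x y. r \<noteq> 0 \<and> (\<forall>i<d. r * X $ i = x * A $ i + y * B $ i))" for X
  proof
    assume "\<exists>r x y. r \<noteq> 0 \<and> (\<forall>i<d. r * X $ i = x * A $ i + y * C $ i)"
    then obtain r x y where r: "r \<noteq> 0" "\<forall>i<d. r * X $ i = x * A $ i + y * C $ i" by blast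
    have "(p * r) * X $ i = (p * x + y * a) * A $ i + (y * b) * B $ i" if "i < d" for i
    proof -
      have "(p * r) * X $ i = p * (r * X $ i)" by simp
      also have "\<dots> = p * x * A $ i + y * (p * C $ i)" using r(2) that by (simp add: algebra_simps)
      also have "\<dots> = (p * x + y * a) * A $ i + (y * b) * B $ i" unfolding rel[OF that] by (simp add: algebra_simps)
      finally show ?thesis .
    qed
    then show "\<exists>r x y. r \<noteq> 0 \<and> (\<forall>i<d. r * X $ i = x * A $ i + y * B $ i)"
      using r(1) nz by (intro exI[of _ "p * r"] exI[of _ "p * x + y * a"] exI[of _ "y * b"]) simp
  next
    assume "\<exists>r x y. r \<noteq> 0 \<and> (\<forall>i<d. r * X $ i = x * A $ i + y * B $ i)"
    then obtain r x y where r: "r \<noteq> 0" "\<forall>i<d. r * X $ i = x * A $ i + y * B $ i" by blast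
    have "(b * r) * X $ i = (b * x - y * a) * A $ i + (y * p) * C $ i" if "i < d" for i
    proof -
      have "(b * r) * X $ i = b * (r * X $ i)" by simp
      also have "\<dots> = (b * x - y * a) * A $ i + y * (a * A $ i + b * B $ i)" using r(2) that by (simp add: algebra_simps)
      also have "\<dots> = (b * x - y * a) * A $ i + (y * p) * C $ i" unfolding rel[OF that, symmetric] by (simp add: algebra_simps)
      finally show ?thesis .
    qed
    then show "\<exists>r x y. r \<noteq> 0 \<and> (\<forall>i<d. r * X $ i = x * A $ i + y * C $ i)"
      using r(1) nz by (intro exI[of _ "b * r"] exI[of _ "b * x - y * a"] exI[of _ "y * p"]) simp
  qed
  show ?thesis
    by (rule Set.set_eqI) (simp only: quasi_span_iff[OF A C] quasi_span_iff[OF A B] eq)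
qed

lemma quasi_span_commute_subset:
  assumes "A \<in> carrier_vec d" "B \<in> carrier_vec d"
  shows "quasi_span d A B \<subseteq> quasi_span d B A"
proof
  fix C assume "C \<in> quasi_span d A B"
  then obtain r a b where r: "C \<in> carrier_vec d" "r \<noteq> 0" "\<forall>i<d. r * C $ i = a * A $ i + b * B $ i"
    unfolding quasi_span_iff[OF assms] by blast
  have "\<forall>i<d. r * C $ i = b * B $ i + a * A $ i" using r(3) by (simp add: add.commute)
  then show "C \<in> quasi_span d B A" unfolding quasi_span_iff[OF assms(2,1)] using r(1,2) by blast
qed

lemma quasi_span_commute: "A \<in> carrier_vec d \<Longrightarrow> B \<in> carrier_vec d \<Longrightarrow> quasi_span d A B = quasi_span d B A"
  by (intro equalityI quasi_span_commute_subset)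

lemma member_quasi_span:
  assumes "A \<in> carrier_vec d" "B \<in> carrier_vec d"
  shows "A \<in> quasi_span d A B"
proof -
  have "\<forall>i<d. 1 * A $ i = 1 * A $ i + 0 * B $ i" by simp
  then show ?thesis unfolding quasi_span_iff[OF assms] using assms(1) zero_neq_one by metis
qed

section \<open>Minimality of a mu-basis\<close>

locale mu_pair =
  fixes d :: nat and M :: "real poly vec set" and E1 E2 :: "real poly vec"
  assumes mu: "mu_basis d E1 E2 M" and d1: "d > 1"
begin

abbreviation "n1 \<equiv> vdeg E1"
abbreviation "n2 \<equiv> vdeg E2"
abbreviation "m12 \<equiv> minor E1 E2"

lemma carr: "E1 \<in> carrier_vec d" "E2 \<in> carrier_vec d"
  and ind: "lin_indep d E1 E2" and M_eq: "M = quasi_span d E1 E2" and deg_eq: "n1 + n2 = module_deg d M"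
  using mu by (auto simp: mu_basis_def quasi_generators_def lin_indep_def)

lemma degE: "i < d \<Longrightarrow> degree (E1 $ i) \<le> n1" "i < d \<Longrightarrow> degree (E2 $ i) \<le> n2"
  using degree_le_vdeg carr by auto

lemma degree_minor: "i < d \<Longrightarrow> j < d \<Longrightarrow> degree (m12 i j) \<le> n1 + n2"
proof -
  assume ij: "i < d" "j < d"
  have "degree (E1 $ i * E2 $ j) \<le> n1 + n2" "degree (E1 $ j * E2 $ i) \<le> n1 + n2"
    using ij degE by (meson add_mono degree_mult_le order_trans)+
  then show ?thesis by (intro degree_diff_le)
qed

lemma generators_degree:
  assumes "A \<in> carrier_vec d" "quasi_span d A B = M" "lin_indep d A B" "\<And>i j. i < d \<Longrightarrow> j < d \<Longrightarrow> degree (minor A B i j) \<le> N"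
  shows "n1 + n2 \<le> N"
proof -
  have "module_deg d M \<le> vdeg (wedge A B)"
    unfolding module_deg_def using assms(2,3) by (intro Least_le) (auto simp: quasi_generators_def)
  also have "\<dots> \<le> N" using assms(4) by (simp add: vdeg_wedge_le_iff[OF assms(1) d1])
  finally show ?thesis by (simp add: deg_eq)
qed

text \<open>If all minors had smaller degree, \<open>E1\<close> and \<open>E2\<close> themselves
  would undercut the minimum that defines the degree of the module. This is the independence of the
  leading vectors.\<close>

lemma ex_top_minor: "\<exists>i<d. \<exists>j<d. coeff (m12 i j) (n1 + n2) \<noteq> 0"
proof (rule ccontr)
  assume "\<not> ?thesis"
  then have z: "coeff (m12 i j) (n1 + n2) = 0" if "i < d" "j < d" for i j using that by blast
  obtain i j where ij: "i < d" "j < d" "m12 i j \<noteq> 0" using ind lin_indep_iff[OF carr] by blast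
  have lt: "degree (m12 i j) < n1 + n2" if "i < d" "j < d" "m12 i j \<noteq> 0" for i j
    using degree_minor[OF that(1,2)] z[OF that(1,2)] that(3) leading_coeff_0_iff[of "m12 i j"]
    by (metis le_neq_implies_less)
  have "n1 + n2 > 0" using lt[OF ij] by linarith
  then have "degree (m12 i j) \<le> n1 + n2 - 1" if "i < d" "j < d" for i j
    using lt[OF that] by (cases "m12 i j = 0") auto
  then have "n1 + n2 \<le> n1 + n2 - 1" by (rule generators_degree[OF carr(1) M_eq[symmetric] ind])
  then show False using \<open>n1 + n2 > 0\<close> by linarith
qed

text \<open>
  A common factor of the minors makes the two generators dependent modulo that factor; dividing the
  dependency by the factor would give generators of smaller degree.
\<close>

lemma no_smaller_generators:
  assumes AB: "A \<in> carrier_vec d" "B \<in> carrier_vec d" "quasi_span d A B = M"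
    and rel: "\<And>i j. i < d \<Longrightarrow> j < d \<Longrightarrow> p * minor A B i j = b * m12 i j" and nz: "p \<noteq> 0" "b \<noteq> 0"
  shows "degree p \<le> degree b"
proof (rule ccontr)
  assume lt: "\<not> degree p \<le> degree b"
  obtain i0 j0 where ij0: "i0 < d" "j0 < d" "m12 i0 j0 \<noteq> 0" using ind lin_indep_iff[OF carr] by blast
  have lt': "degree (minor A B i j) < n1 + n2" if "i < d" "j < d" "minor A B i j \<noteq> 0" for i j
  proof -
    have "b * m12 i j \<noteq> 0" using rel[OF that(1,2)] nz that(3) by (metis no_zero_divisors)
    then have "degree p + degree (minor A B i j) = degree b + degree (m12 i j)"
      using arg_cong[OF rel[OF that(1,2)], of degree] nz that(3) by (simp add: degree_mult_eq)
    then show ?thesis using lt degree_minor[OF that(1,2)] by linarith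
  qed
  have "b * m12 i0 j0 \<noteq> 0" using nz ij0(3) by simp
  then have nz0: "minor A B i0 j0 \<noteq> 0" using rel[OF ij0(1,2)] by (metis mult_zero_right)
  then have l: "lin_indep d A B" using lin_indep_iff[OF AB(1,2)] ij0 by blast
  have pos: "n1 + n2 > 0" using lt'[OF ij0(1,2) nz0] by linarith
  then have "degree (minor A B i j) \<le> n1 + n2 - 1" if "i < d" "j < d" for i j
    using lt'[OF that] by (cases "minor A B i j = 0") auto
  then have "n1 + n2 \<le> n1 + n2 - 1" by (rule generators_degree[OF AB(1,3) l])
  then show False using pos by linarith
qed

lemma no_common_factor:
  assumes dv: "\<And>i j. i < d \<Longrightarrow> j < d \<Longrightarrow> p dvd m12 i j"
  shows "degree p = 0"
proof (rule ccontr)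
  assume pos: "degree p \<noteq> 0"
  then have p0: "p \<noteq> 0" by auto
  show False
  proof (cases "\<forall>i<d. p dvd E1 $ i")
    case True
    define C where "C = vec d (\<lambda>i. E1 $ i div p)"
    have C: "C \<in> carrier_vec d" "\<And>i. i < d \<Longrightarrow> p * C $ i = 0 * E2 $ i + 1 * E1 $ i" using True by (auto simp: C_def)
    have "quasi_span d E2 C = quasi_span d E2 E1"
      by (rule quasi_span_replace[OF carr(2,1) C]) (use p0 in auto)
    then have s: "quasi_span d C E2 = M" using quasi_span_commute carr C M_eq by metis
    have "p * minor C E2 i j = 1 * m12 i j" if "i < d" "j < d" for i j
    proof -
      have "p * minor C E2 i j = (p * C $ i) * E2 $ j - (p * C $ j) * E2 $ i" by (simp add: algebra_simps)
      then show ?thesis using C(2)[OF that(1)] C(2)[OF that(2)] by simp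
    qed
    then have "degree p \<le> degree (1 :: real poly)" by (rule no_smaller_generators[OF C(1) carr(2) s _ p0]) auto
    then show False using pos by simp
  next
    case False
    then obtain i0 where i0: "i0 < d" "\<not> p dvd E1 $ i0" by blast
    \<comment> \<open>The vanishing of the minors modulo \<open>p\<close> is a dependency with
      coefficients \<open>E2 $ i0\<close> and \<open>- E1 $ i0\<close>. Reducing the latter modulo
      \<open>p\<close> makes the degree of \<open>b\<close> less than that of \<open>p\<close>, and
      the minors of the new pair are \<open>b / p\<close> times the old ones.\<close>
    define b where "b = - (E1 $ i0 mod p)"
    define a where "a = E2 $ i0"
    have b0: "b \<noteq> 0" using i0(2) by (simp add: b_def mod_eq_0_iff_dvd)
    have db: "degree b < degree p" using degree_mod_less[of p "E1 $ i0"] p0 b0 by (auto simp: b_def)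
    define C where "C = vec d (\<lambda>j. (a * E1 $ j + b * E2 $ j) div p)"
    have C: "C \<in> carrier_vec d" "\<And>j. j < d \<Longrightarrow> p * C $ j = a * E1 $ j + b * E2 $ j"
    proof -
      fix j assume j: "j < d"
      have "a * E1 $ j + b * E2 $ j = - m12 i0 j + p * (E1 $ i0 div p) * E2 $ j"
      proof -
        have "E1 $ i0 = p * (E1 $ i0 div p) + E1 $ i0 mod p" by simp
        then have e: "b = p * (E1 $ i0 div p) - E1 $ i0" unfolding b_def by (simp add: algebra_simps)
        show ?thesis unfolding e a_def by (simp add: algebra_simps)
      qed
      also have "p dvd \<dots>" using dv[OF j i0(1)] by (intro dvd_add) (simp_all add: mult.assoc)
      finally show "p * C $ j = a * E1 $ j + b * E2 $ j" using j by (simp add: C_def)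
    qed (simp add: C_def)
    have s: "quasi_span d E1 C = M" unfolding M_eq by (rule quasi_span_replace[OF carr C p0 b0])
    have "p * minor E1 C i j = b * m12 i j" if "i < d" "j < d" for i j
    proof -
      have "p * minor E1 C i j = E1 $ i * (p * C $ j) - E1 $ j * (p * C $ i)" by (simp add: algebra_simps)
      then show ?thesis unfolding C(2)[OF that(1)] C(2)[OF that(2)] by (simp add: algebra_simps)
    qed
    then have "degree p \<le> degree b" by (rule no_smaller_generators[OF carr(1) C(1) s _ p0 b0])
    then show False using db by simp
  qed
qed

text \<open>Once \<open>gcd r a\<close> is cancelled, the rest of \<open>r\<close> is coprime to the
  rest of \<open>a\<close>, so it divides every minor and is constant by
  \<open>no_common_factor\<close>.\<close>

lemma minor_dvd_imp:
  assumes r: "r \<noteq> 0" and dv: "\<And>i j. i < d \<Longrightarrow> j < d \<Longrightarrow> r dvd a * m12 i j"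
  shows "r dvd a"
proof -
  have g0: "gcd r a \<noteq> 0" using r by simp
  obtain r' a' where ra': "r = r' * gcd r a" "a = a' * gcd r a" "coprime r' a'"
    using gcd_coprime_exists[OF g0] by blast
  note ra = ra'(1,2)[unfolded mult.commute[of _ "gcd r a"]] ra'(3)
  have "r' dvd m12 i j" if "i < d" "j < d" for i j
  proof -
    have "gcd r a * r' dvd gcd r a * (a' * m12 i j)" using dv[OF that]
      by (simp only: mult.assoc[symmetric] ra(1)[symmetric] ra(2)[symmetric])
    then have "r' dvd a' * m12 i j" using g0 dvd_mult_cancel_left[of "gcd r a"] by blast
    then show ?thesis using ra(3) by (simp add: coprime_dvd_mult_right_iff)
  qed
  then have "degree r' = 0" by (rule no_common_factor)
  moreover have "r' \<noteq> 0" using r ra(1) by (metis mult_zero_right)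
  ultimately have "r' dvd 1" by (simp add: is_unit_iff_degree)
  then have "gcd r a * r' dvd gcd r a * 1" by (rule mult_dvd_mono[OF dvd_refl])
  then have "r dvd gcd r a" by (simp only: ra(1)[symmetric] mult_1_right)
  then show ?thesis using gcd_dvd2 by (rule dvd_trans)
qed

text \<open>By Cramer's rule the denominator \<open>r\<close> divides the numerators times every
  minor, hence the numerators. So a mu-basis generates \<open>M\<close> over
  \<open>\<real>[t]\<close>, with no denominators.\<close>

lemma M_coeffs:
  assumes "C \<in> M"
  shows "\<exists>a b. \<forall>i<d. C $ i = a * E1 $ i + b * E2 $ i"
proof -
  obtain r a b where r: "r \<noteq> 0" "\<forall>i<d. r * C $ i = a * E1 $ i + b * E2 $ i"
    using assms unfolding M_eq quasi_span_iff[OF carr] by blast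
  have "r dvd a"
  proof (rule minor_dvd_imp[OF r(1)])
    fix i j assume ij: "i < d" "j < d"
    have "a * m12 i j = (r * C $ i) * E2 $ j - (r * C $ j) * E2 $ i" using r(2) ij by (simp add: algebra_simps)
    also have "\<dots> = r * (C $ i * E2 $ j - C $ j * E2 $ i)" by (simp add: algebra_simps)
    finally show "r dvd a * m12 i j" by (rule dvdI)
  qed
  moreover have "r dvd b"
  proof (rule minor_dvd_imp[OF r(1)])
    fix i j assume ij: "i < d" "j < d"
    have "b * m12 i j = E1 $ i * (r * C $ j) - E1 $ j * (r * C $ i)" using r(2) ij by (simp add: algebra_simps)
    also have "\<dots> = r * (E1 $ i * C $ j - E1 $ j * C $ i)" by (simp add: algebra_simps)
    finally show "r dvd b * m12 i j" by (rule dvdI)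
  qed
  ultimately obtain a' b' where ab: "a = r * a'" "b = r * b'" by (auto elim!: dvdE)
  have "C $ i = a' * E1 $ i + b' * E2 $ i" if "i < d" for i
  proof -
    have "r * C $ i = r * (a' * E1 $ i + b' * E2 $ i)" using r(2) that by (simp add: ab algebra_simps)
    then show ?thesis using r(1) by (simp only: mult_cancel_left) simp
  qed
  then show ?thesis by blast
qed

lemma E_in_M: "E1 \<in> M" "E2 \<in> M"
  unfolding M_eq using member_quasi_span[OF carr] member_quasi_span[OF carr(2,1)] quasi_span_commute[OF carr] by blast+

end

section \<open>Complexification\<close>

definition cx :: "real poly \<Rightarrow> complex poly" where
  "cx p = map_poly complex_of_real p"

lemma coeff_cx [simp]: "coeff (cx p) j = complex_of_real (coeff p j)"
  by (simp add: cx_def coeff_map_poly)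

lemma cx_simps [simp]: "cx 0 = 0" "cx (p + r) = cx p + cx r" "cx (p - r) = cx p - cx r" "cx (p * r) = cx p * cx r"
  by (simp_all add: poly_eq_iff coeff_mult)

lemma cx_pderiv: "pderiv (cx p) = cx (pderiv p)"
  by (simp add: poly_eq_iff coeff_pderiv)

lemma degree_cx [simp]: "degree (cx p) = degree p"
  unfolding cx_def by (rule degree_map_poly) simp

lemma cx_eq_0_iff [simp]: "cx p = 0 \<longleftrightarrow> p = 0"
  by (simp add: poly_eq_iff)

lemma poly_cx_of_real: "poly (cx p) (complex_of_real x) = complex_of_real (poly p x)"
  by (simp add: poly_altdef)

text \<open>The minimal polynomial of \<open>t\<close> over \<real>, linear or quadratic. It turns a
  common complex zero of real polynomials into a real common factor.\<close>

lemma ex_real_min_poly: "\<exists>g. degree g > 0 \<and> (\<forall>p. poly (cx p) t = 0 \<longrightarrow> g dvd p)"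
proof (cases "Im t = 0")
  case True
  then have t: "t = complex_of_real (Re t)" by (simp add: complex_eq_iff)
  have "[:- Re t, 1:] dvd p" if "poly (cx p) t = 0" for p
  proof -
    have "poly p (Re t) = 0" using that by (subst (asm) t) (simp add: poly_cx_of_real)
    then show ?thesis by (simp add: poly_eq_0_iff_dvd)
  qed
  then show ?thesis by (intro exI[of _ "[:- Re t, 1:]"]) simp
next
  case False
  define g where "g = [:(Re t)\<^sup>2 + (Im t)\<^sup>2, - 2 * Re t, 1:]"
  have g: "degree g = 2" "g \<noteq> 0" by (auto simp: g_def)
  have gt: "poly (cx g) t = 0"
    by (simp add: cx_def g_def map_poly_pCons complex_eq_iff power2_eq_square algebra_simps)
  have "g dvd p" if p: "poly (cx p) t = 0" for p
  proof -
    define r where "r = p mod g"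
    have "p = g * (p div g) + r" by (simp add: r_def)
    then have "poly (cx p) t = poly (cx g) t * poly (cx (p div g)) t + poly (cx r) t"
      by (metis cx_simps(2,4) poly_add poly_mult)
    then have r0: "poly (cx r) t = 0" using p gt by simp
    have "r = 0 \<or> degree r < 2" using degree_mod_less[of g p] g by (simp add: r_def)
    then have r: "r = [:coeff r 0, coeff r 1:]"
      by (intro poly_eqI) (auto simp: coeff_pCons coeff_eq_0 split: nat.split)
    have "cx r = [:complex_of_real (coeff r 0), complex_of_real (coeff r 1):]"
      by (subst r) (simp add: poly_eq_iff coeff_pCons split: nat.split)
    then have "complex_of_real (coeff r 0) + t * complex_of_real (coeff r 1) = 0" using r0 by simp
    then have "coeff r 1 = 0" "coeff r 0 = 0" using False by (auto simp: complex_eq_iff)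
    then have "r = 0" by (subst r) simp
    then show ?thesis by (simp add: r_def mod_eq_0_iff_dvd)
  qed
  then show ?thesis using g(1) by (intro exI[of _ g]) simp
qed

lemma lookup_map_zero: "f 0 = 0 \<Longrightarrow> Poly_Mapping.lookup (Poly_Mapping.map f F) m = f (Poly_Mapping.lookup F m)"
  by (simp add: map.rep_eq when_def)

lemma cmpoly_eq_mp_hom: "cmpoly F = mp_hom (\<lambda>c. MConst (complex_of_real c)) (\<lambda>m. Poly_Mapping.single m 1) F"
proof -
  have keys: "Poly_Mapping.keys (cmpoly F) = Poly_Mapping.keys F"
    by (auto simp: cmpoly_def in_keys_iff lookup_map_zero)
  have "cmpoly F = (\<Sum>m\<in>Poly_Mapping.keys F. Poly_Mapping.single m (complex_of_real (Poly_Mapping.lookup F m)))"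
    by (subst mpoly_sum_singles[of "cmpoly F"]) (simp add: keys, simp add: cmpoly_def lookup_map_zero)
  then show ?thesis by (simp add: mp_hom_def MConst_def mult_single)
qed

lemma comm_ring_hom_cmpoly: "comm_ring_hom cmpoly"
proof
  fix F G :: "real mpoly"
  show "cmpoly (F + G) = cmpoly F + cmpoly G"
    unfolding cmpoly_eq_mp_hom by (rule mp_hom_add) (simp_all add: MConst_simps)
  show "cmpoly (F * G) = cmpoly F * cmpoly G"
    unfolding cmpoly_eq_mp_hom by (rule mp_hom_mult) (simp_all add: MConst_simps mult_single)
  show "cmpoly 1 = 1"
    unfolding cmpoly_eq_mp_hom single_one[symmetric] by (subst mp_hom_single) (simp_all add: MConst_def mult_single)
  show "cmpoly 0 = 0" by (simp add: cmpoly_eq_mp_hom)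
qed

lemma cmpoly_MVar: "cmpoly (MVar i) = MVar i"
  unfolding MVar_def cmpoly_eq_mp_hom by (subst mp_hom_single) (simp_all add: MConst_def mult_single)

lemma cmpoly_MConst: "cmpoly (MConst c) = MConst (complex_of_real c)"
  unfolding MConst_def[of c] cmpoly_eq_mp_hom by (subst mp_hom_single) (simp_all add: MConst_def mult_single)

lemma map_poly_cmpoly_moving_form:
  assumes "A \<in> carrier_vec d"
  shows "map_poly cmpoly (moving_form A) = cform d (\<lambda>i. cx (A $ i))"
proof -
  interpret comm_ring_hom cmpoly by (rule comm_ring_hom_cmpoly)
  show ?thesis
  proof (rule poly_eqI)
    fix j
    have "coeff (moving_form A) j = (\<Sum>i<d. MVar i * MConst (coeff (A $ i) j))"
      using assms by (simp add: moving_form_def coeff_sum coeff_map_poly MConst_simps)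
    then show "coeff (map_poly cmpoly (moving_form A)) j = coeff (cform d (\<lambda>i. cx (A $ i))) j"
      by (simp add: coeff_map_poly coeff_cform hom_sum hom_mult cmpoly_MVar cmpoly_MConst)
  qed
qed

abbreviation mconj :: "complex mpoly \<Rightarrow> complex mpoly" where
  "mconj \<equiv> Poly_Mapping.map cnj"

lemma keys_mconj: "Poly_Mapping.keys (mconj F) = Poly_Mapping.keys F"
  by (auto simp: in_keys_iff lookup_map_zero)

lemma mev_mconj: "mev (mconj F) x = cnj (mev F (\<lambda>i. cnj (x i)))"
  by (simp add: mev_def mp_hom_def keys_mconj lookup_map_zero mmon_def)

lemma mconj_cmpoly: "mconj (cmpoly F) = cmpoly F"
  by (rule poly_mapping_eqI) (simp add: lookup_map_zero cmpoly_def)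

lemma eval_vec_dot:
  assumes "C \<in> carrier_vec d" "x \<in> carrier_vec d"
  shows "eval_vec t C \<bullet> x = poly (dotp d (\<lambda>i. cx (C $ i)) (\<lambda>i. x $ i)) t"
  using assms by (simp add: scalar_prod_def eval_vec_def poly_dotp cx_def atLeast0LessThan mult.commute)

lemma leading_vec_dot:
  assumes "C \<in> carrier_vec d" "x \<in> carrier_vec d"
  shows "leading_vec C \<bullet> x = coeff (dotp d (\<lambda>i. cx (C $ i)) (\<lambda>i. x $ i)) (vdeg C)"
  using assms by (simp add: scalar_prod_def leading_vec_def coeff_dotp atLeast0LessThan mult.commute)

lemma proj_point_eq_iff: "proj_point v = proj_point u \<longleftrightarrow> (\<exists>c. c \<noteq> 0 \<and> v = c \<cdot>\<^sub>v u)"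
proof
  assume e: "proj_point v = proj_point u"
  have "1 \<cdot>\<^sub>v v \<in> proj_point v" unfolding proj_point_def by (intro CollectI exI[of _ 1]) simp
  then have "v \<in> proj_point u" using e by simp
  then show "\<exists>c. c \<noteq> 0 \<and> v = c \<cdot>\<^sub>v u" by (auto simp: proj_point_def)
next
  assume "\<exists>c. c \<noteq> 0 \<and> v = c \<cdot>\<^sub>v u"
  then obtain c where c: "c \<noteq> 0" "v = c \<cdot>\<^sub>v u" by blast
  show "proj_point v = proj_point u"
    unfolding proj_point_def c(2)
  proof (intro equalityI subsetI; clarify)
    fix b :: complex assume "b \<noteq> 0"
    then show "\<exists>b'. b \<cdot>\<^sub>v (c \<cdot>\<^sub>v u) = b' \<cdot>\<^sub>v u \<and> b' \<noteq> 0"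
      using c(1) by (intro exI[of _ "b * c"]) (simp add: smult_smult_assoc)
    show "\<exists>b'. b \<cdot>\<^sub>v u = b' \<cdot>\<^sub>v (c \<cdot>\<^sub>v u) \<and> b' \<noteq> 0"
      using c(1) \<open>b \<noteq> 0\<close> by (intro exI[of _ "b / c"]) (simp add: smult_smult_assoc)
  qed
qed

section \<open>The subspaces and the swept variety in terms of a mu-basis\<close>

context mu_pair
begin

abbreviation "I2 \<equiv> {..<d} \<times> {..<d}"

definition wc :: "nat \<times> nat \<Rightarrow> complex poly" where
  "wc = (\<lambda>(i, j). cx (m12 i j))"

abbreviation "Ac \<equiv> \<lambda>i. cx (E1 $ i)"
abbreviation "Bc \<equiv> \<lambda>i. cx (E2 $ i)"

text \<open>A complex common zero of the minors would produce a nonconstant real common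
  factor.\<close>

lemma wc_nonzero: "\<exists>i<d. \<exists>j<d. poly (wc (i, j)) t \<noteq> 0"
proof (rule ccontr)
  assume "\<not> ?thesis"
  then have z: "poly (cx (m12 i j)) t = 0" if "i < d" "j < d" for i j using that by (auto simp: wc_def)
  obtain g where g: "degree g > 0" "\<forall>p. poly (cx p) t = 0 \<longrightarrow> g dvd p" using ex_real_min_poly by blast
  then have "degree g = 0" using z no_common_factor by blast
  then show False using g(1) by simp
qed

lemma line_family:
  assumes "n1 + n2 > 0"
  shows "line_family d n1 n2 Ac Bc"
proof
  show "degree (cx (E1 $ i)) \<le> n1" "degree (cx (E2 $ i)) \<le> n2" if "i < d" for i using degE[OF that] by simp_all
  show "\<exists>i<d. \<exists>j<d. poly (cx (E1 $ i)) t * poly (cx (E2 $ j)) t \<noteq> poly (cx (E1 $ j)) t * poly (cx (E2 $ i)) t" for t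
    using wc_nonzero[of t] by (simp add: wc_def)
  obtain i j where ij: "i < d" "j < d" "coeff (m12 i j) (n1 + n2) \<noteq> 0" using ex_top_minor by blast
  have c: "coeff (cx (E1 $ i) * cx (E2 $ j)) (n1 + n2) = coeff (cx (E1 $ i)) n1 * coeff (cx (E2 $ j)) n2" if "i < d" "j < d" for i j
    using degE(1)[OF that(1)] degE(2)[OF that(2)] by (intro coeff_mult_bounds) simp_all
  have "coeff (cx (m12 i j)) (n1 + n2) \<noteq> 0" using ij(3) by (simp only: coeff_cx of_real_eq_0_iff not_False_eq_True)
  then show "\<exists>i<d. \<exists>j<d. coeff (cx (E1 $ i)) n1 * coeff (cx (E2 $ j)) n2 \<noteq> coeff (cx (E1 $ j)) n1 * coeff (cx (E2 $ i)) n2"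
    using c[OF ij(1,2)] c[OF ij(2,1)] ij(1,2) by (auto simp del: coeff_cx)
  show "n1 + n2 > 0" by (rule assms)
qed

lemma w_eq_wc: "line_family.w Ac Bc = wc" if "n1 + n2 > 0"
proof -
  interpret L: line_family d n1 n2 Ac Bc by (rule line_family[OF that])
  show ?thesis by (simp add: L.w_def wc_def fun_eq_iff)
qed

lemma dotp_combination:
  "(\<And>i. i < d \<Longrightarrow> C i = p * A i + r * B i) \<Longrightarrow> dotp d C x = p * dotp d A x + r * dotp d B x"
  by (simp add: dotp_def smult_add_right sum.distrib sum_distrib_left)

text \<open>Two equations suffice at every parameter because the coefficients in
  \<open>M_coeffs\<close> are polynomials; rational ones could have a pole at
  \<open>t\<close>.\<close>

lemma module_space_eq:
  "module_space d M t = {x \<in> carrier_vec d. poly (dotp d Ac (\<lambda>i. x $ i)) t = 0 \<and> poly (dotp d Bc (\<lambda>i. x $ i)) t = 0}"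
proof -
  have M_carr: "C \<in> carrier_vec d" if "C \<in> M" for C using that by (simp add: M_eq quasi_span_def)
  have "poly (dotp d (\<lambda>i. cx (C $ i)) x) t = 0"
    if C: "C \<in> M" and x: "poly (dotp d Ac x) t = 0" "poly (dotp d Bc x) t = 0" for C x
  proof -
    obtain a b where ab: "\<forall>i<d. C $ i = a * E1 $ i + b * E2 $ i" using M_coeffs[OF C] by blast
    have "dotp d (\<lambda>i. cx (C $ i)) x = cx a * dotp d Ac x + cx b * dotp d Bc x"
      by (rule dotp_combination) (simp add: ab)
    then show ?thesis using x by simp
  qed
  note van = this
  show ?thesis
    unfolding module_space_def
  proof (rule Collect_cong, rule conj_cong[OF refl])
    fix x :: "complex vec" assume x: "x \<in> carrier_vec d"
    show "(\<forall>C\<in>M. eval_vec t C \<bullet> x = 0) \<longleftrightarrow> poly (dotp d Ac (\<lambda>i. x $ i)) t = 0 \<and> poly (dotp d Bc (\<lambda>i. x $ i)) t = 0"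
    proof
      assume "\<forall>C\<in>M. eval_vec t C \<bullet> x = 0"
      from bspec[OF this E_in_M(1)] bspec[OF this E_in_M(2)]
      show "poly (dotp d Ac (\<lambda>i. x $ i)) t = 0 \<and> poly (dotp d Bc (\<lambda>i. x $ i)) t = 0"
        by (simp only: eval_vec_dot[OF carr(1) x] eval_vec_dot[OF carr(2) x])
    next
      assume z: "poly (dotp d Ac (\<lambda>i. x $ i)) t = 0 \<and> poly (dotp d Bc (\<lambda>i. x $ i)) t = 0"
      show "\<forall>C\<in>M. eval_vec t C \<bullet> x = 0"
      proof
        fix C assume C: "C \<in> M"
        show "eval_vec t C \<bullet> x = 0" unfolding eval_vec_dot[OF M_carr[OF C] x] using van[OF C] z by blast
      qed
    qed
  qed
qed

text \<open>No cancellation of leading terms can occur in \<open>a E1 + b E2\<close>, because the leading vectors of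
  \<open>E1\<close> and \<open>E2\<close> are independent.\<close>

lemma leading_combination:
  assumes C: "C \<in> M"
  shows "\<exists>\<alpha> \<beta>. \<forall>i<d. coeff (C $ i) (vdeg C) = \<alpha> * coeff (E1 $ i) n1 + \<beta> * coeff (E2 $ i) n2"
proof -
  have Cc: "C \<in> carrier_vec d" using C by (simp add: M_eq quasi_span_def)
  obtain a b where ab: "\<forall>i<d. C $ i = a * E1 $ i + b * E2 $ i" using M_coeffs[OF C] by blast
  show ?thesis
  proof (cases "a = 0 \<and> b = 0")
    case True
    then show ?thesis using ab by (intro exI[of _ 0]) simp
  next
    case False
    \<comment> \<open>The largest degree that a summand can reach. A zero coefficient has
      \<open>degree 0 = 0\<close> and would wrongly contribute \<open>n1\<close> or
      \<open>n2\<close>, hence the case distinctions; those in \<open>\<alpha>\<close> and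
      \<open>\<beta>\<close> guard against truncated subtraction.\<close>
    define N where "N = max (if a = 0 then 0 else degree a + n1) (if b = 0 then 0 else degree b + n2)"
    define \<alpha> where "\<alpha> = (if n1 \<le> N then coeff a (N - n1) else 0)"
    define \<beta> where "\<beta> = (if n2 \<le> N then coeff b (N - n2) else 0)"
    have top: "degree (p * q) \<le> N \<and> coeff (p * q) N = (if e \<le> N then coeff p (N - e) else 0) * coeff q e"
      if q: "degree q \<le> e" and p: "p \<noteq> 0 \<Longrightarrow> degree p + e \<le> N" for p q :: "real poly" and e
    proof (cases "p = 0")
      case False
      then have e: "e \<le> N" "degree p \<le> N - e" using p by auto
      have "coeff (cx p * cx q) (N - e + e) = coeff (cx p) (N - e) * coeff (cx q) e"
        using e q by (intro coeff_mult_bounds) auto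
      then have "complex_of_real (coeff (p * q) N) = complex_of_real (coeff p (N - e) * coeff q e)"
        using e by (simp flip: cx_simps)
      then have "coeff (p * q) N = coeff p (N - e) * coeff q e" by (simp only: of_real_eq_iff)
      moreover have "degree (p * q) \<le> N" using degree_mult_le[of p q] q p[OF False] by linarith
      ultimately show ?thesis using e by simp
    qed simp
    have 1: "degree (a * E1 $ i) \<le> N \<and> coeff (a * E1 $ i) N = \<alpha> * coeff (E1 $ i) n1"
      "degree (b * E2 $ i) \<le> N \<and> coeff (b * E2 $ i) N = \<beta> * coeff (E2 $ i) n2" if "i < d" for i
      unfolding \<alpha>_def \<beta>_def using degE[OF that] by (intro top; simp add: N_def)+
    have C_top: "coeff (C $ i) N = \<alpha> * coeff (E1 $ i) n1 + \<beta> * coeff (E2 $ i) n2" "degree (C $ i) \<le> N" if "i < d" for i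
      using 1[OF that] ab that by (auto intro: degree_add_le)
    have nz: "\<alpha> \<noteq> 0 \<or> \<beta> \<noteq> 0"
    proof (cases "a = 0")
      case True
      then have "b \<noteq> 0" "N = degree b + n2" using False by (auto simp: N_def)
      then show ?thesis by (simp add: \<beta>_def)
    next
      case a: False
      show ?thesis
      proof (cases "N = degree a + n1")
        case True
        then show ?thesis using a by (simp add: \<alpha>_def)
      next
        case False
        then have "b \<noteq> 0" "N = degree b + n2" using a by (auto simp: N_def max_def split: if_splits)
        then show ?thesis by (simp add: \<beta>_def)
      qed
    qed
    obtain i j where ij: "i < d" "j < d" "coeff (m12 i j) (n1 + n2) \<noteq> 0" using ex_top_minor by blast
    have cm: "coeff (E1 $ i * E2 $ j) (n1 + n2) = coeff (E1 $ i) n1 * coeff (E2 $ j) n2" if "i < d" "j < d" for i j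
    proof -
      have "coeff (cx (E1 $ i) * cx (E2 $ j)) (n1 + n2) = coeff (cx (E1 $ i)) n1 * coeff (cx (E2 $ j)) n2"
        using degE that by (intro coeff_mult_bounds) simp_all
      then have "complex_of_real (coeff (E1 $ i * E2 $ j) (n1 + n2)) = complex_of_real (coeff (E1 $ i) n1 * coeff (E2 $ j) n2)"
        by (simp flip: cx_simps)
      then show ?thesis by (simp only: of_real_eq_iff)
    qed
    have "\<exists>l<d. coeff (C $ l) N \<noteq> 0"
    proof (rule ccontr)
      assume "\<not> ?thesis"
      then have z: "\<alpha> * coeff (E1 $ l) n1 = - (\<beta> * coeff (E2 $ l) n2)" if "l < d" for l
        using C_top(1)[OF that] that by (simp add: eq_neg_iff_add_eq_0)
      have m: "coeff (m12 i j) (n1 + n2) = coeff (E1 $ i) n1 * coeff (E2 $ j) n2 - coeff (E1 $ j) n1 * coeff (E2 $ i) n2"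
        using cm[OF ij(1,2)] cm[OF ij(2,1)] by simp
      have "\<alpha> * coeff (m12 i j) (n1 + n2) = (\<alpha> * coeff (E1 $ i) n1) * coeff (E2 $ j) n2 - (\<alpha> * coeff (E1 $ j) n1) * coeff (E2 $ i) n2"
        unfolding m by (simp add: algebra_simps)
      also have "\<dots> = 0" unfolding z[OF ij(1)] z[OF ij(2)] by (simp add: algebra_simps)
      finally have a0: "\<alpha> = 0" using ij(3) by simp
      then have "\<beta> * coeff (E2 $ l) n2 = 0" if "l < d" for l using z[OF that] by simp
      from this[OF ij(1)] this[OF ij(2)] have "\<beta> * coeff (m12 i j) (n1 + n2) = 0" unfolding m by auto
      then show False using ij(3) nz a0 by simp
    qed
    then obtain l where l: "l < d" "coeff (C $ l) N \<noteq> 0" by blast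
    have "vdeg C = N"
    proof (rule antisym)
      show "vdeg C \<le> N" unfolding vdeg_def using C_top(2) Cc l(1)
        by (subst Max_le_iff) (auto simp: vec_set_def)
      show "N \<le> vdeg C" using le_degree[OF l(2)] degree_le_vdeg[of l C] l(1) Cc by auto
    qed
    then show ?thesis using C_top(1) by auto
  qed
qed

lemma module_space_inf_eq:
  "module_space_inf d M = {x \<in> carrier_vec d. coeff (dotp d Ac (\<lambda>i. x $ i)) n1 = 0 \<and> coeff (dotp d Bc (\<lambda>i. x $ i)) n2 = 0}"
proof -
  have M_carr: "C \<in> carrier_vec d" if "C \<in> M" for C using that by (simp add: M_eq quasi_span_def)
  have "coeff (dotp d (\<lambda>i. cx (C $ i)) x) (vdeg C) = 0"
    if C: "C \<in> M" and x: "coeff (dotp d Ac x) n1 = 0" "coeff (dotp d Bc x) n2 = 0" for C x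
  proof -
    obtain \<alpha> \<beta> where ab: "\<forall>i<d. coeff (C $ i) (vdeg C) = \<alpha> * coeff (E1 $ i) n1 + \<beta> * coeff (E2 $ i) n2"
      using leading_combination[OF C] by blast
    have "coeff (dotp d (\<lambda>i. cx (C $ i)) x) (vdeg C) =
        complex_of_real \<alpha> * coeff (dotp d Ac x) n1 + complex_of_real \<beta> * coeff (dotp d Bc x) n2"
      using ab by (simp add: coeff_dotp sum_distrib_left distrib_left sum.distrib mult_ac)
    then show ?thesis using x by simp
  qed
  note van = this
  show ?thesis
    unfolding module_space_inf_def
  proof (rule Collect_cong, rule conj_cong[OF refl])
    fix x :: "complex vec" assume x: "x \<in> carrier_vec d"
    show "(\<forall>C\<in>M. leading_vec C \<bullet> x = 0) \<longleftrightarrow> coeff (dotp d Ac (\<lambda>i. x $ i)) n1 = 0 \<and> coeff (dotp d Bc (\<lambda>i. x $ i)) n2 = 0"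
    proof
      assume "\<forall>C\<in>M. leading_vec C \<bullet> x = 0"
      from bspec[OF this E_in_M(1)] bspec[OF this E_in_M(2)]
      show "coeff (dotp d Ac (\<lambda>i. x $ i)) n1 = 0 \<and> coeff (dotp d Bc (\<lambda>i. x $ i)) n2 = 0"
        by (simp only: leading_vec_dot[OF carr(1) x] leading_vec_dot[OF carr(2) x])
    next
      assume z: "coeff (dotp d Ac (\<lambda>i. x $ i)) n1 = 0 \<and> coeff (dotp d Bc (\<lambda>i. x $ i)) n2 = 0"
      show "\<forall>C\<in>M. leading_vec C \<bullet> x = 0"
      proof
        fix C assume C: "C \<in> M"
        show "leading_vec C \<bullet> x = 0" unfolding leading_vec_dot[OF M_carr[OF C] x] using van[OF C] z by blast
      qed
    qed
  qed
qed

text \<open>The resultant of formal degrees \<open>n1\<close> and \<open>n2\<close> also vanishes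
  when both leading coefficients do, and this is membership in the subspace at infinity.\<close>

lemma swept_variety_eq:
  assumes "n1 + n2 > 0"
  shows "swept_variety d M = {x \<in> carrier_vec d. x \<noteq> 0\<^sub>v d \<and> line_family.res d n1 n2 Ac Bc (\<lambda>i. x $ i) = 0}"
proof -
  interpret L: line_family d n1 n2 Ac Bc by (rule line_family[OF assms])
  show ?thesis
    unfolding swept_variety_def module_space_eq module_space_inf_eq L.res_eq_0_iff L.on_line_def by auto
qed

end

section \<open>The curve, its Pluecker map and its fibres\<close>

locale mu_pair_curve = mu_pair +
  fixes E E' :: "real poly vec"
  assumes E': "E' = map_vec pderiv E" and indE: "lin_indep d E E'" and M_E: "M = quasi_span d E E'"
begin

lemma carrE: "E \<in> carrier_vec d" "E' \<in> carrier_vec d"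
  using indE by (auto simp: lin_indep_def)

lemma E_mem: "E \<in> M" "E' \<in> M"
  unfolding M_E using member_quasi_span[OF carrE] member_quasi_span[OF carrE(2,1)] quasi_span_commute[OF carrE] by blast+

text \<open>The factor is the determinant of the coefficients that express \<open>E\<close> and
  \<open>E'\<close> in the mu-basis.\<close>

lemma ex_factor: "\<exists>mu. mu \<noteq> 0 \<and> (\<forall>i<d. \<forall>j<d. minor E E' i j = mu * m12 i j)"
proof -
  obtain a b where ab: "\<forall>i<d. E $ i = a * E1 $ i + b * E2 $ i" using M_coeffs[OF E_mem(1)] by blast
  obtain a' b' where ab': "\<forall>i<d. E' $ i = a' * E1 $ i + b' * E2 $ i" using M_coeffs[OF E_mem(2)] by blast
  have e: "minor E E' i j = (a * b' - a' * b) * m12 i j" if "i < d" "j < d" for i j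
  proof -
    have "E $ i = a * E1 $ i + b * E2 $ i" "E $ j = a * E1 $ j + b * E2 $ j"
      "E' $ i = a' * E1 $ i + b' * E2 $ i" "E' $ j = a' * E1 $ j + b' * E2 $ j" using ab ab' that by auto
    then show ?thesis by (simp add: algebra_simps)
  qed
  obtain i j where "i < d" "j < d" "minor E E' i j \<noteq> 0" using indE lin_indep_iff[OF carrE] by blast
  then have "a * b' - a' * b \<noteq> 0" using e[of i j] by auto
  then show ?thesis using e by blast
qed

definition mu :: "real poly" where
  "mu = (SOME mu. mu \<noteq> 0 \<and> (\<forall>i<d. \<forall>j<d. minor E E' i j = mu * m12 i j))"

lemma mu_props: "mu \<noteq> 0" "\<And>i j. i < d \<Longrightarrow> j < d \<Longrightarrow> minor E E' i j = mu * m12 i j"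
  using someI_ex[OF ex_factor] by (auto simp: mu_def)

lemma vdeg_wedge_E: "vdeg (wedge E E') = degree mu + (n1 + n2)"
proof (rule antisym)
  have "degree (minor E E' i j) \<le> degree mu + (n1 + n2)" if "i < d" "j < d" for i j
    unfolding mu_props(2)[OF that] using degree_mult_le[of mu "m12 i j"] degree_minor[OF that] by linarith
  then show "vdeg (wedge E E') \<le> degree mu + (n1 + n2)" by (simp add: vdeg_wedge_le_iff[OF carrE(1) d1])
  obtain i j where ij: "i < d" "j < d" "coeff (m12 i j) (n1 + n2) \<noteq> 0" using ex_top_minor by blast
  then have "m12 i j \<noteq> 0" by auto
  moreover have "n1 + n2 \<le> degree (m12 i j)" using ij(3) by (rule le_degree)
  ultimately have "degree mu + (n1 + n2) \<le> degree (minor E E' i j)"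
    unfolding mu_props(2)[OF ij(1,2)] using mu_props(1) by (simp add: degree_mult_eq)
  also have "\<dots> \<le> vdeg (wedge E E')"
    using vdeg_wedge_le_iff[OF carrE(1) d1, of E' "vdeg (wedge E E')"] ij(1,2) by blast
  finally show "degree mu + (n1 + n2) \<le> vdeg (wedge E E')" .
qed

lemma degree_dvd_antisym: "degree p = degree q" if "p dvd q" "q dvd p" "p \<noteq> 0" "q \<noteq> 0" for p q :: "real poly"
  using dvd_imp_degree_le[OF that(1,4)] dvd_imp_degree_le[OF that(2,3)] by simp

text \<open>The minors of the mu-basis have a constant gcd, so the gcd for \<open>E\<close> and
  \<open>E'\<close> is \<open>mu\<close> up to a unit.\<close>

lemma degree_Gcd_wedge_E: "degree (Gcd (set\<^sub>v (wedge E E'))) = degree mu"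
proof -
  have "set\<^sub>v (wedge E E') = (*) mu ` set\<^sub>v (wedge E1 E2)"
  proof -
    have "set\<^sub>v (wedge E E') = {mu * m12 i j | i j. i < j \<and> j < d}"
      unfolding set_wedge[OF carrE(1)] using mu_props(2) by (auto; metis less_trans)
    also have "\<dots> = (*) mu ` set\<^sub>v (wedge E1 E2)" unfolding set_wedge[OF carr(1)] by blast
    finally show ?thesis .
  qed
  then have "Gcd (set\<^sub>v (wedge E E')) = normalize (mu * Gcd (set\<^sub>v (wedge E1 E2)))" by (simp add: Gcd_mult)
  moreover define G where "G = Gcd (set\<^sub>v (wedge E1 E2))"
  ultimately have eq: "Gcd (set\<^sub>v (wedge E E')) = normalize (mu * G)" by simp
  have "\<forall>x\<in>set\<^sub>v (wedge E1 E2). G dvd x" unfolding G_def by (intro ballI Gcd_dvd)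
  also have "?this \<longleftrightarrow> (\<forall>i<d. \<forall>j<d. G dvd m12 i j)"
    by (rule all_wedge_iff[OF carr(1)]) (simp_all only: dvd_minus_iff dvd_0_right)
  finally have dv: "G dvd m12 i j" if "i < d" "j < d" for i j using that by blast
  then have deg: "degree G = 0" by (rule no_common_factor)
  have G0: "G \<noteq> 0"
  proof
    assume "G = 0"
    then have "m12 i j = 0" if "i < d" "j < d" for i j using dv[OF that] by (simp only: dvd_0_left_iff)
    then show False using ind lin_indep_iff[OF carr] by blast
  qed
  have "degree (Gcd (set\<^sub>v (wedge E E'))) = degree (mu * G)"
    unfolding eq using mu_props(1) G0 by (intro degree_dvd_antisym) simp_all
  then show ?thesis using mu_props(1) G0 deg by (simp add: degree_mult_eq)
qed

lemma eval_wedge_scalar_iff: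
  "eval_vec s (wedge E E') = c \<cdot>\<^sub>v eval_vec t (wedge E E') \<longleftrightarrow>
    (\<forall>p\<in>I2. poly (cx mu) s * poly (wc p) s = c * (poly (cx mu) t * poly (wc p) t))"
proof -
  have "eval_vec s (wedge E E') = c \<cdot>\<^sub>v eval_vec t (wedge E E') \<longleftrightarrow>
      (\<forall>x\<in>set\<^sub>v (wedge E E'). poly (cx x) s = c * poly (cx x) t)"
    by (auto simp: vec_eq_iff eval_vec_def vec_set_def cx_def)
  also have "\<dots> \<longleftrightarrow> (\<forall>i<d. \<forall>j<d. poly (cx (minor E E' i j)) s = c * poly (cx (minor E E' i j)) t)"
  proof (rule all_wedge_iff[OF carrE(1)])
    fix x :: "real poly" assume "poly (cx x) s = c * poly (cx x) t"
    moreover have "cx (- x) = - cx x" by (simp add: poly_eq_iff)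
    ultimately show "poly (cx (- x)) s = c * poly (cx (- x)) t" by simp
  qed simp
  also have "\<dots> \<longleftrightarrow> (\<forall>p\<in>I2. poly (cx mu) s * poly (wc p) s = c * (poly (cx mu) t * poly (wc p) t))"
  proof -
    have "(poly (cx (minor E E' i j)) s = c * poly (cx (minor E E' i j)) t) \<longleftrightarrow>
      (poly (cx mu) s * poly (wc (i, j)) s = c * (poly (cx mu) t * poly (wc (i, j)) t))" if "i < d" "j < d" for i j
      unfolding mu_props(2)[OF that] wc_def prod.case cx_simps(4)[of mu] poly_mult ..
    then show ?thesis by blast
  qed
  finally show ?thesis .
qed

lemma plucker_dom_eq: "plucker_dom E E' = {t. poly (cx mu) t \<noteq> 0}"
proof -
  have "t \<in> plucker_dom E E' \<longleftrightarrow> poly (cx mu) t \<noteq> 0" for t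
  proof -
    have z: "t \<notin> plucker_dom E E' \<longleftrightarrow> (\<forall>x\<in>set\<^sub>v (wedge E E'). poly (cx x) t = 0)"
      by (auto simp: plucker_dom_def eval_vec_def cx_def)
    also have "\<dots> \<longleftrightarrow> (\<forall>i<d. \<forall>j<d. poly (cx (minor E E' i j)) t = 0)"
    proof (rule all_wedge_iff[OF carrE(1)])
      fix x :: "real poly" assume "poly (cx x) t = 0"
      moreover have "cx (- x) = - cx x" by (simp add: poly_eq_iff)
      ultimately show "poly (cx (- x)) t = 0" by simp
    qed simp
    also have "\<dots> \<longleftrightarrow> (\<forall>i<d. \<forall>j<d. poly (cx mu) t * poly (wc (i, j)) t = 0)"
    proof -
      have "poly (cx (minor E E' i j)) t = poly (cx mu) t * poly (wc (i, j)) t" if "i < d" "j < d" for i j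
        unfolding mu_props(2)[OF that] wc_def prod.case cx_simps(4)[of mu] poly_mult ..
      then show ?thesis by simp
    qed
    also have "\<dots> \<longleftrightarrow> poly (cx mu) t = 0" using wc_nonzero[of t] by auto
    finally show ?thesis by blast
  qed
  then show ?thesis by blast
qed

lemma plucker_map_eq_iff:
  assumes s: "s \<in> plucker_dom E E'" and t: "t \<in> plucker_dom E E'"
  shows "plucker_map E E' s = plucker_map E E' t \<longleftrightarrow> par I2 wc s t"
proof -
  have m: "poly (cx mu) s \<noteq> 0" "poly (cx mu) t \<noteq> 0" using s t by (simp_all add: plucker_dom_eq)
  have "plucker_map E E' s = plucker_map E E' t \<longleftrightarrow> (\<exists>c. c \<noteq> 0 \<and>
      (\<forall>p\<in>I2. poly (cx mu) s * poly (wc p) s = c * (poly (cx mu) t * poly (wc p) t)))"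
    unfolding plucker_map_def proj_point_eq_iff eval_wedge_scalar_iff ..
  also have "\<dots> \<longleftrightarrow> par I2 wc s t"
  proof
    assume "\<exists>c. c \<noteq> 0 \<and> (\<forall>p\<in>I2. poly (cx mu) s * poly (wc p) s = c * (poly (cx mu) t * poly (wc p) t))"
    then obtain c where c: "\<forall>p\<in>I2. poly (cx mu) s * poly (wc p) s = c * (poly (cx mu) t * poly (wc p) t)" by blast
    define r where "r = c * poly (cx mu) t / poly (cx mu) s"
    have r: "poly (wc p) s = r * poly (wc p) t" if "p \<in> I2" for p
      using bspec[OF c that] m by (simp add: r_def field_simps)
    show "par I2 wc s t"
      unfolding par_def
    proof (intro ballI)
      fix p p' assume p: "p \<in> I2" "p' \<in> I2"
      show "poly (wc p) s * poly (wc p') t = poly (wc p') s * poly (wc p) t"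
        unfolding r[OF p(1)] r[OF p(2)] by (simp add: mult_ac)
    qed
  next
    assume p: "par I2 wc s t"
    obtain i j where ij: "i < d" "j < d" "poly (wc (i, j)) t \<noteq> 0" using wc_nonzero by blast
    obtain r where r: "\<forall>p\<in>I2. poly (wc p) s = r * poly (wc p) t"
      using par_scalar[OF p, of "(i, j)"] ij by auto
    have "r \<noteq> 0" using r wc_nonzero[of s] by auto
    then show "\<exists>c. c \<noteq> 0 \<and> (\<forall>p\<in>I2. poly (cx mu) s * poly (wc p) s = c * (poly (cx mu) t * poly (wc p) t))"
      using r m by (intro exI[of _ "poly (cx mu) s * r / poly (cx mu) t"]) simp
  qed
  finally show ?thesis .
qed

lemma degree_pos:
  assumes "plucker_nonconstant E E'"
  shows "n1 + n2 > 0" "\<exists>t u. \<not> par I2 wc t u"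
proof -
  show ex: "\<exists>t u. \<not> par I2 wc t u"
    using assms plucker_map_eq_iff unfolding plucker_nonconstant_def by blast
  show "n1 + n2 > 0"
  proof (rule ccontr)
    assume z: "\<not> n1 + n2 > 0"
    have c: "poly (wc p) s = poly (wc p) t" if "p \<in> I2" for p s t
    proof -
      obtain i j where p: "p = (i, j)" "i < d" "j < d" using \<open>p \<in> I2\<close> by auto
      have "degree (m12 i j) = 0" using degree_minor[OF p(2,3)] z by linarith
      then have "degree (wc p) = 0" by (simp only: p(1) wc_def prod.case degree_cx)
      then obtain c where "wc p = [:c:]" by (rule degree_eq_zeroE)
      then show ?thesis by simp
    qed
    have "par I2 wc t u" for t u
      unfolding par_def
    proof (intro ballI)
      fix p p' assume "p \<in> I2" "p' \<in> I2"
      then show "poly (wc p) t * poly (wc p') u = poly (wc p') t * poly (wc p) u"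
        using c[of p t u] c[of p' t u] by simp
    qed
    then show False using ex by blast
  qed
qed

text \<open>Common zeros of the entries of \<open>E\<close> are removed by dividing out their gcd
  \<open>h\<close>. Both \<open>Et\<close> and its derivative stay in \<open>M\<close>, since
  \<open>h\<close> times the derivative is \<open>E'\<close> minus a multiple of \<open>Et\<close>;
  \<open>l\<close> is the determinant of their coefficients in the mu-basis.\<close>

lemma tangent_family:
  assumes nc: "plucker_nonconstant E E'"
  shows "\<exists>Ev lam. tangent_family d n1 n2 Ac Bc Ev lam"
proof -
  interpret L: line_family d n1 n2 Ac Bc by (rule line_family[OF degree_pos(1)[OF nc]])
  define S where "S = set\<^sub>v E"
  define h where "h = Gcd S"
  define Et where "Et = vec d (\<lambda>i. E $ i div h)"
  have inS: "E $ i \<in> S" if "i < d" for i using that carrE(1) by (auto simp: S_def vec_set_def)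
  have hE: "E $ i = h * Et $ i" if "i < d" for i
    using Gcd_dvd[OF inS[OF that]] that by (simp add: Et_def h_def)
  obtain i0 j0 where ij0: "i0 < d" "j0 < d" "minor E E' i0 j0 \<noteq> 0" using indE lin_indep_iff[OF carrE] by blast
  have h0: "h \<noteq> 0"
  proof
    assume "h = 0"
    then have "E $ i0 = 0" "E $ j0 = 0" using hE ij0 by auto
    then show False using ij0(3) by simp
  qed
  have Et_carr: "Et \<in> carrier_vec d" by (simp add: Et_def)
  have Et_M: "Et \<in> M"
  proof -
    obtain a b where "\<forall>i<d. E $ i = a * E1 $ i + b * E2 $ i" using M_coeffs[OF E_mem(1)] by blast
    then have "\<forall>i<d. h * Et $ i = a * E1 $ i + b * E2 $ i" using hE by metis
    then show ?thesis unfolding M_eq quasi_span_iff[OF carr] using Et_carr h0 by blast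
  qed
  obtain a b where ab: "\<forall>i<d. Et $ i = a * E1 $ i + b * E2 $ i" using M_coeffs[OF Et_M] by blast
  obtain a' b' where ab': "\<forall>i<d. E' $ i = a' * E1 $ i + b' * E2 $ i" using M_coeffs[OF E_mem(2)] by blast
  have E'_eq: "E' $ i = pderiv h * Et $ i + h * pderiv (Et $ i)" if "i < d" for i
  proof -
    have "E' $ i = pderiv (h * Et $ i)" using that carrE(1) hE[OF that] by (simp add: E')
    then show ?thesis by (simp add: pderiv_mult algebra_simps)
  qed
  define D where "D = vec d (\<lambda>i. pderiv (Et $ i))"
  have hD: "h * D $ i = (a' - pderiv h * a) * E1 $ i + (b' - pderiv h * b) * E2 $ i" if "i < d" for i
  proof -
    have "h * D $ i = E' $ i - pderiv h * Et $ i" using E'_eq[OF that] that by (simp add: D_def)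
    also have "\<dots> = (a' * E1 $ i + b' * E2 $ i) - pderiv h * (a * E1 $ i + b * E2 $ i)" using ab ab' that by simp
    finally show ?thesis by (simp add: algebra_simps)
  qed
  have "D \<in> M" unfolding M_eq quasi_span_iff[OF carr] using hD h0 by (intro conjI) (simp add: D_def, blast)
  then obtain p q where pq: "\<forall>i<d. D $ i = p * E1 $ i + q * E2 $ i" using M_coeffs by blast
  define l where "l = a * q - p * b"
  have W: "Et $ i * pderiv (Et $ j) - Et $ j * pderiv (Et $ i) = l * m12 i j" if ij: "i < d" "j < d" for i j
  proof -
    have e: "Et $ i = a * E1 $ i + b * E2 $ i" "Et $ j = a * E1 $ j + b * E2 $ j"
      "D $ i = p * E1 $ i + q * E2 $ i" "D $ j = p * E1 $ j + q * E2 $ j" using ab pq ij by auto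
    have "Et $ i * pderiv (Et $ j) - Et $ j * pderiv (Et $ i) = Et $ i * D $ j - Et $ j * D $ i"
      using ij by (simp add: D_def)
    also have "\<dots> = l * m12 i j" unfolding e l_def by (simp add: algebra_simps)
    finally show ?thesis .
  qed
  have l0: "l \<noteq> 0"
  proof
    assume "l = 0"
    then have z: "Et $ i0 * pderiv (Et $ j0) - Et $ j0 * pderiv (Et $ i0) = 0" using W[OF ij0(1,2)] by simp
    have "minor E E' i0 j0 = h ^ 2 * (Et $ i0 * pderiv (Et $ j0) - Et $ j0 * pderiv (Et $ i0))"
      unfolding hE[OF ij0(1)] hE[OF ij0(2)] E'_eq[OF ij0(1)] E'_eq[OF ij0(2)] by (simp add: algebra_simps power2_eq_square)
    then show False using z ij0(3) by simp
  qed
  have "tangent_family d n1 n2 Ac Bc (\<lambda>i. cx (Et $ i)) (cx l)"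
  proof
    show "cx l \<noteq> 0" using l0 by simp
    show "wronskian (cx (Et $ i)) (cx (Et $ j)) = cx l * L.w (i, j)" if "i < d" "j < d" for i j
    proof -
      have "wronskian (cx (Et $ i)) (cx (Et $ j)) = cx (Et $ i * pderiv (Et $ j) - Et $ j * pderiv (Et $ i))"
        by (simp add: wronskian_def cx_pderiv)
      then show ?thesis unfolding W[OF that] by (simp add: L.w_def)
    qed
    show "\<exists>i<d. poly (cx (Et $ i)) t \<noteq> 0" for t
    proof (rule ccontr)
      assume z: "\<not> ?thesis"
      obtain g where g: "degree g > 0" "\<forall>p. poly (cx p) t = 0 \<longrightarrow> g dvd p" using ex_real_min_poly by blast
      \<comment> \<open>A common zero of the entries of \<open>Et\<close> gives a nonconstant real
        \<open>g\<close> such that even \<open>h * g\<close> divides all entries of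
        \<open>E\<close>.\<close>
      have "h * g dvd h"
        unfolding h_def[of] 
      proof (rule Gcd_greatest)
        fix x assume "x \<in> S"
        then obtain i where i: "i < d" "x = E $ i" using carrE(1) by (auto simp: S_def vec_set_def)
        have "g dvd Et $ i" using z g(2) i(1) by blast
        then show "Gcd S * g dvd x" unfolding i(2) hE[OF i(1)] h_def by (rule mult_dvd_mono[OF dvd_refl])
      qed
      then have "h * g dvd h * 1" by simp
      then have "g dvd 1" using h0 dvd_mult_cancel_left[of h g 1] by blast
      then show False using g(1) by (simp add: poly_dvd_1)
    qed
    show "\<exists>t u. \<not> par L.I2 L.w t u"
      using degree_pos(2)[OF nc] by (simp add: w_eq_wc[OF degree_pos(1)[OF nc]])
  qed
  then show ?thesis by blast
qed

text \<open>Exceptional image points come from \<open>Z\<close> or from fibres that lose a parameter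
  to the zeros of \<open>mu\<close>, finitely many in all. As the image is infinite, no other number
  can fit the generic fibre.\<close>

lemma plucker_degree_eq:
  assumes nc: "plucker_nonconstant E E'" and Z: "finite Z"
    and fib: "\<And>u. u \<notin> Z \<Longrightarrow> finite {t. par I2 wc t u} \<and> card {t. par I2 wc t u} = k"
  shows "plucker_degree E E' = k"
proof -
  interpret L: line_family d n1 n2 Ac Bc by (rule line_family[OF degree_pos(1)[OF nc]])
  note w = w_eq_wc[OF degree_pos(1)[OF nc]]
  note sym = L.par_w_sym[unfolded w] and trans = L.par_w_trans[unfolded w]
  let ?dom = "plucker_dom E E'" and ?map = "plucker_map E E'"
  let ?F = "\<lambda>u. {t. par I2 wc t u}"
  define N where "N = {t. poly (cx mu) t = 0}"
  have finN: "finite N" unfolding N_def using mu_props(1) by (intro poly_roots_finite) simp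
  have dom: "?dom = - N" by (auto simp: plucker_dom_eq N_def)
  \<comment> \<open>Fibres over points of \<open>Z\<close> are finite too: an infinite one would
    contain a parameter outside \<open>Z\<close>, which has the same fibre.\<close>
  have fin: "finite (?F u)" for u
  proof (rule ccontr)
    assume inf: "infinite (?F u)"
    then have "infinite (?F u - Z)" using Z by simp
    then obtain v where v: "par I2 wc v u" "v \<notin> Z" 
      by (metis (no_types, lifting) Diff_iff finite.emptyI mem_Collect_eq ex_in_conv)
    have "?F u \<subseteq> ?F v" using trans[OF _ sym[OF v(1)]] by blast
    then show False using fib[OF v(2)] inf finite_subset by blast
  qed
  define Bad where "Bad = Z \<union> (\<Union>z\<in>N. ?F z)"
  have finBad: "finite Bad" unfolding Bad_def using Z finN fin by blast
  have fibre: "{t \<in> ?dom. ?map t = ?map u} = ?F u \<inter> ?dom" if "u \<in> ?dom" for u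
    using plucker_map_eq_iff that by blast
  have good: "finite {t \<in> ?dom. ?map t = ?map u} \<and> card {t \<in> ?dom. ?map t = ?map u} = k" if u: "u \<in> ?dom" "u \<notin> Bad" for u
  proof -
    have "?F u \<subseteq> ?dom"
    proof
      fix t assume t: "t \<in> ?F u"
      show "t \<in> ?dom"
      proof (rule ccontr)
        assume "t \<notin> ?dom"
        then have "t \<in> N" by (simp add: dom)
        moreover have "u \<in> ?F t" using t sym by simp
        ultimately show False using u(2) by (auto simp: Bad_def)
      qed
    qed
    then have "{t \<in> ?dom. ?map t = ?map u} = ?F u" using fibre[OF u(1)] by blast
    moreover have "u \<notin> Z" using u(2) by (simp add: Bad_def)
    ultimately show ?thesis using fib by simp
  qed
  let ?ok = "\<lambda>k. finite {p \<in> ?map ` ?dom. \<not> (finite {t \<in> ?dom. ?map t = p} \<and> card {t \<in> ?dom. ?map t = p} = k)}"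
  have "{p \<in> ?map ` ?dom. \<not> (finite {t \<in> ?dom. ?map t = p} \<and> card {t \<in> ?dom. ?map t = p} = k)} \<subseteq> ?map ` Bad"
    using good by blast
  then have ok: "?ok k" using finBad finite_subset by blast
  have inf: "infinite (?map ` ?dom)"
  proof
    assume f: "finite (?map ` ?dom)"
    have "finite (\<Union>p\<in>?map ` ?dom. {t \<in> ?dom. ?map t = p})"
    proof (rule finite_UN_I[OF f])
      fix p assume "p \<in> ?map ` ?dom"
      then obtain u where "u \<in> ?dom" "p = ?map u" by blast
      then show "finite {t \<in> ?dom. ?map t = p}" using fibre fin by simp
    qed
    moreover have "?dom \<subseteq> (\<Union>p\<in>?map ` ?dom. {t \<in> ?dom. ?map t = p})" by blast
    ultimately have "finite ?dom" using finite_subset by blast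
    then have "finite (UNIV :: complex set)" using finN dom by (metis Compl_partition2 finite_UnI)
    then show False using infinite_UNIV_char_0 by blast
  qed
  have uniq: "k' = k" if ok': "?ok k'" for k'
  proof (rule ccontr)
    assume ne: "k' \<noteq> k"
    have "?map ` ?dom \<subseteq> {p \<in> ?map ` ?dom. \<not> (finite {t \<in> ?dom. ?map t = p} \<and> card {t \<in> ?dom. ?map t = p} = k)}
       \<union> {p \<in> ?map ` ?dom. \<not> (finite {t \<in> ?dom. ?map t = p} \<and> card {t \<in> ?dom. ?map t = p} = k')}" using ne by blast
    then show False using inf ok ok' finite_subset by blast
  qed
  show ?thesis unfolding plucker_degree_def
    by (rule the_equality[where P = ?ok]) (use ok uniq in blast)+
qed

text \<open>The swept variety is the zero set of \<open>P\<close>, because \<open>P\<close> and the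
  resultant have the same zeros. Any other irreducible equation vanishes on all the subspaces, so it
  is a constant multiple of \<open>P\<close>; the degree and the power statement carry over.\<close>

theorem implicit_equation_of_swept_variety:
  assumes nc: "plucker_nonconstant E E'"
  shows "plucker_degree E E' * hypersurface_degree d (swept_variety d M) = n1 + n2"
    "\<exists>F :: real mpoly. implicit_equation d (swept_variety d M) (cmpoly F)"
    "\<And>F. implicit_equation d (swept_variety d M) F \<Longrightarrow>
      \<exists>c. c \<noteq> 0 \<and> cmpoly (resultant_sub n1 n2 (moving_form E1) (moving_form E2)) = MConst c * F ^ plucker_degree E E'"
proof -
  define V where "V = swept_variety d M"
  define Rr where "Rr = resultant_sub n1 n2 (moving_form E1) (moving_form E2)"
  note pos = degree_pos(1)[OF nc]
  obtain Ev lam where "tangent_family d n1 n2 Ac Bc Ev lam" using tangent_family[OF nc] by blast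
  then interpret T: tangent_family d n1 n2 Ac Bc Ev lam .
  obtain k m P Z c where *: "k > 0" "finite Z"
    "\<forall>u. u \<notin> Z \<longrightarrow> finite {t. par I2 T.w t u} \<and> card {t. par I2 T.w t u} = k"
    "k * m = n1 + n2" "m > 0" "is_form d m P" "irreducible P" "c \<noteq> 0" "T.R = MConst c * P ^ k"
    "\<forall>F. vars_below d F \<longrightarrow> (\<forall>t x. T.on_line t x \<longrightarrow> mev F x = 0) \<longrightarrow> P dvd F"
    "\<forall>F e. is_form d e F \<longrightarrow> irreducible F \<longrightarrow>
      (\<forall>t x. T.on_line t x \<longrightarrow> (\<exists>i<d. x i \<noteq> 0) \<longrightarrow> mev F x = 0) \<longrightarrow> (\<exists>c. c \<noteq> 0 \<and> F = MConst c * P)"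
    using T.implicitization by (elim exE conjE)
  have kk: "plucker_degree E E' = k"
    by (rule plucker_degree_eq[OF nc *(2)]) (use *(3) w_eq_wc[OF pos] in simp)
  have R_eq: "cmpoly Rr = T.R"
    unfolding Rr_def T.R_def hom_resultant_sub[OF comm_ring_hom_cmpoly]
      map_poly_cmpoly_moving_form[OF carr(1)] map_poly_cmpoly_moving_form[OF carr(2)] ..
  have P0: "mev P x = 0 \<longleftrightarrow> T.res x = 0" for x
  proof -
    have "T.res x = mev T.R x" by (simp only: T.mev_R)
    also have "\<dots> = c * mev P x ^ k" by (simp add: *(9))
    finally show ?thesis using *(1,8) by simp
  qed
  have V_eq: "V = proj_zeros d P"
    unfolding V_def swept_variety_eq[OF pos] proj_zeros_def meval_eq_mev P0 ..
  \<comment> \<open>A zero set of one form is already closed.\<close>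
  have closure: "zariski_closure d V = V"
  proof (intro equalityI subsetI)
    fix x assume x: "x \<in> zariski_closure d V"
    have "meval P x = 0" using x *(6) unfolding zariski_closure_def V_eq by blast
    then show "x \<in> V" using x by (simp add: V_eq zariski_closure_def proj_zeros_def)
  next
    fix x assume "x \<in> V"
    then show "x \<in> zariski_closure d V" by (auto simp: zariski_closure_def V_eq proj_zeros_def)
  qed
  have imp_P: "implicit_equation d V P"
    unfolding implicit_equation_def closure using *(6,7) V_eq by blast
  have uniq: "\<exists>c. c \<noteq> 0 \<and> F = MConst c * P" if F: "implicit_equation d V F" for F
  proof -
    obtain e where e: "is_form d e F" "irreducible F" "proj_zeros d F = V"
      using F by (auto simp: implicit_equation_def closure)
    have "mev F x = 0" if x: "T.on_line t x" "\<exists>i<d. x i \<noteq> 0" for t x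
    proof -
      have "T.res x = 0" using x(1) T.res_eq_0_iff by blast
      then have "mev P x = 0" by (simp only: P0)
      then have "mev P (\<lambda>i. vec d x $ i) = 0" by (subst mev_cong[OF is_form_vars_below[OF *(6)], of _ x]) simp_all
      moreover have "vec d x \<noteq> 0\<^sub>v d" using x(2) by (auto simp: vec_eq_iff)
      ultimately have "vec d x \<in> proj_zeros d F" unfolding e(3) V_eq by (simp add: proj_zeros_def meval_eq_mev)
      then have "mev F (\<lambda>i. vec d x $ i) = 0" by (simp add: proj_zeros_def meval_eq_mev)
      then show ?thesis by (subst mev_cong[OF is_form_vars_below[OF e(1)], of _ "\<lambda>i. vec d x $ i"]) simp_all
    qed
    then show ?thesis using *(11) e(1,2) by blast
  qed
  have Pnz: "P \<noteq> 0" using *(7) by (auto simp: irreducible_def)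
  have "hypersurface_degree d V = m"
    unfolding hypersurface_degree_def
  proof (rule the_equality)
    show "\<exists>F. implicit_equation d V F \<and> is_form d m F" using imp_P *(6) by blast
    fix e assume "\<exists>F. implicit_equation d V F \<and> is_form d e F"
    then obtain F where F: "implicit_equation d V F" "is_form d e F" by blast
    obtain g where g: "g \<noteq> 0" "F = MConst g * P" using uniq[OF F(1)] by blast
    have "is_form d (0 + m) F" unfolding g(2) by (intro is_form_mult is_form_simps *(6))
    moreover have "F \<noteq> 0" using F(1) by (auto simp: implicit_equation_def irreducible_def)
    ultimately show "e = m" using is_form_unique[OF F(2)] by simp
  qed
  then show "plucker_degree E E' * hypersurface_degree d (swept_variety d M) = n1 + n2"
    using *(4) kk by (simp add: V_def)
  show "\<exists>c. c \<noteq> 0 \<and> cmpoly (resultant_sub n1 n2 (moving_form E1) (moving_form E2)) = MConst c * F ^ plucker_degree E E'"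
    if F: "implicit_equation d (swept_variety d M) F" for F
  proof -
    obtain g where g: "g \<noteq> 0" "F = MConst g * P" using uniq F unfolding V_def by blast
    have "cmpoly Rr = MConst c * P ^ k" using R_eq *(9) by simp
    also have "\<dots> = MConst (c / g ^ k) * (MConst (g ^ k) * P ^ k)"
      using g(1) by (simp add: mult.assoc[symmetric] MConst_simps(4)[symmetric])
    also have "\<dots> = MConst (c / g ^ k) * F ^ k" by (simp add: g(2) power_mult_distrib MConst_power)
    finally have "cmpoly Rr = MConst (c / g ^ k) * F ^ k" .
    moreover have "c / g ^ k \<noteq> 0" using *(8) g(1) by simp
    ultimately show ?thesis unfolding Rr_def kk by blast
  qed
  text \<open>The resultant is real, so \<open>P\<close> is proportional to its conjugate; dividing \<open>P\<close> by one of its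
    coefficients makes it real.\<close>
  have conj_van: "mev (mconj P) x = 0" if "T.on_line t x" for t x
  proof -
    have "mev T.R x = 0" using that T.res_eq_0_iff T.mev_R by auto
    then have "mev (mconj T.R) x = 0" unfolding R_eq[symmetric] mconj_cmpoly .
    then have "T.res (\<lambda>i. cnj (x i)) = 0" by (simp add: mev_mconj T.mev_R)
    then show ?thesis by (simp add: mev_mconj P0)
  qed
  have form_conj: "is_form d m (mconj P)" using *(6) by (simp add: is_form_def keys_mconj)
  obtain K where K: "mconj P = P * K" using *(10) is_form_vars_below[OF form_conj] conj_van by blast
  have cP0: "mconj P \<noteq> 0" using Pnz keys_mconj[of P] by (metis keys_eq_empty)
  obtain e1 e2 where e: "is_form d e1 P" "is_form d e2 K" "e1 + e2 = m"
    using is_form_factor[of d m P K] form_conj cP0 K by auto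
  have "e1 = m" by (rule is_form_unique[OF e(1) *(6) Pnz])
  then have "is_form d 0 K" using e by simp
  then obtain g where g: "K = MConst g" using is_form_0_const by blast
  have coef: "cnj (Poly_Mapping.lookup P \<nu>) = g * Poly_Mapping.lookup P \<nu>" for \<nu>
  proof -
    have "cnj (Poly_Mapping.lookup P \<nu>) = Poly_Mapping.lookup (MConst g * P) \<nu>"
      using arg_cong[OF K, of "\<lambda>F. Poly_Mapping.lookup F \<nu>"] by (simp add: lookup_map_zero g mult.commute)
    also have "\<dots> = g * Poly_Mapping.lookup P \<nu>"
      unfolding MConst_def mult_map_scale_conv_mult[symmetric] by (simp add: lookup_map_zero)
    finally show ?thesis .
  qed
  obtain \<nu>0 where \<nu>0: "Poly_Mapping.lookup P \<nu>0 \<noteq> 0" using Pnz by (metis keys_eq_empty ex_in_conv in_keys_iff)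
  define p0 where "p0 = Poly_Mapping.lookup P \<nu>0"
  have p0: "p0 \<noteq> 0" using \<nu>0 by (simp add: p0_def)
  define F where "F = Poly_Mapping.map (\<lambda>z. Re (z / p0)) P"
  have g0: "g \<noteq> 0" using coef[of \<nu>0] p0 by (auto simp: p0_def)
  have "cmpoly F = MConst (inverse p0) * P"
  proof (rule poly_mapping_eqI)
    fix \<nu>
    have "cnj (Poly_Mapping.lookup P \<nu> / p0) = Poly_Mapping.lookup P \<nu> / p0"
      using coef[of \<nu>] coef[of \<nu>0] g0 by (simp add: p0_def)
    then have "Poly_Mapping.lookup P \<nu> / p0 \<in> \<real>" using Reals_cnj_iff by blast
    then have r: "complex_of_real (Re (Poly_Mapping.lookup P \<nu> / p0)) = Poly_Mapping.lookup P \<nu> / p0" by (rule of_real_Re)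
    have "Poly_Mapping.lookup (cmpoly F) \<nu> = complex_of_real (Re (Poly_Mapping.lookup P \<nu> / p0))"
      unfolding cmpoly_def F_def by (simp add: lookup_map_zero)
    also have "\<dots> = Poly_Mapping.lookup (MConst (inverse p0) * P) \<nu>"
      unfolding r MConst_def mult_map_scale_conv_mult[symmetric] by (simp add: lookup_map_zero field_simps)
    finally show "Poly_Mapping.lookup (cmpoly F) \<nu> = Poly_Mapping.lookup (MConst (inverse p0) * P) \<nu>" .
  qed
  moreover have "implicit_equation d V (MConst (inverse p0) * P)"
    unfolding implicit_equation_def closure
  proof (intro conjI)
    show "\<exists>e. is_form d e (MConst (inverse p0) * P)" using is_form_mult[OF is_form_simps(2) *(6)] by blast
    have u: "MConst (inverse p0) dvd (1 :: complex mpoly)" using p0 by (intro MConst_dvd_1) simp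
    then show "irreducible (MConst (inverse p0) * P)" using *(7) by (simp add: irreducible_mult_unit_left)
    show "proj_zeros d (MConst (inverse p0) * P) = V" unfolding V_eq proj_zeros_def meval_eq_mev using p0 by simp
  qed
  ultimately show "\<exists>F :: real mpoly. implicit_equation d (swept_variety d M) (cmpoly F)"
    unfolding V_def by metis
qed

end

theorem proposition19:
  fixes e0 e1 e2 e3 e4 :: "real poly" and E E' E1 E2 :: "real poly vec"
    and V :: "complex vec set" and k :: nat
  assumes E: "E = spine_vec e0 e1 e2 e3 e4"
    and E': "E' = map_vec pderiv E"
    and V: "V = dual_variety e0 e1 e2 e3 e4"
    and k: "k = plucker_degree E E'"
    and gcd_e: "Gcd {e0, e1, e2, e3, e4} = 1"
    and indep: "lin_indep 6 E E'"
    and nonconst: "plucker_nonconstant E E'"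
    and mu: "mu_basis 6 E1 E2 (quasi_span 6 E E')"
  shows "k * hypersurface_degree 6 V = vdeg E1 + vdeg E2 \<and>
    int (vdeg E1 + vdeg E2) =
      int (vdeg (wedge E E')) - int (degree (Gcd (set\<^sub>v (wedge E E')))) \<and>
    (\<exists>F :: real mpoly. implicit_equation 6 V (cmpoly F)) \<and>
    (\<forall>F. implicit_equation 6 V F \<longrightarrow>
      (\<exists>c. c \<noteq> 0 \<and>
        cmpoly (resultant_sub (vdeg E1) (vdeg E2) (moving_form E1) (moving_form E2))
          = MConst c * F ^ k))"
proof -
  interpret mu_pair_curve 6 "quasi_span 6 E E'" E1 E2 E E'
    by standard (use mu E' indep in auto)
  have V_eq: "V = swept_variety 6 (quasi_span 6 E E')"
    by (simp only: V dual_variety_def E' E)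
  show ?thesis
    unfolding k V_eq using implicit_equation_of_swept_variety[OF nonconst]
    by (simp add: vdeg_wedge_E degree_Gcd_wedge_E)
qed

end
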